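(* Let $k\ge 2$ be an integer, let $f\in L^2(\Omega)$ and $g,g_n\in L^2(\partial\Omega)$, and let $V_h$, $V_h^0$, $V_h(T)$ and $a(\cdot,\cdot)$ be the weak Galerkin spaces and bilinear form (with polynomial degree $k$) described in the context. Let $u_h=\{u_0,u_b,u_n\}\in V_h$ be the solution of the weak Galerkin method: $u_b=Q_b g$ and $u_n=Q_b g_n\,(\mathbf n\cdot\mathbf n_e)$ on $\partial\Omega$, and $$a(u_h,v)=(f,v_0)\qquad\text{for all } v=\{v_0,v_b,v_n\}\in V_h^0 .$$ Let $w_h=\{w_0,w_b,w_n\}\in V_h$ be the solution of the Schur complement formulation: $w_b=Q_b g$ and $w_n=Q_b g_n\,(\mathbf n\cdot\mathbf n_e)$ on $\partial\Omega$, together with the global equation $$a(w_h,v)=0\qquad\text{for all } v=\{0,v_b,v_n\}\in V_h^0,$$ and, on each element $T\in\mathcal T_h$, the local system $$a(w_h,v)=(f,v_0)\qquad\text{for all } v=\{v_0,0,0\}\in V_h(T).$$ Then $w_h=u_h$.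
   Context: Setting: $\Omega\subset\mathbb R^d$ ($d=2$ or $3$) is a bounded polygonal/polyhedral domain. The methods approximate the biharmonic problem $\Delta^2u=f$ in $\Omega$, $u=g$ and $\partial u/\partial n=g_n$ on $\partial\Omega$. $\mathcal T_h$ is a finite partition of $\Omega$ into polygons (2D) or polyhedra (3D); $h_T$ is the diameter of $T\in\mathcal T_h$; $\mathcal E_h$ is the set of all edges (2D) or flat faces (3D) of $\mathcal T_h$. $(\cdot,\cdot)_T$, $\langle\cdot,\cdot\rangle_{\partial T}$ and $(\cdot,\cdot)$ are the $L^2$ inner products on $T$, $\partial T$ and $\Omega$. $P_r(T)$, $P_r(e)$ denote polynomials of degree at most $r$ on $T$, $e$. Shape regularity of $\mathcal T_h$ means that there are positive constants $\rho_v,\rho_e,\kappa,\sigma^*,\gamma_*$ and $\theta_0<\pi/2$ such that, for every $T\in\mathcal T_h$ and every edge/face $e$ of $T$ (with diameter $h_e$): $\rho_v h_T^d\le |T|$ and $\rho_e h_e^{d-1}\le|e|$; $\kappa h_T\le h_e$; $T$ contains a pyramid with base $e$, apex $A_e\in T$ and height at least $\sigma^* h_T$, such that for every $x_e\in e$ the angle between $x_e-A_e$ and the outward normal of $e$ is at most $\theta_0$; and $T$ has a circumscribed shape-regular simplex $S(T)$ of diameter at most $\gamma_* h_T$, each $S(T)$ meeting only a bounded number of other such simplices. $\mathcal T_h$ is assumed shape regular in this sense. For each $e\in\mathcal E_h$ a unit normal $\mathbf n_e$ to $e$ is fixed once and for all. $\mathbf n$ denotes the outward unit normal on $\partial T$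 (respectively on $\partial\Omega$). Spaces: $V_h$ is the space of triples $v=\{v_0,v_b,v_n\}$ with $v_0|_T\in P_k(T)$ for each $T\in\mathcal T_h$ (no continuity between elements), and $v_b|_e\in P_{k-1}(e)$, $v_n|_e\in P_{k-1}(e)$ for each $e\in\mathcal E_h$; $v_b$ and $v_n$ are single valued on each $e$, and $v_n$ plays the role of $\nabla v\cdot\mathbf n_e$. $V_h^0=\{v\in V_h: v_b|_e=0,\ v_n|_e=0 \text{ for all } e\subset\partial\Omega\}$. For $T\in\mathcal T_h$, $V_h(T)=\{v=\{v_0,v_b,v_n\}\in V_h^0: v(\mathbf x)=0 \text{ for } \mathbf x\notin T\}$; in particular its elements of the form $\{v_0,0,0\}$ are those with $v_0\in P_k(T)$ extended by zero outside $T$. Projection: $Q_b$ is the $L^2$ projection onto $P_{k-1}(e)$ on each $e\in\mathcal E_h$. Discrete weak Laplacian: for $v\in V_h$ and $T\in\mathcal T_h$, $\Delta_w v|_T\in P_{k-2}(T)$ is the unique polynomial with $$(\Delta_w v,\varphi)_T=(v_0,\Delta\varphi)_T-\langle v_b,\nabla\varphi\cdot\mathbf n\rangle_{\partial T}+\langle v_n\,\mathbf n_e\cdot\mathbf n,\varphi\rangle_{\partial T}\qquad\forall\varphi\in P_{k-2}(T).$$ Bilinear form: for $v,w\in V_h$, $$s(v,w)=\sum_{T\in\mathcal T_h}h_T^{-1}\langle\nabla v_0\cdot\mathbf n_e-v_n,\ \nabla w_0\cdot\mathbf n_e-w_n\rangle_{\partial T}+\sum_{T\in\mathcal T_h}h_T^{-3}\langle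 Q_bv_0-v_b,\ Q_bw_0-w_b\rangle_{\partial T},$$ $$a(v,w)=\sum_{T\in\mathcal T_h}(\Delta_wv,\Delta_ww)_T+s(v,w).$$ On $\partial T$, $\nabla v_0$ and $v_0$ denote traces taken from inside $T$. *)

theory Defs
  imports "HOL-Analysis.Analysis"
begin

section \<open>Polygonal and polyhedral sets\<close>

text \<open>
  An \<open>m\<close>-dimensional polyhedral cell is a finite union of \<open>m\<close>-dimensional convex polytopes lying in
  one \<open>m\<close>-dimensional affine space, with connected relative interior; it need not be convex.
  With \<open>m = d\<close> these are the (closed) polygons/polyhedra, with \<open>m = d - 1\<close> the edges
  (for \<open>d = 2\<close> exactly the nondegenerate closed segments) or flat faces.
\<close>
definition polyhedral_cell :: "int \<Rightarrow> (real^'n) set \<Rightarrow> bool" where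
  "polyhedral_cell m S \<longleftrightarrow>
     (\<exists>\<P>. finite \<P> \<and> (\<forall>p\<in>\<P>. polytope p \<and> aff_dim p = m) \<and> S = \<Union>\<P>)
     \<and> aff_dim S = m \<and> connected (rel_interior S)"

text \<open>The condition \<open>\<Omega> = interior (closure \<Omega>)\<close> rules out slits: a domain lies locally on one side
  of (almost every point of) its boundary.\<close>
definition polyhedral_domain :: "(real^'n) set \<Rightarrow> bool" where
  "polyhedral_domain \<Omega> \<longleftrightarrow>
     connected \<Omega> \<and> \<Omega> = interior (closure \<Omega>) \<and> polyhedral_cell (int CARD('n)) (closure \<Omega>)"

text \<open>The edges/faces in \<open>\<E>\<close> of an element, or those on the boundary of the domain.\<close>
definition faces_on :: "(real^'n) set set \<Rightarrow> (real^'n) set \<Rightarrow> (real^'n) set set" where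
  "faces_on \<E> S = {e \<in> \<E>. e \<subseteq> frontier S}"

text \<open>
  A partition \<open>\<T>\<close> of \<open>\<Omega>\<close> into closed elements together with its set \<open>\<E>\<close> of edges/faces. A straight
  side of an element may consist of several members of \<open>\<E>\<close>, as happens at a hanging node;
  every member of \<open>\<E>\<close> is either an entire common edge/face of two elements or lies on the boundary.
\<close>
definition polyhedral_mesh ::
  "(real^'n) set \<Rightarrow> (real^'n) set set \<Rightarrow> (real^'n) set set \<Rightarrow> bool" where
  "polyhedral_mesh \<Omega> \<T> \<E> \<longleftrightarrow>
     finite \<T> \<and> (\<forall>T\<in>\<T>. polyhedral_cell (int CARD('n)) T)
     \<and> \<Union>\<T> = closure \<Omega>
     \<and> (\<forall>T\<in>\<T>. \<forall>T'\<in>\<T>. T \<noteq> T' \<longrightarrow> interior T \<inter> interior T' = {})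
     \<and> finite \<E> \<and> (\<forall>e\<in>\<E>. polyhedral_cell (int CARD('n) - 1) e)
     \<and> (\<forall>e\<in>\<E>. \<forall>e'\<in>\<E>. e \<noteq> e' \<longrightarrow> rel_interior e \<inter> rel_interior e' = {})
     \<and> (\<forall>e\<in>\<E>. \<exists>T\<in>\<T>. e \<in> faces_on \<E> T)
     \<and> (\<forall>T\<in>\<T>. frontier T = \<Union>(faces_on \<E> T))"

definition unit_normal :: "(real^'n) set \<Rightarrow> real^'n \<Rightarrow> bool" where
  "unit_normal e \<nu> \<longleftrightarrow> norm \<nu> = 1 \<and> (\<forall>x\<in>e. \<forall>y\<in>e. \<nu> \<bullet> (x - y) = 0)"

definition outer_normal :: "(real^'n) set \<Rightarrow> (real^'n) set \<Rightarrow> real^'n" where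
  "outer_normal S e = (THE \<nu>. unit_normal e \<nu> \<and>
     (\<exists>x\<in>rel_interior e. \<forall>\<^sub>F t in at_right 0.
        x - t *\<^sub>R \<nu> \<in> interior S \<and> x + t *\<^sub>R \<nu> \<notin> S))"

text \<open>
  \<open>(d-1)\<close>-dimensional Lebesgue measure on a flat set \<open>e\<close>: a subset of the hyperplane \<open>affine hull e\<close>
  is measured by the volume of the right prism of total height 1 over it
  (\<open>closest_point\<close> is the orthogonal projection onto the hyperplane).
\<close>
definition surface_measure :: "(real^'n) set \<Rightarrow> (real^'n) measure" where
  "surface_measure e =
     distr (restrict_space lborel
              {y. infdist y (affine hull e) \<le> 1/2 \<and> closest_point (affine hull e) y \<in> e})
           (restrict_space borel e)
           (closest_point (affine hull e))"

section \<open>Shape regularity\<close>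

definition angle_between :: "real^'n \<Rightarrow> real^'n \<Rightarrow> real" where
  "angle_between x y = arccos ((x \<bullet> y) / (norm x * norm y))"

definition pyramid :: "(real^'n) set \<Rightarrow> real^'n \<Rightarrow> (real^'n) set" where
  "pyramid e A = (\<Union>x\<in>e. closed_segment x A)"

text \<open>\<open>\<tau>\<close> and \<open>N\<close> are the constants left implicit in ``shape-regular simplex'' (ratio of a radius of
  an inscribed ball to the diameter) and in ``bounded number''.\<close>
definition shape_regular :: "(real^'n) set set \<Rightarrow> (real^'n) set set \<Rightarrow> bool" where
  "shape_regular \<T> \<E> \<longleftrightarrow>
     (\<exists>\<rho>\<^sub>v \<rho>\<^sub>e \<kappa> \<sigma> \<gamma> \<theta>\<^sub>0 \<tau> :: real. \<exists>N :: nat. \<exists>S :: (real^'n) set \<Rightarrow> (real^'n) set.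
        \<rho>\<^sub>v > 0 \<and> \<rho>\<^sub>e > 0 \<and> \<kappa> > 0 \<and> \<sigma> > 0 \<and> \<gamma> > 0 \<and> 0 < \<theta>\<^sub>0 \<and> \<theta>\<^sub>0 < pi / 2 \<and> \<tau> > 0 \<and>
        (\<forall>T\<in>\<T>.
           \<rho>\<^sub>v * diameter T ^ CARD('n) \<le> measure lebesgue T \<and>
           (\<forall>e\<in>faces_on \<E> T.
              \<rho>\<^sub>e * diameter e ^ (CARD('n) - 1) \<le> measure (surface_measure e) e \<and>
              \<kappa> * diameter T \<le> diameter e \<and>
              (\<exists>A\<in>T. pyramid e A \<subseteq> T \<and> infdist A (affine hull e) \<ge> \<sigma> * diameter T \<and>
                 (\<forall>x\<in>e. angle_between (x - A) (outer_normal T e) \<le> \<theta>\<^sub>0))) \<and>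
           int CARD('n) simplex S T \<and> T \<subseteq> S T \<and> diameter (S T) \<le> \<gamma> * diameter T \<and>
           (\<exists>c. cball c (\<tau> * diameter (S T)) \<subseteq> S T) \<and>
           card {T'\<in>\<T>. T' \<noteq> T \<and> S T' \<inter> S T \<noteq> {}} \<le> N))"

section \<open>Polynomials and $L^2$\<close>

text \<open>The \<open>d\<close>-variate real polynomials of total degree at most \<open>r\<close>, as functions on the whole space;
  the index set of multi-indices is finite, see below.\<close>
definition polys :: "nat \<Rightarrow> (real^'n \<Rightarrow> real) set" where
  "polys r = {p. \<exists>c :: ('n \<Rightarrow> nat) \<Rightarrow> real.
     p = (\<lambda>x. \<Sum>\<alpha> | (\<Sum>i\<in>UNIV. \<alpha> i) \<le> r. c \<alpha> * (\<Prod>i\<in>UNIV. x $ i ^ \<alpha> i))}"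

lemma finite_multi_indices: "finite {\<alpha> :: 'n::finite \<Rightarrow> nat. (\<Sum>i\<in>UNIV. \<alpha> i) \<le> r}"
proof (rule finite_subset)
  show "{\<alpha> :: 'n \<Rightarrow> nat. (\<Sum>i\<in>UNIV. \<alpha> i) \<le> r} \<subseteq> (\<Pi>\<^sub>E i\<in>UNIV. {..r})"
  proof
    fix \<alpha> :: "'n \<Rightarrow> nat" assume "\<alpha> \<in> {\<alpha>. (\<Sum>i\<in>UNIV. \<alpha> i) \<le> r}"
    then have le: "(\<Sum>i\<in>UNIV. \<alpha> i) \<le> r" by simp
    have "\<alpha> i \<le> r" for i
      using member_le_sum[of i UNIV \<alpha>] le by simp
    then show "\<alpha> \<in> (\<Pi>\<^sub>E i\<in>UNIV. {..r})" by (simp add: PiE_UNIV_domain)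
  qed
qed (simp add: finite_PiE)

text \<open>\<open>P\<^sub>r(e)\<close> on an edge/face, as functions on \<open>e\<close> only. Polynomials in coordinates of the hyperplane
  containing \<open>e\<close> are exactly the restrictions of polynomials of the same degree bound.\<close>
definition polys_on :: "nat \<Rightarrow> (real^'n) set \<Rightarrow> (real^'n \<Rightarrow> real) set" where
  "polys_on r e = (\<lambda>p. restrict p e) ` polys r"

definition L2 :: "'a measure \<Rightarrow> ('a \<Rightarrow> real) set" where
  "L2 M = {f \<in> borel_measurable M. integrable M (\<lambda>x. (f x)\<^sup>2)}"

definition inner_L2 :: "'a measure \<Rightarrow> ('a \<Rightarrow> real) \<Rightarrow> ('a \<Rightarrow> real) \<Rightarrow> real" where
  "inner_L2 M f g = (\<integral>x. f x * g x \<partial>M)"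

abbreviation inner_elem :: "(real^'n) set \<Rightarrow> (real^'n \<Rightarrow> real) \<Rightarrow> (real^'n \<Rightarrow> real) \<Rightarrow> real" where
  "inner_elem T \<equiv> inner_L2 (lebesgue_on T)"

text \<open>The inner product on the boundary of \<open>T\<close>, of functions given separately on each edge/face.\<close>
definition inner_bd :: "(real^'n) set set \<Rightarrow> (real^'n) set \<Rightarrow>
    ((real^'n) set \<Rightarrow> real^'n \<Rightarrow> real) \<Rightarrow> ((real^'n) set \<Rightarrow> real^'n \<Rightarrow> real) \<Rightarrow> real" where
  "inner_bd \<E> T F G = (\<Sum>e\<in>faces_on \<E> T. inner_L2 (surface_measure e) (F e) (G e))"

definition Q\<^sub>b :: "nat \<Rightarrow> (real^'n) set \<Rightarrow> (real^'n \<Rightarrow> real) \<Rightarrow> real^'n \<Rightarrow> real" where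
  "Q\<^sub>b k e g = (THE p. p \<in> polys_on (k - 1) e \<and>
     (\<forall>q\<in>polys_on (k - 1) e.
        inner_L2 (surface_measure e) p q = inner_L2 (surface_measure e) g q))"

definition partial_deriv :: "'n \<Rightarrow> (real^'n \<Rightarrow> real) \<Rightarrow> real^'n \<Rightarrow> real" where
  "partial_deriv i f x = deriv (\<lambda>t. f (x + t *\<^sub>R axis i 1)) 0"

definition grad :: "(real^'n \<Rightarrow> real) \<Rightarrow> real^'n \<Rightarrow> real^'n" where
  "grad f x = (\<chi> i. partial_deriv i f x)"

definition laplacian :: "(real^'n \<Rightarrow> real) \<Rightarrow> real^'n \<Rightarrow> real" where
  "laplacian f x = (\<Sum>i\<in>UNIV. partial_deriv i (partial_deriv i f) x)"

section \<open>Weak Galerkin functions\<close>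

text \<open>
  A weak function is a triple \<open>(v\<^sub>0, v\<^sub>b, v\<^sub>n)\<close>; \<open>v\<^sub>0 T\<close> is the polynomial representing the interior part
  on \<open>T\<close> (determined by its values on \<open>T\<close>, which has nonempty interior, so that its values and
  gradients on the boundary of \<open>T\<close> are the traces from inside), while \<open>v\<^sub>b e\<close> and \<open>v\<^sub>n e\<close> are functions
  on \<open>e\<close>. All families are extensional, so equality of triples is equality of weak functions.
\<close>
type_synonym 'n elem_fun = "(real^'n) set \<Rightarrow> real^'n \<Rightarrow> real"
type_synonym 'n weak_fun = "'n elem_fun \<times> 'n elem_fun \<times> 'n elem_fun"

definition zero_elem :: "(real^'n) set set \<Rightarrow> 'n elem_fun" where
  "zero_elem \<T> = (\<lambda>T\<in>\<T>. \<lambda>x. 0)"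

definition zero_face :: "(real^'n) set set \<Rightarrow> 'n elem_fun" where
  "zero_face \<E> = (\<lambda>e\<in>\<E>. \<lambda>x\<in>e. 0)"

definition V\<^sub>h :: "nat \<Rightarrow> (real^'n) set set \<Rightarrow> (real^'n) set set \<Rightarrow> 'n weak_fun set" where
  "V\<^sub>h k \<T> \<E> = (\<Pi>\<^sub>E T\<in>\<T>. polys k) \<times> (\<Pi>\<^sub>E e\<in>\<E>. polys_on (k - 1) e) \<times> (\<Pi>\<^sub>E e\<in>\<E>. polys_on (k - 1) e)"

definition V\<^sub>h\<^sub>0 :: "nat \<Rightarrow> (real^'n) set \<Rightarrow> (real^'n) set set \<Rightarrow> (real^'n) set set \<Rightarrow> 'n weak_fun set" where
  "V\<^sub>h\<^sub>0 k \<Omega> \<T> \<E> = {(v0, vb, vn) \<in> V\<^sub>h k \<T> \<E>.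
     \<forall>e\<in>faces_on \<E> \<Omega>. \<forall>x\<in>e. vb e x = 0 \<and> vn e x = 0}"

text \<open>Functions in \<open>V\<^sub>h\<^sub>0\<close> all of whose components vanish outside the element \<open>T\<close>.\<close>
definition V\<^sub>h_local ::
  "nat \<Rightarrow> (real^'n) set \<Rightarrow> (real^'n) set set \<Rightarrow> (real^'n) set set \<Rightarrow> (real^'n) set \<Rightarrow> 'n weak_fun set" where
  "V\<^sub>h_local k \<Omega> \<T> \<E> T = {(v0, vb, vn) \<in> V\<^sub>h\<^sub>0 k \<Omega> \<T> \<E>.
     (\<forall>T'\<in>\<T>. \<forall>x\<in>T' - T. v0 T' x = 0) \<and>
     (\<forall>e\<in>\<E>. \<forall>x\<in>e - T. vb e x = 0 \<and> vn e x = 0)}"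

text \<open>The interior part as a function on \<open>\<Omega>\<close>, defined almost everywhere.\<close>
definition piecewise :: "(real^'n) set set \<Rightarrow> 'n elem_fun \<Rightarrow> real^'n \<Rightarrow> real" where
  "piecewise \<T> v0 x = (\<Sum>T\<in>\<T>. indicator (interior T) x * v0 T x)"

section \<open>Discrete weak Laplacian and the bilinear forms\<close>

text \<open>Below, \<open>\<n> e\<close> is the unit normal of \<open>e\<close> that is fixed once and for all.\<close>

definition weak_laplacian :: "nat \<Rightarrow> (real^'n) set set \<Rightarrow> ((real^'n) set \<Rightarrow> real^'n) \<Rightarrow>
    'n weak_fun \<Rightarrow> (real^'n) set \<Rightarrow> real^'n \<Rightarrow> real" where
  "weak_laplacian k \<E> \<n> v T = (case v of (v0, vb, vn) \<Rightarrow>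
     (THE p. p \<in> polys (k - 2) \<and>
       (\<forall>\<phi>\<in>polys (k - 2).
          inner_elem T p \<phi> =
            inner_elem T (v0 T) (laplacian \<phi>)
            - inner_bd \<E> T vb (\<lambda>e x. grad \<phi> x \<bullet> outer_normal T e)
            + inner_bd \<E> T (\<lambda>e x. vn e x * (\<n> e \<bullet> outer_normal T e)) (\<lambda>e. \<phi>))))"

definition stabilizer :: "nat \<Rightarrow> (real^'n) set set \<Rightarrow> (real^'n) set set \<Rightarrow>
    ((real^'n) set \<Rightarrow> real^'n) \<Rightarrow> 'n weak_fun \<Rightarrow> 'n weak_fun \<Rightarrow> real" where
  "stabilizer k \<T> \<E> \<n> v w = (case (v, w) of ((v0, vb, vn), (w0, wb, wn)) \<Rightarrow>
     (\<Sum>T\<in>\<T>. 1 / diameter T *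
        inner_bd \<E> T (\<lambda>e x. grad (v0 T) x \<bullet> \<n> e - vn e x) (\<lambda>e x. grad (w0 T) x \<bullet> \<n> e - wn e x))
     + (\<Sum>T\<in>\<T>. 1 / diameter T ^ 3 *
        inner_bd \<E> T (\<lambda>e x. Q\<^sub>b k e (v0 T) x - vb e x) (\<lambda>e x. Q\<^sub>b k e (w0 T) x - wb e x)))"

definition wg_form :: "nat \<Rightarrow> (real^'n) set set \<Rightarrow> (real^'n) set set \<Rightarrow>
    ((real^'n) set \<Rightarrow> real^'n) \<Rightarrow> 'n weak_fun \<Rightarrow> 'n weak_fun \<Rightarrow> real" where
  "wg_form k \<T> \<E> \<n> v w =
     (\<Sum>T\<in>\<T>. inner_elem T (weak_laplacian k \<E> \<n> v T) (weak_laplacian k \<E> \<n> w T))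
     + stabilizer k \<T> \<E> \<n> v w"

text \<open>\<open>v\<^sub>b = Q\<^sub>b g\<close> and \<open>v\<^sub>n = Q\<^sub>b g\<^sub>n (n \<bullet> n\<^sub>e)\<close> on the boundary of \<open>\<Omega>\<close>, with \<open>n\<close> outward from \<open>\<Omega>\<close>.\<close>
definition boundary_values :: "nat \<Rightarrow> (real^'n) set \<Rightarrow> (real^'n) set set \<Rightarrow>
    ((real^'n) set \<Rightarrow> real^'n) \<Rightarrow> (real^'n \<Rightarrow> real) \<Rightarrow> (real^'n \<Rightarrow> real) \<Rightarrow> 'n weak_fun \<Rightarrow> bool" where
  "boundary_values k \<Omega> \<E> \<n> g gn v = (case v of (v0, vb, vn) \<Rightarrow>
     \<forall>e\<in>faces_on \<E> \<Omega>. \<forall>x\<in>e.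
       vb e x = Q\<^sub>b k e g x \<and>
       vn e x = Q\<^sub>b k e gn x * (outer_normal (closure \<Omega>) e \<bullet> \<n> e))"

end

theory Submission
  imports Defs
begin

text \<open>
  The form \<open>a\<close> is bilinear on \<open>V\<^sub>h\<close>, since the Riesz representation on a finite-dimensional space of
  polynomials shows that \<open>\<Delta>\<^sub>w\<close> and \<open>Q\<^sub>b\<close> are well defined and linear. A test function in \<open>V\<^sub>h\<^sub>0\<close> is the sum of
  its face part and of its interior parts on the single elements, so the global equation and the local
  systems together say that \<open>w\<close> satisfies the weak Galerkin equation
  (\<open>schur_complement_imp_wg\<close>). Hence \<open>v = w - u\<close>, which has zero boundary values, satisfies
  \<open>a(v, v) = 0\<close>, and what remains is that \<open>a\<close> is definite on \<open>V\<^sub>h\<^sub>0\<close> (\<open>wg_form_definite\<close>).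

  Suppose \<open>a(v, v) = 0\<close>. Every term of the energy is nonnegative, so \<open>\<Delta>\<^sub>w v = 0\<close> on each element and, on
  each of its faces, \<open>\<nabla>v\<^sub>0 \<bullet> n\<^sub>e = v\<^sub>n\<close> and \<open>Q\<^sub>b v\<^sub>0 = v\<^sub>b\<close>. Integrating by parts in the definition of \<open>\<Delta>\<^sub>w\<close> gives
  \<open>\<Delta> v\<^sub>0 = 0\<close>, and integrating by parts once more,
  \<open>\<Sum>\<^sub>T \<parallel>\<nabla>v\<^sub>0\<parallel>\<^sup>2\<^sub>T = \<Sum>\<^sub>T \<langle>v\<^sub>n (n\<^sub>e \<bullet> n), v\<^sub>b\<rangle>\<close> over the boundaries of the elements. A face inside the domain occurs
  twice with opposite signs, and on the boundary \<open>v\<^sub>b = 0\<close>; so \<open>v\<^sub>0\<close> is constant on each element. The constants of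
  neighbours agree as both equal \<open>v\<^sub>b\<close>, and are zero at the boundary, so they all vanish.

  The integration by parts and the last step, that the constants vanish, rest on one fact
  (\<open>indicator_jump\<close>): along a generic line, the indicator of an element jumps exactly where the line crosses
  one of its faces, with the sign of the outward normal. Generic means that the line avoids the set, of
  codimension two, where faces meet. Near other points of a face an element is half a ball, on the side of
  the pyramid over that face which shape regularity provides; this proves the fact, identifies the outward
  normals, and shows that an inner face has exactly two elements, with opposite normals (\<open>sum_orientation\<close>).
  Integrating the jump relation over all lines in one direction expresses the difference between an element
  and its translate by prisms over the faces; for short translations this is the divergence theorem
  (\<open>divergence_theorem_elem\<close>). On one long line that leaves the domain it shows that a piecewise constant
  function without jumps vanishes (\<open>piecewise_constant_zero\<close>).
\<close>

section \<open>Polynomial functions of bounded degree\<close>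

definition monomial :: "('n \<Rightarrow> nat) \<Rightarrow> real^'n \<Rightarrow> real" where
  "monomial \<alpha> x = (\<Prod>i\<in>UNIV. x $ i ^ \<alpha> i)"

lemma polys_iff:
  "p \<in> polys r \<longleftrightarrow> (\<exists>c. p = (\<lambda>x. \<Sum>\<alpha> | (\<Sum>i\<in>UNIV. \<alpha> i) \<le> r. c \<alpha> * monomial \<alpha> x))"
  by (simp add: polys_def monomial_def)

lemma monomial_in_polys: "(\<Sum>i\<in>UNIV. \<alpha> i) \<le> r \<Longrightarrow> monomial \<alpha> \<in> polys r"
proof -
  assume "(\<Sum>i\<in>UNIV. \<alpha> i) \<le> r"
  then have "monomial \<alpha> x = (\<Sum>\<beta> | (\<Sum>i\<in>UNIV. \<beta> i) \<le> r.
      (if \<beta> = \<alpha> then 1 else 0) * monomial \<beta> x)" for x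
    by (simp add: finite_multi_indices if_distrib[of "\<lambda>c. c * _"] cong: if_cong)
  then have "monomial \<alpha> = (\<lambda>x. \<Sum>\<beta> | (\<Sum>i\<in>UNIV. \<beta> i) \<le> r.
      (if \<beta> = \<alpha> then 1 else 0) * monomial \<beta> x)" by (rule ext)
  then show "monomial \<alpha> \<in> polys r" unfolding polys_iff by (intro exI[of _ "\<lambda>\<beta>. if \<beta> = \<alpha> then 1 else 0"])
qed

lemma polys_add_scaled:
  assumes "p \<in> polys r" "q \<in> polys r"
  shows "(\<lambda>x. p x + c * q x) \<in> polys r"
proof -
  obtain a where a: "p = (\<lambda>x. \<Sum>\<alpha> | (\<Sum>i\<in>UNIV. \<alpha> i) \<le> r. a \<alpha> * monomial \<alpha> x)"
    using assms(1) polys_iff by blast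
  obtain b where b: "q = (\<lambda>x. \<Sum>\<alpha> | (\<Sum>i\<in>UNIV. \<alpha> i) \<le> r. b \<alpha> * monomial \<alpha> x)"
    using assms(2) polys_iff by blast
  show ?thesis
    unfolding polys_iff a b
    by (rule exI[of _ "\<lambda>\<alpha>. a \<alpha> + c * b \<alpha>"])
       (simp add: fun_eq_iff sum.distrib sum_distrib_left sum_negf algebra_simps)
qed

lemma polys_zero: "(\<lambda>x. 0) \<in> polys r"
  unfolding polys_iff by (rule exI[of _ "\<lambda>_. 0"]) simp

lemma polys_scale: "p \<in> polys r \<Longrightarrow> (\<lambda>x. c * p x) \<in> polys r"
  using polys_add_scaled[OF polys_zero, of p r c] by simp

lemma polys_sum:
  assumes "finite A" "\<And>a. a \<in> A \<Longrightarrow> f a \<in> polys r"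
  shows "(\<lambda>x. \<Sum>a\<in>A. f a x) \<in> polys r"
  using assms
proof (induction A rule: finite_induct)
  case empty
  then show ?case by (simp add: polys_zero)
next
  case (insert a A)
  then show ?case using polys_add_scaled[of "f a" r "\<lambda>x. \<Sum>a\<in>A. f a x" 1] by simp
qed

lemma polys_mono:
  assumes "p \<in> polys r" "r \<le> s"
  shows "p \<in> polys s"
proof -
  obtain c where c: "p = (\<lambda>x. \<Sum>\<alpha> | (\<Sum>i\<in>UNIV. \<alpha> i) \<le> r. c \<alpha> * monomial \<alpha> x)"
    using assms(1) polys_iff by blast
  show ?thesis
    unfolding c using assms(2)
    by (intro polys_sum finite_multi_indices polys_scale monomial_in_polys) auto
qed

lemma polys_const: "(\<lambda>x. c) \<in> polys r"
proof -
  have "(\<lambda>x. c * monomial (\<lambda>_. 0) x) \<in> polys r"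
    by (intro polys_scale monomial_in_polys) simp
  then show ?thesis by (simp add: monomial_def)
qed

lemma real_polynomial_function_polys:
  fixes p :: "real^'n \<Rightarrow> real"
  assumes "p \<in> polys r"
  shows "real_polynomial_function p"
proof -
  obtain c where c: "p = (\<lambda>x. \<Sum>\<alpha> | (\<Sum>i\<in>UNIV. \<alpha> i) \<le> r. c \<alpha> * monomial \<alpha> x)"
    using assms(1) polys_iff by blast
  have "real_polynomial_function (\<lambda>x::real^'n. x $ i)" for i
    by (intro real_polynomial_function.intros(1) bounded_linear_vec_nth)
  then show ?thesis
    unfolding c monomial_def
    by (intro real_polynomial_function_sum real_polynomial_function.intros(2,4)
        real_polynomial_function_prod real_polynomial_function_power finite_multi_indices finite)
qed

text \<open>For \<open>\<alpha> i = 0\<close> the truncated exponent \<open>\<alpha> i - 1\<close> is harmless, as the factor \<open>\<alpha> i\<close> vanishes.\<close>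

lemma DERIV_monomial_along_axis:
  "((\<lambda>t. monomial \<alpha> (x + t *\<^sub>R axis i 1)) has_field_derivative
     of_nat (\<alpha> i) * monomial (\<alpha>(i := \<alpha> i - 1)) x) (at 0)"
proof -
  have split: "monomial \<beta> y = y $ i ^ \<beta> i * (\<Prod>j\<in>UNIV - {i}. y $ j ^ \<beta> j)" for \<beta> and y :: "real^'a"
    unfolding monomial_def by (simp add: prod.remove[of UNIV i])
  have "monomial \<alpha> (x + t *\<^sub>R axis i 1) = (x $ i + t) ^ \<alpha> i * (\<Prod>j\<in>UNIV - {i}. x $ j ^ \<alpha> j)" for t
    unfolding split
    by (intro arg_cong2[where f = "(*)"] prod.cong) (auto simp: axis_def)
  moreover have "((\<lambda>t. (x $ i + t) ^ \<alpha> i * (\<Prod>j\<in>UNIV - {i}. x $ j ^ \<alpha> j)) has_field_derivative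
      (of_nat (\<alpha> i) * (x $ i + 0) ^ (\<alpha> i - 1)) * (\<Prod>j\<in>UNIV - {i}. x $ j ^ \<alpha> j)) (at 0)"
    by (auto intro!: derivative_eq_intros)
  moreover have "(\<Prod>j\<in>UNIV - {i}. x $ j ^ (\<alpha>(i := \<alpha> i - 1)) j) = (\<Prod>j\<in>UNIV - {i}. x $ j ^ \<alpha> j)"
    by (intro prod.cong) auto
  ultimately show ?thesis by (simp only: split[of "\<alpha>(i := \<alpha> i - 1)"]) (simp add: mult.assoc)
qed

lemma partial_deriv_in_polys:
  assumes "p \<in> polys r"
  shows "partial_deriv i p \<in> polys (r - 1)"
proof -
  let ?I = "{\<alpha> :: 'a \<Rightarrow> nat. (\<Sum>i\<in>UNIV. \<alpha> i) \<le> r}"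
  obtain c where c: "p = (\<lambda>x. \<Sum>\<alpha>\<in>?I. c \<alpha> * monomial \<alpha> x)"
    using assms(1) polys_iff by blast
  have "partial_deriv i p =
      (\<lambda>x. \<Sum>\<alpha>\<in>?I. c \<alpha> * (of_nat (\<alpha> i) * monomial (\<alpha>(i := \<alpha> i - 1)) x))"
  proof
    fix x
    have "((\<lambda>t. \<Sum>\<alpha>\<in>?I. c \<alpha> * monomial \<alpha> (x + t *\<^sub>R axis i 1)) has_field_derivative
        (\<Sum>\<alpha>\<in>?I. c \<alpha> * (of_nat (\<alpha> i) * monomial (\<alpha>(i := \<alpha> i - 1)) x))) (at 0)"
      by (intro DERIV_sum DERIV_cmult DERIV_monomial_along_axis)
    then show "partial_deriv i p x =
        (\<Sum>\<alpha>\<in>?I. c \<alpha> * (of_nat (\<alpha> i) * monomial (\<alpha>(i := \<alpha> i - 1)) x))"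
      unfolding partial_deriv_def c by (rule DERIV_imp_deriv)
  qed
  moreover have "(\<lambda>x. c \<alpha> * (of_nat (\<alpha> i) * monomial (\<alpha>(i := \<alpha> i - 1)) x)) \<in> polys (r - 1)"
    if "\<alpha> \<in> ?I" for \<alpha>
  proof (cases "\<alpha> i = 0")
    case True
    then show ?thesis by (simp add: polys_zero)
  next
    case False
    have "(\<Sum>j\<in>UNIV. (\<alpha>(i := \<alpha> i - 1)) j) = (\<alpha> i - 1) + (\<Sum>j\<in>UNIV - {i}. \<alpha> j)"
      by (simp add: sum.remove[of UNIV i])
    moreover have "(\<Sum>j\<in>UNIV. \<alpha> j) = \<alpha> i + (\<Sum>j\<in>UNIV - {i}. \<alpha> j)"
      by (simp add: sum.remove[of UNIV i])
    ultimately have "(\<Sum>j\<in>UNIV. (\<alpha>(i := \<alpha> i - 1)) j) \<le> r - 1"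
      using that False by simp
    then show ?thesis by (intro polys_scale monomial_in_polys)
  qed
  ultimately show ?thesis
    by (simp only: polys_sum finite_multi_indices)
qed

lemma laplacian_in_polys:
  assumes "p \<in> polys r"
  shows "laplacian p \<in> polys (r - 2)"
proof -
  have "partial_deriv i (partial_deriv i p) \<in> polys (r - 2)" for i
    using partial_deriv_in_polys[OF partial_deriv_in_polys[OF assms]]
    by (simp add: numeral_2_eq_2)
  then show ?thesis
    unfolding laplacian_def[abs_def] by (intro polys_sum) auto
qed

lemma inner_grad_in_polys:
  assumes "p \<in> polys r"
  shows "(\<lambda>x. grad p x \<bullet> a) \<in> polys (r - 1)"
  unfolding grad_def inner_vec_def
  by (auto intro!: polys_sum polys_scale partial_deriv_in_polys[OF assms, simplified] simp: mult.commute[of _ "a $ _"])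

lemma has_derivative_polys:
  fixes p :: "real^'n \<Rightarrow> real"
  assumes "p \<in> polys r"
  shows "(p has_derivative (\<lambda>h. grad p x \<bullet> h)) (at x)"
proof -
  obtain D where D: "(p has_derivative D) (at x)"
    using differentiable_at_real_polynomial_function[OF real_polynomial_function_polys[OF assms]]
    unfolding differentiable_def by blast
  have lin: "linear D" using D has_derivative_linear by blast
  have part: "partial_deriv i p x = D (axis i 1)" for i
  proof -
    have "((\<lambda>t. p (x + t *\<^sub>R axis i 1)) has_derivative (\<lambda>t. D (t *\<^sub>R axis i 1))) (at 0)"
    proof (rule has_derivative_compose[where g = p])
      show "((\<lambda>t. x + t *\<^sub>R axis i 1) has_derivative (\<lambda>t. t *\<^sub>R axis i 1)) (at 0)"
        by (auto intro!: derivative_eq_intros)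
      show "(p has_derivative D) (at (x + 0 *\<^sub>R axis i 1))" using D by simp
    qed
    moreover have "(\<lambda>t. D (t *\<^sub>R axis i 1)) = (*) (D (axis i 1))"
      by (simp add: fun_eq_iff linear_cmul[OF lin])
    ultimately have "((\<lambda>t. p (x + t *\<^sub>R axis i 1)) has_field_derivative D (axis i 1)) (at 0)"
      by (simp add: has_field_derivative_def)
    then show ?thesis unfolding partial_deriv_def by (rule DERIV_imp_deriv)
  qed
  have "D h = grad p x \<bullet> h" for h
  proof -
    have "D h = D (\<Sum>i\<in>UNIV. h $ i *\<^sub>R axis i 1)"
      using basis_expansion[of h] by (simp add: scalar_mult_eq_scaleR)
    also have "\<dots> = (\<Sum>i\<in>UNIV. h $ i * D (axis i 1))"
      by (simp add: linear_sum[OF lin] linear_cmul[OF lin])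
    also have "\<dots> = grad p x \<bullet> h"
      by (simp add: grad_def inner_vec_def part mult.commute)
    finally show ?thesis .
  qed
  then have "D = (\<lambda>h. grad p x \<bullet> h)" by (rule ext)
  then show ?thesis using D by simp
qed

lemma continuous_on_polys: "p \<in> polys r \<Longrightarrow> continuous_on S p"
  by (meson continuous_at_imp_continuous_on has_derivative_continuous has_derivative_polys)

lemma continuous_on_grad: 
  assumes "p \<in> polys r" shows "continuous_on S (grad p)"
  unfolding grad_def
  by (intro continuous_on_vec_lambda continuous_on_polys[OF partial_deriv_in_polys[OF assms]])

text \<open>On the line from a point of the open set to any other point, the polynomial is a univariate one with
  infinitely many roots.\<close>

lemma polys_zero_if_zero_on_open:
  fixes p :: "real^'n \<Rightarrow> real"
  assumes p: "p \<in> polys r" and "open S" "x0 \<in> S" and zero: "\<And>x. x \<in> S \<Longrightarrow> p x = 0"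
  shows "p = (\<lambda>x. 0)"
proof
  fix y
  let ?g = "\<lambda>t::real. x0 + t *\<^sub>R (y - x0)"
  have "polynomial_function ?g"
    by (intro polynomial_function_add polynomial_function_const polynomial_function_mult
        polynomial_function_bounded_linear bounded_linear_ident)
  then have "real_polynomial_function (p \<circ> ?g)"
    using real_polynomial_function_polys[OF p] by (rule real_polynomial_function_compose)
  then obtain a m where a: "p \<circ> ?g = (\<lambda>t. \<Sum>i\<le>m. a i * t ^ i)"
    using real_polynomial_function_iff_sum by blast
  have "continuous (at 0) ?g" by (intro continuous_intros)
  then have "(?g \<longlongrightarrow> x0) (at 0)" unfolding continuous_at by simp
  then have "\<forall>\<^sub>F t in at 0. ?g t \<in> S"
    using \<open>open S\<close> \<open>x0 \<in> S\<close> by (auto simp: tendsto_def)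
  then obtain d where d: "d > 0" "\<And>t. t \<noteq> 0 \<Longrightarrow> dist t 0 < d \<Longrightarrow> ?g t \<in> S"
    unfolding eventually_at by auto
  have "{0<..<d} \<subseteq> {t. (\<Sum>i\<le>m. a i * t ^ i) = 0}"
  proof
    fix t assume t: "t \<in> {0<..<d}"
    have "(p \<circ> ?g) t = 0" using d(2)[of t] t zero by (simp add: o_def)
    then show "t \<in> {t. (\<Sum>i\<le>m. a i * t ^ i) = 0}" by (simp add: a)
  qed
  then have "infinite {t. (\<Sum>i\<le>m. a i * t ^ i) = 0}"
    using d(1) infinite_Ioo[of 0 d] finite_subset by blast
  then have "\<forall>i\<le>m. a i = 0"
    using polyfun_finite_roots[of a m] by blast
  then have "(p \<circ> ?g) 1 = 0" by (simp add: a)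
  then show "p y = 0" by simp
qed

section \<open>Riesz representation on a finite-dimensional space of functions\<close>

text \<open>Gram--Schmidt: let \<open>m'\<close> be the component of a new generator that is \<open>B\<close>-orthogonal to the span of the
  earlier ones. If \<open>B m' m' = 0\<close>, then \<open>l\<close> vanishes on \<open>m'\<close> and nothing has to be done; otherwise a
  multiple of \<open>m'\<close> corrects the value of \<open>l\<close> without disturbing it on the earlier span.\<close>

lemma Riesz_representation_span:
  fixes B :: "('a \<Rightarrow> real) \<Rightarrow> ('a \<Rightarrow> real) \<Rightarrow> real" and m :: "'i \<Rightarrow> 'a \<Rightarrow> real"
  defines "lin \<equiv> \<lambda>I c x. \<Sum>i\<in>I. c i * m i x"
  assumes "finite I" and m: "\<And>i. i \<in> I \<Longrightarrow> m i \<in> W"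
    and zero: "(\<lambda>x. 0) \<in> W"
    and comb: "\<And>f g c. f \<in> W \<Longrightarrow> g \<in> W \<Longrightarrow> (\<lambda>x. f x + c * g x) \<in> W"
    and B_lin: "\<And>f g h c. f \<in> W \<Longrightarrow> g \<in> W \<Longrightarrow> h \<in> W \<Longrightarrow> B (\<lambda>x. f x + c * g x) h = B f h + c * B g h"
    and B_sym: "\<And>f g. B f g = B g f"
    and B_null: "\<And>f g. f \<in> W \<Longrightarrow> g \<in> W \<Longrightarrow> B f f = 0 \<Longrightarrow> B f g = 0"
    and l_lin: "\<And>f g c. f \<in> W \<Longrightarrow> g \<in> W \<Longrightarrow> l (\<lambda>x. f x + c * g x) = l f + c * l g"
    and l_null: "\<And>f. f \<in> W \<Longrightarrow> B f f = 0 \<Longrightarrow> l f = 0"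
  shows "\<exists>c. \<forall>d. B (lin I c) (lin I d) = l (lin I d)"
  using assms(2) m l_lin l_null
proof (induction I arbitrary: l rule: finite_induct)
  case empty
  have "B (\<lambda>x. 0) (\<lambda>x. 0) = 0" using B_lin[OF zero zero zero, of 1] by simp
  with empty show ?case by (auto simp: lin_def zero)
next
  case (insert j I)
  have mW: "m i \<in> W" if "i \<in> insert j I" for i using insert.prems(1) that .
  have linW: "lin J d \<in> W" if "J \<subseteq> insert j I" for J d
  proof -
    have "finite J" using that insert(1) finite_subset by blast
    then show ?thesis using that
    proof (induction J rule: finite_induct)
      case empty
      then show ?case using zero by (simp add: lin_def)
    next
      case (insert a J)
      then have "lin (insert a J) d = (\<lambda>x. lin J d x + d a * m a x)"
        by (simp add: lin_def fun_eq_iff)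
      moreover have "lin J d \<in> W" "m a \<in> W" using insert mW by simp_all
      ultimately show ?case by (simp only: comb)
    qed
  qed
  have mj: "m j \<in> W" using insert by auto
  have IHt: "\<exists>c. \<forall>d. B (lin I c) (lin I d) = l' (lin I d)"
    if "\<And>f g c. f \<in> W \<Longrightarrow> g \<in> W \<Longrightarrow> l' (\<lambda>x. f x + c * g x) = l' f + c * l' g"
      "\<And>f. f \<in> W \<Longrightarrow> B f f = 0 \<Longrightarrow> l' f = 0" for l'
    by (rule insert.IH[of l']) (simp_all only: mW that insertI2)
  obtain c0 where c0: "\<And>d. B (lin I c0) (lin I d) = l (lin I d)"
    using IHt[of l, OF insert.prems(2,3)] by blast
  obtain c1 where c1: "\<And>d. B (lin I c1) (lin I d) = B (m j) (lin I d)"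
  proof -
    have "B (m j) (\<lambda>x. f x + c * g x) = B (m j) f + c * B (m j) g" if "f \<in> W" "g \<in> W" for f g c
      using B_lin[OF that mj, of c] by (simp only: B_sym[of "m j"])
    moreover have "B (m j) f = 0" if "f \<in> W" "B f f = 0" for f
      using B_null[OF that(1) mj that(2)] by (simp only: B_sym[of "m j"])
    ultimately have "\<exists>c. \<forall>d. B (lin I c) (lin I d) = B (m j) (lin I d)"
      by (rule IHt)
    then show thesis using that by blast
  qed
  define m' where "m' = (\<lambda>x. m j x + (-1) * lin I c1 x)"
  have m'W: "m' \<in> W" unfolding m'_def by (intro comb mj linW) auto
  have orth: "B m' (lin I d) = 0" for d
    unfolding m'_def by (subst B_lin) (auto simp: mj linW c1 subset_insertI)
  define t where "t = (if B m' m' = 0 then 0 else (l m' - B (lin I c0) m') / B m' m')"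
  define c where "c = (\<lambda>i. if i = j then t else c0 i - t * c1 i)"
  have c_eq: "lin (insert j I) c = (\<lambda>x. lin I c0 x + t * m' x)"
  proof
    fix x
    have "(\<Sum>i\<in>I. c i * m i x) = (\<Sum>i\<in>I. c0 i * m i x - t * (c1 i * m i x))"
      using insert(2) by (intro sum.cong) (auto simp: c_def algebra_simps)
    then have "(\<Sum>i\<in>I. c i * m i x) = lin I c0 x - t * lin I c1 x"
      by (simp add: lin_def sum_subtractf sum_distrib_left)
    moreover have "c j = t" by (simp add: c_def)
    moreover have "lin (insert j I) c x = c j * m j x + (\<Sum>i\<in>I. c i * m i x)"
      using insert(1,2) by (simp add: lin_def)
    ultimately show "lin (insert j I) c x = lin I c0 x + t * m' x"
      by (simp add: m'_def algebra_simps)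
  qed
  have key: "B (lin (insert j I) c) m' = l m'"
  proof (cases "B m' m' = 0")
    case True
    have "B m' (lin I c0) = 0" by (rule B_null[OF m'W linW True]) auto
    then have "B (lin I c0) m' = 0" by (simp only: B_sym[of _ m'])
    then show ?thesis using True insert.prems(3)[OF m'W True]
      unfolding c_eq by (subst B_lin) (auto simp: linW m'W subset_insertI)
  next
    case False
    then show ?thesis
      unfolding c_eq by (subst B_lin) (auto simp: linW m'W subset_insertI t_def)
  qed
  have low: "B (lin (insert j I) c) (lin I d) = l (lin I d)" for d
    unfolding c_eq by (subst B_lin) (auto simp: linW m'W subset_insertI c0 orth)
  show ?case
  proof (intro exI[of _ c] allI)
    fix d
    let ?d' = "\<lambda>i. d i + d j * c1 i"
    have d_eq: "lin (insert j I) d = (\<lambda>x. lin I ?d' x + d j * m' x)"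
      using insert(1,2)
      by (simp add: lin_def m'_def fun_eq_iff sum.distrib sum_distrib_left sum_negf algebra_simps)
    have "B (lin (insert j I) c) (lin (insert j I) d) = B (lin (insert j I) d) (lin (insert j I) c)"
      by (rule B_sym)
    also have "\<dots> = B (lin I ?d') (lin (insert j I) c) + d j * B m' (lin (insert j I) c)"
      unfolding d_eq by (rule B_lin) (auto intro!: linW m'W)
    also have "\<dots> = l (lin I ?d') + d j * l m'"
      using key low[of ?d'] by (simp only: B_sym[of _ "lin (insert j I) c"])
    also have "\<dots> = l (lin (insert j I) d)"
      unfolding d_eq by (subst insert.prems(2)) (auto intro!: linW m'W)
    finally show "B (lin (insert j I) c) (lin (insert j I) d) = l (lin (insert j I) d)" .
  qed
qed

lemma Riesz_representation_polys:
  fixes B :: "(real^'n \<Rightarrow> real) \<Rightarrow> (real^'n \<Rightarrow> real) \<Rightarrow> real"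
  assumes B_lin: "\<And>f g h c. f \<in> polys r \<Longrightarrow> g \<in> polys r \<Longrightarrow> h \<in> polys r \<Longrightarrow>
        B (\<lambda>x. f x + c * g x) h = B f h + c * B g h"
    and B_sym: "\<And>f g. B f g = B g f"
    and B_null: "\<And>f g. f \<in> polys r \<Longrightarrow> g \<in> polys r \<Longrightarrow> B f f = 0 \<Longrightarrow> B f g = 0"
    and l_lin: "\<And>f g c. f \<in> polys r \<Longrightarrow> g \<in> polys r \<Longrightarrow> l (\<lambda>x. f x + c * g x) = l f + c * l g"
    and l_null: "\<And>f. f \<in> polys r \<Longrightarrow> B f f = 0 \<Longrightarrow> l f = 0"
  shows "\<exists>p\<in>polys r. \<forall>q\<in>polys r. B p q = l q"
proof -
  let ?I = "{\<alpha> :: 'n \<Rightarrow> nat. (\<Sum>i\<in>UNIV. \<alpha> i) \<le> r}"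
  have "\<exists>c. \<forall>d. B (\<lambda>x. \<Sum>i\<in>?I. c i * monomial i x) (\<lambda>x. \<Sum>i\<in>?I. d i * monomial i x)
      = l (\<lambda>x. \<Sum>i\<in>?I. d i * monomial i x)"
    by (rule Riesz_representation_span[where W = "polys r", OF finite_multi_indices _ polys_zero
          polys_add_scaled B_lin B_sym B_null l_lin l_null])
       (simp_all add: monomial_in_polys)
  then obtain c where "\<And>d. B (\<lambda>x. \<Sum>i\<in>?I. c i * monomial i x) (\<lambda>x. \<Sum>i\<in>?I. d i * monomial i x)
      = l (\<lambda>x. \<Sum>i\<in>?I. d i * monomial i x)"
    by blast
  then show ?thesis
    by (intro bexI[of _ "\<lambda>x. \<Sum>i\<in>?I. c i * monomial i x"]) (auto simp: polys_iff)
qed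

section \<open>Integration over a flat face\<close>

lemma nn_integral_lborel_translate:
  fixes h :: "'a::euclidean_space \<Rightarrow> ennreal"
  assumes [measurable]: "h \<in> borel_measurable borel"
  shows "(\<integral>\<^sup>+y. h (y + c) \<partial>lborel) = (\<integral>\<^sup>+y. h y \<partial>lborel)"
  by (subst (2) lborel_distr_plus[of c, symmetric]) (simp add: nn_integral_distr add.commute)

text \<open>The change of variables for a rank-one perturbation of the identity. A dummy variable \<open>\<tau>\<close> that
  ranges over \<open>[0, 1]\<close> turns it into translations in one variable with the other one fixed; this is
  the block elimination that proves \<open>det (I + u v\<^sup>T) = 1 + v \<bullet> u\<close>.\<close>

lemma nn_integral_rank_one:
  fixes f :: "'a::euclidean_space \<Rightarrow> ennreal"
  assumes f[measurable]: "f \<in> borel_measurable borel" and nz: "1 + v \<bullet> u \<noteq> 0"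
  shows "(\<integral>\<^sup>+y. f (y + (v \<bullet> y) *\<^sub>R u) \<partial>lborel) = ennreal (1 / \<bar>1 + v \<bullet> u\<bar>) * (\<integral>\<^sup>+x. f x \<partial>lborel)"
proof -
  define \<delta> where "\<delta> = 1 + v \<bullet> u"
  have \<delta>: "\<delta> \<noteq> 0" using nz by (simp add: \<delta>_def)
  define K :: "real \<Rightarrow> ennreal" where "K = indicator {0..1}"
  have [measurable]: "K \<in> borel_measurable borel" by (simp add: K_def)
  note translate = nn_integral_lborel_translate
  have K1: "(\<integral>\<^sup>+\<tau>. K \<tau> \<partial>lborel) = 1" by (simp add: K_def)
  have K2: "(\<integral>\<^sup>+\<sigma>. K (\<delta> * \<sigma> - c) \<partial>lborel) = ennreal (1 / \<bar>\<delta>\<bar>)" for c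
  proof -
    have "1 = ennreal \<bar>\<delta>\<bar> * (\<integral>\<^sup>+\<sigma>. K (- c + \<delta> * \<sigma>) \<partial>lborel)"
      using nn_integral_real_affine[of K \<delta> "-c"] \<delta> K1 by simp
    then have "ennreal (1 / \<bar>\<delta>\<bar>) * 1 = ennreal (1 / \<bar>\<delta>\<bar>) * (ennreal \<bar>\<delta>\<bar> * (\<integral>\<^sup>+\<sigma>. K (- c + \<delta> * \<sigma>) \<partial>lborel))"
      by simp
    also have "\<dots> = (\<integral>\<^sup>+\<sigma>. K (- c + \<delta> * \<sigma>) \<partial>lborel)"
      using \<delta> by (simp add: mult.assoc[symmetric] ennreal_mult[symmetric])
    finally show ?thesis by simp
  qed
  \<comment> \<open>a translation by \<open>\<tau> w\<close> before the map is a translation by \<open>\<tau> u\<close> after it\<close>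
  define w where "w = (1 / \<delta>) *\<^sub>R u"
  have gw: "(y + \<tau> *\<^sub>R w) + (v \<bullet> (y + \<tau> *\<^sub>R w)) *\<^sub>R u = y + (\<tau> + v \<bullet> y) *\<^sub>R u" for y \<tau>
  proof -
    have "\<tau> *\<^sub>R w + (\<tau> * (v \<bullet> w)) *\<^sub>R u = (\<tau> * ((1 + v \<bullet> u) / \<delta>)) *\<^sub>R u"
      by (simp add: w_def algebra_simps add_divide_distrib)
    also have "\<dots> = \<tau> *\<^sub>R u" using \<delta> by (simp add: \<delta>_def)
    finally show ?thesis by (simp add: inner_add_right algebra_simps)
  qed
  have shift: "(\<integral>\<^sup>+y. f (y + (v \<bullet> y) *\<^sub>R u) \<partial>lborel)
      = (\<integral>\<^sup>+y. f (y + (\<tau> + v \<bullet> y) *\<^sub>R u) \<partial>lborel)" for \<tau>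
    using translate[of "\<lambda>y. f (y + (v \<bullet> y) *\<^sub>R u)" "\<tau> *\<^sub>R w"] unfolding gw by simp
  have "(\<integral>\<^sup>+y. f (y + (v \<bullet> y) *\<^sub>R u) \<partial>lborel)
      = (\<integral>\<^sup>+\<tau>. (\<integral>\<^sup>+y. f (y + (v \<bullet> y) *\<^sub>R u) \<partial>lborel) * K \<tau> \<partial>lborel)"
    by (simp add: nn_integral_cmult K1)
  also have "\<dots> = (\<integral>\<^sup>+\<tau>. (\<integral>\<^sup>+y. f (y + (\<tau> + v \<bullet> y) *\<^sub>R u) \<partial>lborel) * K \<tau> \<partial>lborel)"
    by (simp only: shift[symmetric])
  also have "\<dots> = (\<integral>\<^sup>+\<tau>. (\<integral>\<^sup>+y. f (y + (\<tau> + v \<bullet> y) *\<^sub>R u) * K \<tau> \<partial>lborel) \<partial>lborel)"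
    by (simp add: nn_integral_multc)
  also have "\<dots> = (\<integral>\<^sup>+y. (\<integral>\<^sup>+\<tau>. f (y + (\<tau> + v \<bullet> y) *\<^sub>R u) * K \<tau> \<partial>lborel) \<partial>lborel)"
    by (rule lborel_pair.Fubini') measurable
  also have "\<dots> = (\<integral>\<^sup>+y. (\<integral>\<^sup>+\<sigma>. f (y + \<sigma> *\<^sub>R u) * K (\<sigma> - v \<bullet> y) \<partial>lborel) \<partial>lborel)"
  proof (rule nn_integral_cong)
    fix y
    show "(\<integral>\<^sup>+\<tau>. f (y + (\<tau> + v \<bullet> y) *\<^sub>R u) * K \<tau> \<partial>lborel) = (\<integral>\<^sup>+\<sigma>. f (y + \<sigma> *\<^sub>R u) * K (\<sigma> - v \<bullet> y) \<partial>lborel)"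
      using translate[of "\<lambda>\<sigma>. f (y + \<sigma> *\<^sub>R u) * K (\<sigma> - v \<bullet> y)" "v \<bullet> y"] by simp
  qed
  also have "\<dots> = (\<integral>\<^sup>+\<sigma>. (\<integral>\<^sup>+y. f (y + \<sigma> *\<^sub>R u) * K (\<sigma> - v \<bullet> y) \<partial>lborel) \<partial>lborel)"
    by (rule lborel_pair.Fubini') measurable
  also have "\<dots> = (\<integral>\<^sup>+\<sigma>. (\<integral>\<^sup>+x. f x * K (\<delta> * \<sigma> - v \<bullet> x) \<partial>lborel) \<partial>lborel)"
  proof (rule nn_integral_cong)
    fix \<sigma>
    have "\<delta> * \<sigma> - v \<bullet> (y + \<sigma> *\<^sub>R u) = \<sigma> - v \<bullet> y" for y
      by (simp add: \<delta>_def algebra_simps inner_add_right)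
    then show "(\<integral>\<^sup>+y. f (y + \<sigma> *\<^sub>R u) * K (\<sigma> - v \<bullet> y) \<partial>lborel) = (\<integral>\<^sup>+x. f x * K (\<delta> * \<sigma> - v \<bullet> x) \<partial>lborel)"
      using translate[of "\<lambda>x. f x * K (\<delta> * \<sigma> - v \<bullet> x)" "\<sigma> *\<^sub>R u"] by simp
  qed
  also have "\<dots> = (\<integral>\<^sup>+x. (\<integral>\<^sup>+\<sigma>. f x * K (\<delta> * \<sigma> - v \<bullet> x) \<partial>lborel) \<partial>lborel)"
    by (rule lborel_pair.Fubini') measurable
  also have "\<dots> = (\<integral>\<^sup>+x. f x * ennreal (1 / \<bar>\<delta>\<bar>) \<partial>lborel)"
    by (simp add: nn_integral_cmult K2)
  also have "\<dots> = ennreal (1 / \<bar>\<delta>\<bar>) * (\<integral>\<^sup>+x. f x \<partial>lborel)"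
    by (subst nn_integral_multc) (simp_all add: mult.commute)
  finally show ?thesis unfolding \<delta>_def .
qed

lemma distr_lborel_rank_one:
  fixes u v :: "'a::euclidean_space"
  assumes nz: "1 + v \<bullet> u \<noteq> 0"
  shows "distr lborel borel (\<lambda>y. y + (v \<bullet> y) *\<^sub>R u) = density lborel (\<lambda>_. ennreal (1 / \<bar>1 + v \<bullet> u\<bar>))"
proof (rule measure_eqI)
  fix A :: "'a set" assume "A \<in> sets (distr lborel borel (\<lambda>y. y + (v \<bullet> y) *\<^sub>R u))"
  then have [measurable]: "A \<in> sets borel" by simp
  have "emeasure (distr lborel borel (\<lambda>y. y + (v \<bullet> y) *\<^sub>R u)) A
      = (\<integral>\<^sup>+y. indicator A (y + (v \<bullet> y) *\<^sub>R u) \<partial>lborel)"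
    using nn_integral_distr[of "\<lambda>y. y + (v \<bullet> y) *\<^sub>R u" lborel borel "indicator A"] by simp
  then show "emeasure (distr lborel borel (\<lambda>y. y + (v \<bullet> y) *\<^sub>R u)) A
      = emeasure (density lborel (\<lambda>_. ennreal (1 / \<bar>1 + v \<bullet> u\<bar>))) A"
    by (simp add: nn_integral_rank_one[OF _ nz] emeasure_density nn_integral_cmult)
qed simp

lemma integral_rank_one:
  fixes f :: "'a::euclidean_space \<Rightarrow> real"
  assumes [measurable]: "f \<in> borel_measurable borel" and nz: "1 + v \<bullet> u \<noteq> 0"
  shows "(\<integral>x. f x \<partial>lborel) = \<bar>1 + v \<bullet> u\<bar> * (\<integral>y. f (y + (v \<bullet> y) *\<^sub>R u + c) \<partial>lborel)"
proof -
  have "(\<integral>x. f x \<partial>lborel) = (\<integral>x. f (x + c) \<partial>lborel)"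
    by (subst lborel_distr_plus[of c, symmetric]) (simp add: integral_distr add.commute)
  moreover have "(\<integral>y. f (y + (v \<bullet> y) *\<^sub>R u + c) \<partial>lborel)
      = integral\<^sup>L (distr lborel borel (\<lambda>y. y + (v \<bullet> y) *\<^sub>R u)) (\<lambda>x. f (x + c))"
    by (subst integral_distr) simp_all
  moreover have "\<dots> = 1 / \<bar>1 + v \<bullet> u\<bar> * (\<integral>x. f (x + c) \<partial>lborel)"
    unfolding distr_lborel_rank_one[OF nz] by (subst integral_density) simp_all
  ultimately show ?thesis using nz by simp
qed

definition bounded_measurable :: "'a measure \<Rightarrow> ('a \<Rightarrow> real) set" where
  "bounded_measurable M = {f \<in> borel_measurable M. \<exists>C. \<forall>x\<in>space M. \<bar>f x\<bar> \<le> C}"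

lemma integrable_mult_bounded_measurable:
  assumes "finite_measure M" "f \<in> bounded_measurable M" "g \<in> bounded_measurable M"
  shows "integrable M (\<lambda>x. f x * g x)"
proof -
  interpret finite_measure M by fact
  obtain C D where "\<And>x. x \<in> space M \<Longrightarrow> \<bar>f x\<bar> \<le> C" "\<And>x. x \<in> space M \<Longrightarrow> \<bar>g x\<bar> \<le> D"
    using assms by (auto simp: bounded_measurable_def)
  then have "\<And>x. x \<in> space M \<Longrightarrow> norm (f x * g x) \<le> C * D"
    by (auto simp: abs_mult intro!: mult_mono order_trans[OF abs_ge_zero])
  then show ?thesis
    using assms by (intro integrable_const_bound[of _ "C * D"]) (auto simp: bounded_measurable_def)
qed

lemma inner_L2_commute: "inner_L2 M f g = inner_L2 M g f"
  by (simp add: inner_L2_def mult.commute)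

lemma inner_L2_cong:
  assumes "\<And>x. x \<in> space M \<Longrightarrow> f x = f' x" "\<And>x. x \<in> space M \<Longrightarrow> g x = g' x"
  shows "inner_L2 M f g = inner_L2 M f' g'"
  unfolding inner_L2_def using assms by (intro Bochner_Integration.integral_cong) auto

lemma inner_L2_nonneg: "0 \<le> inner_L2 M f f"
  unfolding inner_L2_def by simp

lemma inner_L2_add_scaled:
  assumes "finite_measure M"
    and "f \<in> bounded_measurable M" "g \<in> bounded_measurable M" "h \<in> bounded_measurable M"
  shows "inner_L2 M (\<lambda>x. f x + c * g x) h = inner_L2 M f h + c * inner_L2 M g h"
  using integrable_mult_bounded_measurable[OF assms(1,2,4)]
    integrable_mult_bounded_measurable[OF assms(1,3,4)]
  by (simp add: inner_L2_def algebra_simps)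

lemma inner_L2_scale: "inner_L2 M (\<lambda>x. c * f x) g = c * inner_L2 M f g"
  by (simp add: inner_L2_def mult.assoc)

definition prism :: "(real^'n) set \<Rightarrow> real^'n \<Rightarrow> real \<Rightarrow> (real^'n) set" where
  "prism e a s = {y. \<exists>\<tau>\<in>{0..s}. y - \<tau> *\<^sub>R a \<in> e}"

text \<open>With \<open>height\<close> and \<open>proj\<close> as normal and tangential coordinates, the surface measure of \<open>e\<close> is the
  projection of the Lebesgue measure on a tube over \<open>e\<close>. The last assumption is the regularity that makes
  a continuous function on \<open>e\<close> determined by its values almost everywhere.\<close>

locale flat_face =
  fixes e :: "(real^'n) set" and \<nu> :: "real^'n" and b :: real
  assumes norm_normal: "norm \<nu> = 1"
    and hull: "affine hull e = {y. \<nu> \<bullet> y = b}"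
    and compact_face: "compact e"
    and closure_face: "e \<subseteq> closure (rel_interior e)"
begin

definition height :: "real^'n \<Rightarrow> real" where "height y = \<nu> \<bullet> y - b"
definition proj :: "real^'n \<Rightarrow> real^'n" where "proj y = y - height y *\<^sub>R \<nu>"
definition tube :: "(real^'n) set" where "tube = {y. \<bar>height y\<bar> \<le> 1/2 \<and> proj y \<in> e}"

lemma inner_normal [simp]: "\<nu> \<bullet> \<nu> = 1"
  using norm_normal by (simp add: norm_eq_1)

lemma height_face: "x \<in> e \<Longrightarrow> \<nu> \<bullet> x = b"
  using hull hull_inc[of x e affine] by auto

lemma height_proj: "\<nu> \<bullet> proj y = b"
  by (simp add: proj_def height_def inner_diff_right)

lemma proj_face: "x \<in> e \<Longrightarrow> proj (x + t *\<^sub>R \<nu>) = x"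
  by (simp add: proj_def height_def inner_add_right height_face)

lemma height_face_add: "x \<in> e \<Longrightarrow> height (x + t *\<^sub>R \<nu>) = t"
  by (simp add: height_def inner_add_right height_face)

lemma closest_point_hull: "closest_point (affine hull e) y = proj y"
proof (rule closest_point_unique[symmetric])
  show "\<forall>z\<in>affine hull e. dist y (proj y) \<le> dist y z"
  proof
    fix z assume "z \<in> affine hull e"
    then have "height y = \<nu> \<bullet> (y - z)" by (simp add: hull height_def inner_diff_right)
    then have "\<bar>height y\<bar> \<le> norm (y - z)"
      using Cauchy_Schwarz_ineq2[of \<nu> "y - z"] norm_normal by simp
    then show "dist y (proj y) \<le> dist y z"
      by (simp add: dist_norm proj_def norm_normal)
  qed
qed (auto simp: hull height_proj affine_imp_convex affine_hyperplane closed_hyperplane)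

lemma infdist_hull: "infdist y (affine hull e) = \<bar>height y\<bar>"
proof -
  have "proj y \<in> affine hull e" by (simp add: hull height_proj)
  moreover have "closed (affine hull e)" by (simp add: hull closed_hyperplane)
  ultimately have "infdist y (affine hull e) = dist y (closest_point (affine hull e) y)"
    by (metis empty_iff infdist_eq_setdist setdist_closest_point setdist_sym)
  then show ?thesis by (simp add: closest_point_hull dist_norm proj_def norm_normal)
qed

lemma surface_measure_tube:
  "surface_measure e = distr (restrict_space lborel tube) (restrict_space borel e) proj"
  unfolding surface_measure_def tube_def closest_point_hull[abs_def] infdist_hull ..

lemma continuous_on_height: "continuous_on S height"
  unfolding height_def by (intro continuous_intros)

lemma continuous_on_proj: "continuous_on S proj"
  unfolding proj_def height_def by (intro continuous_intros)

lemma height_measurable [measurable]: "height \<in> borel_measurable borel"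
  by (rule borel_measurable_continuous_onI[OF continuous_on_height])

lemma proj_measurable [measurable]: "proj \<in> borel_measurable borel"
  by (rule borel_measurable_continuous_onI[OF continuous_on_proj])

lemma compact_tube: "compact tube"
proof -
  have "tube = {y. height y \<le> 1/2} \<inter> {y. - height y \<le> 1/2} \<inter> proj -` e"
    by (auto simp: tube_def)
  moreover have "closed (proj -` e)"
    using continuous_on_proj compact_imp_closed[OF compact_face]
    by (simp add: closed_vimage continuous_on_eq_continuous_at)
  moreover have "closed {y. height y \<le> 1/2}" "closed {y. - height y \<le> 1/2}"
    by (intro closed_Collect_le continuous_on_height continuous_intros)+
  ultimately have "closed tube" by (simp add: closed_Int)
  moreover have "bounded tube"
  proof -
    obtain C where C: "\<And>x. x \<in> e \<Longrightarrow> norm x \<le> C"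
      using compact_imp_bounded[OF compact_face] by (auto simp: bounded_iff)
    have "norm y \<le> C + 1" if "y \<in> tube" for y
    proof -
      have "norm y \<le> norm (proj y) + norm (height y *\<^sub>R \<nu>)"
        using norm_triangle_ineq[of "proj y" "height y *\<^sub>R \<nu>"] by (simp add: proj_def)
      then show ?thesis using that C[of "proj y"] by (simp add: tube_def norm_normal)
    qed
    then show ?thesis by (auto simp: bounded_iff)
  qed
  ultimately show ?thesis by (simp add: compact_eq_bounded_closed)
qed

lemma sets_tube [measurable]: "tube \<in> sets borel"
  by (simp add: compact_imp_closed compact_tube borel_closed)

lemma proj_measurable_tube: "proj \<in> measurable (restrict_space lborel tube) (restrict_space borel e)"
  by (rule measurable_restrict_space3) (auto simp: tube_def)

lemma space_surface: "space (surface_measure e) = e"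
  by (simp add: surface_measure_def space_restrict_space)

lemma sets_surface: "sets (surface_measure e) = sets (restrict_space borel e)"
  by (simp add: surface_measure_def)

lemma finite_measure_surface: "finite_measure (surface_measure e)"
  unfolding surface_measure_tube
proof (rule finite_measure.finite_measure_distr[OF _ proj_measurable_tube], rule finite_measureI)
  show "emeasure (restrict_space lborel tube) (space (restrict_space lborel tube)) \<noteq> \<infinity>"
    using emeasure_compact_finite[OF compact_tube]
    by (simp add: emeasure_restrict_space space_restrict_space)
qed

lemma measurable_surface_continuous:
  assumes "continuous_on UNIV F"
  shows "F \<in> borel_measurable (surface_measure e)"
proof -
  have "F \<in> borel_measurable (restrict_space borel e)"
    using borel_measurable_continuous_onI[OF assms] by (rule measurable_restrict_space1)
  then show ?thesis using measurable_cong_sets[OF sets_surface refl] by blast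
qed

lemma bounded_measurable_surface:
  assumes "continuous_on UNIV F" "\<And>x. x \<in> e \<Longrightarrow> f x = F x"
  shows "f \<in> bounded_measurable (surface_measure e)"
proof -
  have "bounded (F ` e)"
    using assms(1) compact_face by (meson compact_continuous_image compact_imp_bounded continuous_on_subset subset_UNIV)
  then obtain C where "\<And>x. x \<in> e \<Longrightarrow> \<bar>F x\<bar> \<le> C" by (auto simp: bounded_iff)
  moreover have "f \<in> borel_measurable (surface_measure e)"
    using measurable_surface_continuous[OF assms(1)] assms(2) space_surface
    by (subst measurable_cong[of _ f F]) auto
  ultimately show ?thesis
    using assms(2) by (auto simp: bounded_measurable_def space_surface)
qed

lemma surface_integral:
  fixes F :: "real^'n \<Rightarrow> real"
  assumes "continuous_on UNIV F"
  shows "integral\<^sup>L (surface_measure e) F = (\<integral>y. indicator tube y * F (proj y) \<partial>lborel)"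
proof -
  have "F \<in> borel_measurable (restrict_space borel e)"
    using borel_measurable_continuous_onI[OF assms] by (rule measurable_restrict_space1)
  then have "integral\<^sup>L (surface_measure e) F = integral\<^sup>L (restrict_space lborel tube) (\<lambda>y. F (proj y))"
    unfolding surface_measure_tube by (subst integral_distr[OF proj_measurable_tube]) auto
  then show ?thesis by (simp add: integral_restrict_space)
qed

text \<open>A continuous function on \<open>e\<close> that is nonzero somewhere is nonzero at a point of the relative
  interior, hence on a nonempty open part of the tube.\<close>

lemma surface_null_imp_zero:
  fixes F :: "real^'n \<Rightarrow> real"
  assumes F: "continuous_on UNIV F" and zero: "inner_L2 (surface_measure e) F F = 0"
  shows "\<forall>x\<in>e. F x = 0"
proof (rule ccontr)
  assume "\<not> (\<forall>x\<in>e. F x = 0)"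
  then obtain x where x: "x \<in> e" "F x \<noteq> 0" by blast
  have "open {y. F y \<noteq> 0}"
    using F by (intro open_Collect_neq) auto
  moreover have "x \<in> closure (rel_interior e)" using x closure_face by auto
  ultimately obtain x0 where x0: "x0 \<in> rel_interior e" "F x0 \<noteq> 0"
    using x by (auto simp: closure_iff_nhds_not_empty)
  obtain U where U: "open U" "rel_interior e = affine hull e \<inter> U"
    using openin_rel_interior[of e] by (auto simp: openin_open)
  define G where "G = proj -` (U \<inter> {y. F y \<noteq> 0}) \<inter> {y. height y < 1/2} \<inter> {y. - height y < 1/2}"
  have "open G"
  proof -
    have "open (proj -` (U \<inter> {y. F y \<noteq> 0}))"
      using continuous_on_proj U(1) \<open>open {y. F y \<noteq> 0}\<close>
      by (intro open_vimage) auto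
    moreover have "open {y. height y < 1/2}" "open {y. - height y < 1/2}"
      by (intro open_Collect_less continuous_on_height continuous_intros)+
    ultimately show ?thesis unfolding G_def by (intro open_Int)
  qed
  moreover have "x0 \<in> G"
  proof -
    have "x0 \<in> e" using x0 rel_interior_subset by blast
    then have "proj x0 = x0" "height x0 = 0" using proj_face[of x0 0] height_face_add[of x0 0] by simp_all
    then show ?thesis using x0 U(2) by (auto simp: G_def)
  qed
  moreover have "G \<subseteq> tube"
  proof
    fix y assume y: "y \<in> G"
    then have "proj y \<in> rel_interior e" using U(2) by (auto simp: G_def hull height_proj)
    then show "y \<in> tube" using y rel_interior_subset[of e] by (auto simp: G_def tube_def)
  qed
  moreover have FF: "continuous_on UNIV (\<lambda>x. F x * F x)" using F by (intro continuous_intros)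
  moreover have "integrable lborel (\<lambda>y. indicator tube y * (F (proj y) * F (proj y)))"
  proof -
    have "continuous_on tube (\<lambda>y. F (proj y) * F (proj y))"
      by (intro continuous_intros continuous_on_compose2[OF F continuous_on_proj]) auto
    then show ?thesis
      using borel_integrable_compact[OF compact_tube, of "\<lambda>y. F (proj y) * F (proj y)"] by simp
  qed
  ultimately have "AE y in lborel. indicator tube y * (F (proj y) * F (proj y)) = 0"
    using zero by (subst integral_nonneg_eq_0_iff_AE[symmetric])
      (auto simp: inner_L2_def surface_integral)
  then have "AE y in lborel. y \<notin> G"
    by eventually_elim (use \<open>G \<subseteq> tube\<close> in \<open>auto simp: G_def\<close>)
  then have "G \<in> null_sets lborel"
    using \<open>open G\<close> by (subst AE_iff_null_sets) (auto simp: borel_open)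
  then show False
    using \<open>open G\<close> \<open>x0 \<in> G\<close> open_not_negligible[of G]
    by (auto simp: negligible_iff_null_sets null_sets_completionI)
qed

text \<open>The prism \<open>{x + \<tau> a | x \<in> e, 0 \<le> \<tau> \<le> s}\<close> is the image of the tube over \<open>e\<close> under an affine map
  whose linear part \<open>y \<mapsto> y + (\<nu> \<bullet> y) (s a - \<nu>)\<close> has determinant \<open>s (\<nu> \<bullet> a)\<close>.\<close>

lemma compact_prism: "compact (prism e a s)"
proof -
  have "prism e a s = (\<lambda>(x, \<tau>). x + \<tau> *\<^sub>R a) ` (e \<times> {0..s})"
  proof (intro equalityI subsetI)
    fix y assume "y \<in> prism e a s"
    then obtain \<tau> where "\<tau> \<in> {0..s}" "y - \<tau> *\<^sub>R a \<in> e" by (auto simp: prism_def)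
    then show "y \<in> (\<lambda>(x, \<tau>). x + \<tau> *\<^sub>R a) ` (e \<times> {0..s})"
      by (intro image_eqI[of _ _ "(y - \<tau> *\<^sub>R a, \<tau>)"]) auto
  qed (force simp: prism_def)
  moreover have "continuous_on (e \<times> {0..s}) (\<lambda>(x, \<tau>). x + \<tau> *\<^sub>R a)"
    by (auto simp: case_prod_unfold intro!: continuous_intros)
  ultimately show ?thesis
    by (simp add: compact_continuous_image compact_Times compact_face)
qed

lemma integral_prism:
  fixes F :: "real^'n \<Rightarrow> real"
  assumes F: "continuous_on UNIV F" and s: "s > 0" and a: "\<nu> \<bullet> a \<noteq> 0"
  shows "(\<integral>y. indicator (prism e a s) y * F y \<partial>lborel)
    = s * \<bar>\<nu> \<bullet> a\<bar> * (\<integral>y. indicator tube y * F (proj y + (s * (height y + 1/2)) *\<^sub>R a) \<partial>lborel)"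
proof -
  let ?\<Phi> = "\<lambda>y. proj y + (s * (height y + 1/2)) *\<^sub>R a"
  define c where "c = b *\<^sub>R \<nu> + (s * (1/2 - b)) *\<^sub>R a"
  have \<Phi>: "?\<Phi> y = y + (\<nu> \<bullet> y) *\<^sub>R (s *\<^sub>R a - \<nu>) + c" for y
    by (simp add: proj_def height_def c_def algebra_simps)
  have det: "1 + \<nu> \<bullet> (s *\<^sub>R a - \<nu>) = s * (\<nu> \<bullet> a)"
    by (simp add: inner_diff_right)
  have ind: "indicator (prism e a s) (?\<Phi> y) = (indicator tube y :: real)" for y
  proof -
    have "?\<Phi> y \<in> prism e a s \<longleftrightarrow> y \<in> tube"
    proof
      assume "?\<Phi> y \<in> prism e a s"
      then obtain \<tau> where \<tau>: "\<tau> \<in> {0..s}" and mem: "?\<Phi> y - \<tau> *\<^sub>R a \<in> e" by (auto simp: prism_def)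
      have "\<nu> \<bullet> (?\<Phi> y - \<tau> *\<^sub>R a) = b" using height_face[OF mem] .
      then have "(s * (height y + 1/2) - \<tau>) * (\<nu> \<bullet> a) = 0"
        by (simp add: inner_diff_right inner_add_right height_proj algebra_simps)
      then have \<tau>_eq: "\<tau> = s * (height y + 1/2)" using a by simp
      then have "proj y \<in> e" using mem by simp
      moreover have "0 \<le> height y + 1/2" "height y + 1/2 \<le> 1"
        using \<tau> s unfolding \<tau>_eq by (auto simp: zero_le_mult_iff mult_le_cancel_left1)
      ultimately show "y \<in> tube" by (simp add: tube_def abs_le_iff)
    next
      assume y: "y \<in> tube"
      then have "s * (height y + 1/2) \<in> {0..s}"
        using s by (auto simp: tube_def mult_le_cancel_left1)
      moreover have "?\<Phi> y - (s * (height y + 1/2)) *\<^sub>R a \<in> e" using y by (simp add: tube_def)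
      ultimately show "?\<Phi> y \<in> prism e a s" unfolding prism_def by blast
    qed
    then show ?thesis by (simp add: indicator_def)
  qed
  have [measurable]: "F \<in> borel_measurable borel" by (rule borel_measurable_continuous_onI[OF F])
  have [measurable]: "prism e a s \<in> sets borel"
    by (simp add: borel_closed compact_imp_closed compact_prism)
  have "(\<integral>y. indicator (prism e a s) y * F y \<partial>lborel)
      = \<bar>1 + \<nu> \<bullet> (s *\<^sub>R a - \<nu>)\<bar> * (\<integral>y. indicator (prism e a s) (?\<Phi> y) * F (?\<Phi> y) \<partial>lborel)"
    unfolding \<Phi> using s a by (intro integral_rank_one) (auto simp: det)
  then show ?thesis
    using s by (simp add: ind det abs_mult)
qed

text \<open>The prism is thin as \<open>s \<rightarrow> 0\<close>: by dominated convergence \<open>F\<close> may be evaluated at the foot.\<close>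

lemma tendsto_integral_prism:
  fixes F :: "real^'n \<Rightarrow> real"
  assumes F: "continuous_on UNIV F" and a: "\<nu> \<bullet> a \<noteq> 0"
  shows "(\<lambda>m. real (Suc m) * (\<integral>y. indicator (prism e a (1 / real (Suc m))) y * F y \<partial>lborel))
    \<longlonglongrightarrow> \<bar>\<nu> \<bullet> a\<bar> * integral\<^sup>L (surface_measure e) F"
proof -
  let ?\<Phi> = "\<lambda>s y. proj y + (s * (height y + 1/2)) *\<^sub>R a"
  have cont: "continuous_on (UNIV \<times> UNIV) (\<lambda>(s, y). ?\<Phi> s y)"
    unfolding proj_def height_def by (auto simp: case_prod_unfold intro!: continuous_intros)
  have "continuous_on ({0..1} \<times> tube) (\<lambda>q. F (case q of (s, y) \<Rightarrow> ?\<Phi> s y))"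
    by (rule continuous_on_compose2[OF F continuous_on_subset[OF cont]]) auto
  then have "bounded ((\<lambda>q. F (case q of (s, y) \<Rightarrow> ?\<Phi> s y)) ` ({0..1} \<times> tube))"
    by (intro compact_imp_bounded compact_continuous_image compact_Times compact_tube) auto
  then obtain C where "\<forall>x\<in>{0..1}. \<forall>y\<in>tube. \<bar>F (?\<Phi> x y)\<bar> \<le> C"
    by (auto simp: bounded_iff)
  then have C: "\<And>s y. s \<in> {0..1} \<Longrightarrow> y \<in> tube \<Longrightarrow> \<bar>F (?\<Phi> s y)\<bar> \<le> C" by blast
  have Fm[measurable]: "F \<in> borel_measurable borel" by (rule borel_measurable_continuous_onI[OF F])
  have "(\<lambda>m. \<integral>y. indicator tube y * F (?\<Phi> (1 / real (Suc m)) y) \<partial>lborel)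
      \<longlonglongrightarrow> (\<integral>y. indicator tube y * F (proj y) \<partial>lborel)"
  proof (rule integral_dominated_convergence[where w = "\<lambda>y. indicator tube y * C"])
    show "integrable lborel (\<lambda>y. indicator tube y * C)"
      using emeasure_compact_finite[OF compact_tube] by (simp add: integrable_real_indicator)
    show "AE y in lborel. (\<lambda>m. indicator tube y * F (?\<Phi> (1 / real (Suc m)) y))
        \<longlonglongrightarrow> indicator tube y * F (proj y)"
    proof (rule AE_I2)
      fix y
      have "(\<lambda>m. ?\<Phi> (1 / real (Suc m)) y) \<longlonglongrightarrow> proj y + (0 * (height y + 1/2)) *\<^sub>R a"
        using LIMSEQ_inverse_real_of_nat by (intro tendsto_intros) (simp add: inverse_eq_divide)
      then have "(\<lambda>m. F (?\<Phi> (1 / real (Suc m)) y)) \<longlonglongrightarrow> F (proj y + (0 * (height y + 1/2)) *\<^sub>R a)"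
        using F by (auto intro: continuous_on_tendsto_compose)
      then show "(\<lambda>m. indicator tube y * F (?\<Phi> (1 / real (Suc m)) y))
          \<longlonglongrightarrow> indicator tube y * F (proj y)"
        by (intro tendsto_intros) simp
    qed
    show "AE y in lborel. norm (indicator tube y * F (?\<Phi> (1 / real (Suc m)) y)) \<le> indicator tube y * C" for m
      using C[of "1 / real (Suc m)"] by (intro AE_I2) (auto simp: indicator_def)
  qed simp_all
  then have "(\<lambda>m. \<bar>\<nu> \<bullet> a\<bar> * (\<integral>y. indicator tube y * F (?\<Phi> (1 / real (Suc m)) y) \<partial>lborel))
      \<longlonglongrightarrow> \<bar>\<nu> \<bullet> a\<bar> * integral\<^sup>L (surface_measure e) F"
    unfolding surface_integral[OF F] by (intro tendsto_intros)
  moreover have "real (Suc m) * (\<integral>y. indicator (prism e a (1 / real (Suc m))) y * F y \<partial>lborel)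
      = \<bar>\<nu> \<bullet> a\<bar> * (\<integral>y. indicator tube y * F (?\<Phi> (1 / real (Suc m)) y) \<partial>lborel)" for m
    by (subst integral_prism[OF F _ a]) simp_all
  ultimately show ?thesis by simp
qed

end

section \<open>Geometry of a mesh near a generic point of a face\<close>

text \<open>Codimension two is what a generic line in a given direction avoids: the union of the lines that meet
  such a set still lies in finitely many hyperplanes.\<close>

definition thin :: "(real^'n) set \<Rightarrow> bool" where
  "thin A \<longleftrightarrow> (\<exists>\<L>. finite \<L> \<and> (\<forall>L\<in>\<L>. aff_dim L \<le> int CARD('n) - 2) \<and> A \<subseteq> \<Union>\<L>)"

lemma thinI: "aff_dim A \<le> int CARD('n) - 2 \<Longrightarrow> thin (A :: (real^'n) set)"
  unfolding thin_def by (intro exI[of _ "{A}"]) simp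

lemma thin_subset: "thin B \<Longrightarrow> A \<subseteq> B \<Longrightarrow> thin A"
  unfolding thin_def by (meson order_trans)

lemma thin_UN:
  fixes A :: "'i \<Rightarrow> (real^'n) set"
  assumes "finite I" "\<And>i. i \<in> I \<Longrightarrow> thin (A i)"
  shows "thin (\<Union>i\<in>I. A i)"
proof -
  obtain \<L> where \<L>: "\<And>i. i \<in> I \<Longrightarrow> finite (\<L> i) \<and> (\<forall>L\<in>\<L> i. aff_dim L \<le> int CARD('n) - 2) \<and> A i \<subseteq> \<Union>(\<L> i)"
    using assms(2) unfolding thin_def by metis
  have "(\<Union>i\<in>I. A i) \<subseteq> \<Union>(\<Union>i\<in>I. \<L> i)" using \<L> by fastforce
  then show ?thesis
    unfolding thin_def using \<L> assms(1) by (intro exI[of _ "\<Union>i\<in>I. \<L> i"]) auto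
qed

lemma thin_Un: "thin A \<Longrightarrow> thin B \<Longrightarrow> thin (A \<union> B)"
  using thin_UN[of "UNIV :: bool set" "\<lambda>i. if i then A else B"]
  by (simp add: UNIV_bool Un_commute)

lemma negligible_lines_through_thin:
  fixes a :: "real^'n"
  assumes "thin A"
  shows "negligible {y. \<exists>\<tau>. y - \<tau> *\<^sub>R a \<in> A}"
proof -
  obtain \<L> where \<L>: "finite \<L>" "\<And>L. L \<in> \<L> \<Longrightarrow> aff_dim L \<le> int CARD('n) - 2" "A \<subseteq> \<Union>\<L>"
    using assms unfolding thin_def by blast
  have "negligible {y. \<exists>\<tau>. y - \<tau> *\<^sub>R a \<in> L}" if "L \<in> \<L>" for L
  proof (cases "L = {}")
    case False
    then obtain x0 where x0: "x0 \<in> L" by blast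
    let ?M = "insert (x0 + a) L"
    have "aff_dim ?M < int DIM(real^'n)"
      using \<L>(2)[OF that] by (simp add: aff_dim_insert)
    then have "aff_dim (affine hull ?M) < int DIM(real^'n)" by simp
    then obtain c d where cd: "c \<noteq> 0" "affine hull ?M \<subseteq> {x. c \<bullet> x = d}"
      using aff_lowdim_subset_hyperplane by blast
    have "{y. \<exists>\<tau>. y - \<tau> *\<^sub>R a \<in> L} \<subseteq> affine hull ?M"
    proof safe
      fix y \<tau> assume y: "y - \<tau> *\<^sub>R a \<in> L"
      have "(y - \<tau> *\<^sub>R a) + \<tau> *\<^sub>R ((x0 + a) - x0) \<in> affine hull ?M"
        by (rule mem_affine_3_minus) (use y x0 in \<open>auto intro: hull_inc\<close>)
      then show "y \<in> affine hull ?M" by simp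
    qed
    then show ?thesis
      using negligible_hyperplane[of c d] cd by (meson negligible_subset)
  qed simp
  then have "negligible (\<Union>L\<in>\<L>. {y. \<exists>\<tau>. y - \<tau> *\<^sub>R a \<in> L})"
    using \<L>(1) by (intro negligible_Union) auto
  then show ?thesis by (rule negligible_subset) (use \<L>(3) in blast)
qed

lemma polyhedral_cell_compact: "polyhedral_cell m S \<Longrightarrow> compact S"
  unfolding polyhedral_cell_def by (metis compact_Union polytope_imp_compact)

lemma polyhedral_cell_pieces:
  assumes "polyhedral_cell m S"
  shows "\<exists>\<P>. finite \<P> \<and> S = \<Union>\<P> \<and>
    (\<forall>p\<in>\<P>. polytope p \<and> aff_dim p = m \<and> rel_interior p \<subseteq> rel_interior S)"
proof -
  obtain \<P> where \<P>: "finite \<P>" "\<forall>p\<in>\<P>. polytope p \<and> aff_dim p = m" "S = \<Union>\<P>"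
    and dim: "aff_dim S = m"
    using assms unfolding polyhedral_cell_def by blast
  have "rel_interior p \<subseteq> rel_interior S" if "p \<in> \<P>" for p
  proof (rule subset_rel_interior)
    show sub: "p \<subseteq> S" using that \<P>(3) by blast
    show "affine hull p = affine hull S"
      using aff_dim_eq_full_gen[OF sub] \<P>(2) that dim by simp
  qed
  then show ?thesis using \<P> by blast
qed

lemma polyhedral_cell_closure_rel_interior:
  assumes "polyhedral_cell m S"
  shows "S \<subseteq> closure (rel_interior S)"
proof
  fix x assume "x \<in> S"
  obtain \<P> where \<P>: "\<And>p. p \<in> \<P> \<Longrightarrow> polytope p" "S = \<Union>\<P>" "\<And>p. p \<in> \<P> \<Longrightarrow> rel_interior p \<subseteq> rel_interior S"
    using polyhedral_cell_pieces[OF assms] by blast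
  then obtain p where p: "p \<in> \<P>" "x \<in> p" using \<open>x \<in> S\<close> by blast
  then have "x \<in> closure (rel_interior p)"
    using \<P>(1) closure_subset by (auto simp: convex_closure_rel_interior polytope_imp_convex)
  then show "x \<in> closure (rel_interior S)"
    using closure_mono[OF \<P>(3)[OF p(1)]] by blast
qed

lemma thin_rel_boundary:
  fixes S :: "(real^'n) set"
  assumes "polyhedral_cell (int CARD('n) - 1) S"
  shows "thin (S - rel_interior S)"
proof -
  obtain \<P> where \<P>: "finite \<P>" "\<And>p. p \<in> \<P> \<Longrightarrow> polytope p" "\<And>p. p \<in> \<P> \<Longrightarrow> aff_dim p = int CARD('n) - 1"
    "S = \<Union>\<P>" "\<And>p. p \<in> \<P> \<Longrightarrow> rel_interior p \<subseteq> rel_interior S"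
    using polyhedral_cell_pieces[OF assms] by blast
  have "thin (p - rel_interior p)" if "p \<in> \<P>" for p
  proof -
    have "p - rel_interior p = \<Union>{F. F facet_of p}"
      using \<P>(2)[OF that] by (simp add: rel_boundary_of_polyhedron polytope_imp_polyhedron)
    moreover have "aff_dim F \<le> int CARD('n) - 2" if "F facet_of p" for F
      using that \<P>(3)[OF \<open>p \<in> \<P>\<close>] by (simp add: facet_of_def)
    ultimately show ?thesis
      unfolding thin_def using finite_polytope_facets[OF \<P>(2)[OF that]]
      by (intro exI[of _ "{F. F facet_of p}"]) auto
  qed
  then have "thin (\<Union>p\<in>\<P>. p - rel_interior p)" by (rule thin_UN[OF \<P>(1)])
  then show ?thesis by (rule thin_subset) (use \<P>(4,5) in blast)
qed

lemma affine_hull_face: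
  fixes e :: "(real^'n) set"
  assumes "aff_dim e = int CARD('n) - 1" and \<nu>: "unit_normal e \<nu>" and "x \<in> e"
  shows "affine hull e = {y. \<nu> \<bullet> y = \<nu> \<bullet> x}"
proof -
  have sub: "e \<subseteq> {y. \<nu> \<bullet> y = \<nu> \<bullet> x}"
  proof
    fix y assume "y \<in> e"
    then have "\<nu> \<bullet> (y - x) = 0" using \<nu> \<open>x \<in> e\<close> by (simp add: unit_normal_def)
    then show "y \<in> {y. \<nu> \<bullet> y = \<nu> \<bullet> x}" by (simp add: inner_diff_right)
  qed
  have "\<nu> \<noteq> 0" using \<nu> by (auto simp: unit_normal_def)
  then have "aff_dim e = aff_dim {y. \<nu> \<bullet> y = \<nu> \<bullet> x}"
    using assms(1) by (simp add: aff_dim_hyperplane)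
  then have "affine hull e = affine hull {y. \<nu> \<bullet> y = \<nu> \<bullet> x}"
    using aff_dim_eq_full_gen[OF sub] by blast
  then show ?thesis by (simp add: affine_hyperplane hull_same)
qed

lemma unit_normal_unique:
  fixes e :: "(real^'n) set"
  assumes dim: "aff_dim e = int CARD('n) - 1" and "e \<noteq> {}" and \<nu>: "unit_normal e \<nu>" and \<mu>: "unit_normal e \<mu>"
  shows "\<mu> = \<nu> \<or> \<mu> = - \<nu>"
proof -
  obtain x where x: "x \<in> e" using \<open>e \<noteq> {}\<close> by blast
  have norms: "\<nu> \<bullet> \<nu> = 1" "\<mu> \<bullet> \<mu> = 1" using \<nu> \<mu> by (auto simp: unit_normal_def norm_eq_1)
  define z where "z = \<mu> - (\<mu> \<bullet> \<nu>) *\<^sub>R \<nu>"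
  have "\<nu> \<bullet> (x + z) = \<nu> \<bullet> x"
    by (simp add: z_def inner_add_right inner_diff_right norms inner_commute)
  then have "x + z \<in> {y. \<mu> \<bullet> y = \<mu> \<bullet> x}"
    using affine_hull_face[OF dim \<nu> x] affine_hull_face[OF dim \<mu> x] by blast
  then have "\<mu> \<bullet> z = 0" by (simp add: inner_add_right)
  then have sq: "(\<mu> \<bullet> \<nu>)\<^sup>2 = 1"
    by (simp add: z_def inner_diff_right norms power2_eq_square)
  then have "z \<bullet> z = 0"
    by (simp add: z_def inner_diff_right inner_diff_left norms inner_commute power2_eq_square)
  then have "\<mu> = (\<mu> \<bullet> \<nu>) *\<^sub>R \<nu>" by (simp add: z_def)
  moreover have "\<mu> \<bullet> \<nu> = 1 \<or> \<mu> \<bullet> \<nu> = -1" using sq by (simp add: power2_eq_1_iff)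
  ultimately show ?thesis by (metis scaleR_minus1_left scaleR_one)
qed

lemma shape_regular_pyramid:
  fixes \<T> \<E> :: "(real^'n) set set"
  shows "shape_regular \<T> \<E> \<Longrightarrow> T \<in> \<T> \<Longrightarrow> e \<in> faces_on \<E> T \<Longrightarrow>
    \<exists>\<sigma>>0. \<exists>A. pyramid e A \<subseteq> T \<and> infdist A (affine hull e) \<ge> \<sigma> * diameter T"
  unfolding shape_regular_def
  by (elim exE conjE, drule (1) bspec, elim conjE, drule (1) bspec, elim conjE bexE) (intro exI conjI)

abbreviation half_space_at :: "(real^'n) set \<Rightarrow> real^'n \<Rightarrow> real^'n \<Rightarrow> bool" where
  "half_space_at T \<nu> z \<equiv> \<forall>\<^sub>F y in nhds z.
     (\<nu> \<bullet> (y - z) < 0 \<longrightarrow> y \<in> interior T) \<and> (\<nu> \<bullet> (y - z) > 0 \<longrightarrow> y \<notin> T)"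

locale wg_mesh =
  fixes \<Omega> :: "(real^'n) set" and \<T> \<E> :: "(real^'n) set set" and \<n> :: "(real^'n) set \<Rightarrow> real^'n"
  assumes dim: "CARD('n) \<ge> 2"
    and domain: "polyhedral_domain \<Omega>"
    and mesh: "polyhedral_mesh \<Omega> \<T> \<E>"
    and regular: "shape_regular \<T> \<E>"
    and normals: "\<forall>e\<in>\<E>. unit_normal e (\<n> e)"
begin

lemma finite_mesh: "finite \<T>" "finite \<E>"
  using mesh by (auto simp: polyhedral_mesh_def)

lemma elem_cell: "T \<in> \<T> \<Longrightarrow> polyhedral_cell (int CARD('n)) T"
  and face_cell: "e \<in> \<E> \<Longrightarrow> polyhedral_cell (int CARD('n) - 1) e"
  and frontier_elem: "T \<in> \<T> \<Longrightarrow> frontier T = \<Union>(faces_on \<E> T)"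
  and cover: "\<Union>\<T> = closure \<Omega>"
  and face_on_elem: "e \<in> \<E> \<Longrightarrow> \<exists>T\<in>\<T>. e \<in> faces_on \<E> T"
  using mesh by (simp_all add: polyhedral_mesh_def)

lemma elems_disjoint:
  assumes "T \<in> \<T>" "T' \<in> \<T>" "x \<in> interior T" "x \<in> interior T'"
  shows "T = T'"
proof (rule ccontr)
  assume "T \<noteq> T'"
  then have "interior T \<inter> interior T' = {}" using mesh assms(1,2) by (simp add: polyhedral_mesh_def)
  then show False using assms(3,4) by blast
qed

lemma faces_disjoint:
  assumes "e \<in> \<E>" "e' \<in> \<E>" "x \<in> rel_interior e" "x \<in> rel_interior e'"
  shows "e = e'"
proof (rule ccontr)
  assume "e \<noteq> e'"
  then have "rel_interior e \<inter> rel_interior e' = {}" using mesh assms(1,2) by (simp add: polyhedral_mesh_def)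
  then show False using assms(3,4) by blast
qed

lemma faces_on_subset: "faces_on \<E> S \<subseteq> \<E>"
  by (auto simp: faces_on_def)

lemma finite_faces_on: "finite (faces_on \<E> S)"
  using finite_mesh(2) faces_on_subset finite_subset by blast

lemma faces_onD: "e \<in> faces_on \<E> S \<Longrightarrow> e \<in> \<E>"
  by (simp add: faces_on_def)

lemma compact_elem: "T \<in> \<T> \<Longrightarrow> compact T"
  using polyhedral_cell_compact elem_cell by blast

lemma closed_elem: "T \<in> \<T> \<Longrightarrow> closed T"
  using compact_elem compact_imp_closed by blast

lemma compact_face: "e \<in> \<E> \<Longrightarrow> compact e"
  using polyhedral_cell_compact face_cell by blast

lemma face_subset_elem: "T \<in> \<T> \<Longrightarrow> e \<in> faces_on \<E> T \<Longrightarrow> e \<subseteq> T"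
  using closed_elem frontier_subset_closed by (auto simp: faces_on_def)

lemma interior_elem_nonempty:
  assumes "T \<in> \<T>" shows "interior T \<noteq> {}"
proof -
  have "aff_dim T = int CARD('n)" using elem_cell[OF assms] by (simp add: polyhedral_cell_def)
  then have "T \<noteq> {}" "interior T = rel_interior T"
    by (auto simp: interior_rel_interior_gen)
  then show ?thesis
    using polyhedral_cell_closure_rel_interior[OF elem_cell[OF assms]] by auto
qed

lemma aff_dim_face: "e \<in> \<E> \<Longrightarrow> aff_dim e = int CARD('n) - 1"
  using face_cell by (simp add: polyhedral_cell_def)

lemma face_nonempty: "e \<in> \<E> \<Longrightarrow> e \<noteq> {}"
  using aff_dim_face[of e] dim by auto

lemma diameter_elem_pos:
  assumes "T \<in> \<T>" shows "diameter T > 0"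
proof -
  obtain x where x: "x \<in> interior T" using interior_elem_nonempty[OF assms] by blast
  have "\<not> T \<subseteq> {x}"
  proof
    assume "T \<subseteq> {x}"
    then have "interior T \<subseteq> interior {x}" by (rule interior_mono)
    then show False using x by simp
  qed
  then obtain y where "y \<in> T" "y \<noteq> x" by blast
  then show ?thesis
    using diameter_bounded_bound[OF compact_imp_bounded[OF compact_elem[OF assms]], of x y] x interior_subset
    by (metis dist_pos_lt order.strict_trans2 subsetD)
qed

definition level :: "(real^'n) set \<Rightarrow> real" where
  "level e = \<n> e \<bullet> (SOME x. x \<in> e)"

lemma flat_face: assumes "e \<in> \<E>" shows "flat_face e (\<n> e) (level e)"
proof
  show "norm (\<n> e) = 1" using normals assms by (auto simp: unit_normal_def)
  show "affine hull e = {y. \<n> e \<bullet> y = level e}"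
    unfolding level_def
    using affine_hull_face[OF aff_dim_face[OF assms]] normals assms face_nonempty[OF assms]
    by (simp add: some_in_eq)
  show "compact e" by (rule compact_face[OF assms])
  show "e \<subseteq> closure (rel_interior e)"
    using polyhedral_cell_closure_rel_interior face_cell[OF assms] .
qed

lemma hull_face: "e \<in> \<E> \<Longrightarrow> affine hull e = {y. \<n> e \<bullet> y = level e}"
  using flat_face.hull[OF flat_face] .

lemma face_level: "e \<in> \<E> \<Longrightarrow> x \<in> e \<Longrightarrow> \<n> e \<bullet> x = level e"
  using flat_face.height_face[OF flat_face] .

lemma normal_nonzero: "e \<in> \<E> \<Longrightarrow> \<n> e \<noteq> 0"
  using flat_face.norm_normal[OF flat_face] by force

lemma normal_self: "e \<in> \<E> \<Longrightarrow> \<n> e \<bullet> \<n> e = 1"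
  using flat_face.inner_normal[OF flat_face] .

text \<open>A point outside this set lies on the hyperplane of at most one face up to coplanarity, and in at most
  one face, then in its relative interior.\<close>

definition crossings :: "(real^'n) set" where
  "crossings = (\<Union>e\<in>\<E>. e - rel_interior e) \<union>
     (\<Union>e\<in>\<E>. \<Union>e'\<in>{e'\<in>\<E>. affine hull e' \<noteq> affine hull e}. affine hull e \<inter> affine hull e')"

lemma thin_crossings: "thin crossings"
  unfolding crossings_def
proof (intro thin_Un thin_UN)
  fix e e' assume e: "e \<in> \<E>" "e' \<in> {e'\<in>\<E>. affine hull e' \<noteq> affine hull e}"
  have "affine hull e \<inter> affine hull e' \<subset> affine hull e"
  proof -
    have "\<not> affine hull e \<subseteq> affine hull e'"
      using aff_dim_eq_full_gen[of "affine hull e" "affine hull e'"] e aff_dim_face by auto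
    then show ?thesis by blast
  qed
  then have "affine hull (affine hull e \<inter> affine hull e') \<subset> affine hull (affine hull e)"
    by (simp add: affine_Int hull_same hull_hull)
  then have "aff_dim (affine hull e \<inter> affine hull e') < aff_dim (affine hull e)"
    by (rule aff_dim_psubset)
  then show "thin (affine hull e \<inter> affine hull e')"
    using e aff_dim_face by (intro thinI) auto
qed (use finite_mesh thin_rel_boundary face_cell in auto)

lemma generic_unique_face:
  assumes "z \<notin> crossings" "e \<in> \<E>" "z \<in> e" "e' \<in> \<E>" "z \<in> e'"
  shows "e' = e"
proof -
  have "z \<in> rel_interior e" "z \<in> rel_interior e'"
    using assms unfolding crossings_def by blast+
  then show ?thesis using assms faces_disjoint by blast
qed

lemma generic_rel_interior: "z \<notin> crossings \<Longrightarrow> e \<in> \<E> \<Longrightarrow> z \<in> e \<Longrightarrow> z \<in> rel_interior e"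
  unfolding crossings_def by blast

text \<open>Near a point of the relative interior, a face fills its hyperplane, and almost every normal line
  avoids the crossings.\<close>

lemma generic_points_dense:
  assumes e: "e \<in> \<E>" and U: "open U" "U \<inter> e \<noteq> {}"
  obtains z where "z \<in> U" "z \<in> e" "z \<notin> crossings"
proof -
  interpret flat_face e "\<n> e" "level e" by (rule flat_face[OF e])
  obtain x where x: "x \<in> U" "x \<in> e" using U by blast
  then have "x \<in> closure (rel_interior e)" using closure_face by blast
  then obtain x0 where x0: "x0 \<in> U" "x0 \<in> rel_interior e"
    using U(1) x(1) by (auto simp: closure_iff_nhds_not_empty)
  obtain W where W: "open W" "rel_interior e = affine hull e \<inter> W"
    using openin_rel_interior[of e] by (auto simp: openin_open)
  have "open (U \<inter> W)" "x0 \<in> U \<inter> W" using U(1) W x0 by auto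
  then obtain r where r: "r > 0" "ball x0 r \<subseteq> U \<inter> W" using open_contains_ball by blast
  have "negligible {y. \<exists>\<tau>. y - \<tau> *\<^sub>R \<n> e \<in> crossings}"
    by (rule negligible_lines_through_thin[OF thin_crossings])
  moreover have "\<not> negligible (ball x0 r)"
    using r(1) by (intro open_not_negligible) auto
  ultimately have "\<not> ball x0 r \<subseteq> {y. \<exists>\<tau>. y - \<tau> *\<^sub>R \<n> e \<in> crossings}"
    using negligible_subset by blast
  then obtain y where y: "y \<in> ball x0 r" "\<And>\<tau>. y - \<tau> *\<^sub>R \<n> e \<notin> crossings"
    by blast
  have "x0 \<in> e" using x0 rel_interior_subset by blast
  have "proj y \<in> ball x0 r"
  proof -
    have "dist (proj y) x0 \<le> dist y x0"
    proof -
      define d where "d = y - x0"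
      have "proj y - x0 = d - (\<n> e \<bullet> d) *\<^sub>R \<n> e"
        using height_face[OF \<open>x0 \<in> e\<close>] by (simp add: proj_def height_def d_def inner_diff_right)
      then have "(norm (proj y - x0))\<^sup>2 = (norm d)\<^sup>2 - (\<n> e \<bullet> d)\<^sup>2"
        unfolding power2_norm_eq_inner
        by (simp add: inner_diff_left inner_diff_right inner_commute power2_eq_square)
      then have "(norm (proj y - x0))\<^sup>2 \<le> (norm (y - x0))\<^sup>2" by (simp add: d_def)
      then show ?thesis unfolding dist_norm by (rule power2_le_imp_le) simp
    qed
    then show ?thesis using y(1) by (simp add: dist_commute)
  qed
  then have "proj y \<in> U" "proj y \<in> W" using r(2) by auto
  moreover have "proj y \<in> e"
    using \<open>proj y \<in> W\<close> W(2) rel_interior_subset[of e] by (auto simp: hull height_proj)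
  moreover have "proj y \<notin> crossings" unfolding proj_def by (rule y(2))
  ultimately show ?thesis using that by blast
qed

lemma apex:
  assumes "T \<in> \<T>" "e \<in> faces_on \<E> T"
  obtains A where "\<And>x. x \<in> e \<Longrightarrow> closed_segment x A \<subseteq> T" "A \<notin> affine hull e"
proof -
  obtain \<sigma> :: real and A where "\<sigma> > 0" and A: "pyramid e A \<subseteq> T" "infdist A (affine hull e) \<ge> \<sigma> * diameter T"
    using shape_regular_pyramid[OF regular assms] by blast
  then have "infdist A (affine hull e) > 0"
    using diameter_elem_pos[OF assms(1)] by (meson mult_pos_pos order.strict_trans2)
  then have "A \<notin> affine hull e" by (auto simp: infdist_zero)
  moreover have "closed_segment x A \<subseteq> T" if "x \<in> e" for x
    using A(1) that unfolding pyramid_def by blast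
  ultimately show ?thesis using that by blast
qed

text \<open>Near a generic point of one of its faces, an element is a half ball: a half ball around the point
  meets no other hyperplane of a face, hence misses the boundary. The segment to the apex of the pyramid
  shows which half belongs to the element; the other half cannot, as the point is on the boundary.\<close>

lemma half_ball:
  assumes T: "T \<in> \<T>" and e: "e \<in> faces_on \<E> T" and z: "z \<in> e" "z \<notin> crossings"
    and A: "closed_segment z A \<subseteq> T" and \<nu>: "\<nu> = \<n> e \<or> \<nu> = - \<n> e" "\<nu> \<bullet> A < \<nu> \<bullet> z"
  shows "half_space_at T \<nu> z"
proof -
  have eE: "e \<in> \<E>" using e faces_onD by blast
  let ?H = "\<Union>e'\<in>{e'\<in>\<E>. affine hull e' \<noteq> affine hull e}. affine hull e'"
  have "closed ?H" by (intro closed_UN closed_affine_hull) (use finite_mesh in auto)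
  moreover have "z \<notin> ?H"
    using z eE hull_inc[of z e affine] unfolding crossings_def by blast
  ultimately have "open (- ?H)" "z \<in> - ?H" by (simp_all only: open_Compl Compl_iff not_False_eq_True)
  then obtain r where r: "r > 0" "ball z r \<subseteq> - ?H" by (rule openE)
  have front: "y \<notin> frontier T" if "y \<in> ball z r" "\<nu> \<bullet> (y - z) \<noteq> 0" for y
  proof
    assume "y \<in> frontier T"
    then obtain e' where e': "e' \<in> \<E>" "y \<in> e'" using frontier_elem[OF T] faces_onD by auto
    then have "y \<in> affine hull e'" by (simp add: hull_inc)
    then have "affine hull e' = affine hull e" using e'(1) r(2) that(1) by blast
    then have "\<n> e \<bullet> y = \<n> e \<bullet> z"
      using \<open>y \<in> affine hull e'\<close> hull_face[OF eE] face_level[OF eE z(1)] by simp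
    then show False using that(2) \<nu>(1) by (auto simp: inner_diff_right)
  qed
  have side: "M \<inter> T = {} \<or> M \<subseteq> interior T"
    if M: "M = ball z r \<inter> {y. \<nu> \<bullet> y < \<nu> \<bullet> z} \<or> M = ball z r \<inter> {y. \<nu> \<bullet> y > \<nu> \<bullet> z}" for M
  proof (rule ccontr)
    assume neg: "\<not> (M \<inter> T = {} \<or> M \<subseteq> interior T)"
    have "convex M" using M by (auto intro: convex_Int convex_halfspace_lt convex_halfspace_gt)
    moreover have "M \<inter> frontier T = {}" using M front by (auto simp: inner_diff_right)
    moreover have "M - T \<noteq> {}"
    proof
      assume "M - T = {}"
      then have "M \<subseteq> interior T"
        using \<open>M \<inter> frontier T = {}\<close> closed_elem[OF T] by (auto simp: frontier_def)
      then show False using neg by blast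
    qed
    ultimately show False
      using connected_Int_frontier[OF convex_connected, of M T] neg by blast
  qed
  let ?M = "ball z r \<inter> {y. \<nu> \<bullet> y < \<nu> \<bullet> z}" and ?P = "ball z r \<inter> {y. \<nu> \<bullet> y > \<nu> \<bullet> z}"
  have "?M \<inter> T \<noteq> {}"
  proof -
    define t where "t = min 1 (r / (2 * (norm (A - z) + 1)))"
    have t: "0 < t" "t \<le> 1" using r(1) by (auto simp: t_def divide_pos_pos add_nonneg_pos)
    have "t * norm (A - z) \<le> r / (2 * (norm (A - z) + 1)) * norm (A - z)"
      by (intro mult_right_mono) (auto simp: t_def)
    also have "\<dots> = r * (norm (A - z) / (2 * (norm (A - z) + 1)))" by simp
    also have "\<dots> < r * 1"
      using r(1) by (intro mult_strict_left_mono) (auto simp: divide_less_eq add_nonneg_pos)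
    finally have "z + t *\<^sub>R (A - z) \<in> ball z r" using t by (simp add: dist_norm)
    moreover have "\<nu> \<bullet> (z + t *\<^sub>R (A - z)) < \<nu> \<bullet> z"
      using t \<nu>(2) by (simp add: inner_add_right inner_diff_right mult_less_0_iff)
    moreover have "z + t *\<^sub>R (A - z) = (1 - t) *\<^sub>R z + t *\<^sub>R A" by (simp add: algebra_simps)
    then have "z + t *\<^sub>R (A - z) \<in> closed_segment z A" using t by (auto simp: closed_segment_def)
    then have "z + t *\<^sub>R (A - z) \<in> T" using A by blast
    ultimately show ?thesis by blast
  qed
  then have M: "?M \<subseteq> interior T" using side by blast
  have "?P \<inter> T = {}"
  proof (rule ccontr)
    assume "?P \<inter> T \<noteq> {}"
    then have P: "?P \<subseteq> interior T" using side by blast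
    have "ball z r \<subseteq> T"
    proof
      fix y assume y: "y \<in> ball z r"
      show "y \<in> T"
      proof (cases "\<nu> \<bullet> y = \<nu> \<bullet> z")
        case False
        then have "y \<in> ?M \<or> y \<in> ?P" using y by auto
        then show ?thesis using M P interior_subset[of T] by blast
      next
        case True
        have "((\<lambda>t. y - t *\<^sub>R \<nu>) \<longlongrightarrow> y - 0 *\<^sub>R \<nu>) (at_right 0)" by (intro tendsto_intros)
        then have lim: "((\<lambda>t. y - t *\<^sub>R \<nu>) \<longlongrightarrow> y) (at_right 0)" by simp
        have "\<nu> \<bullet> \<nu> = 1" using \<nu>(1) normal_self[OF eE] by auto
        then have "\<forall>\<^sub>F t in at_right 0. \<nu> \<bullet> (y - t *\<^sub>R \<nu>) < \<nu> \<bullet> z"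
          using True eventually_at_right_less[of "0::real"] by (auto simp: inner_diff_right elim: eventually_mono)
        moreover have "\<forall>\<^sub>F t in at_right 0. y - t *\<^sub>R \<nu> \<in> ball z r"
          using topological_tendstoD[OF lim open_ball y] .
        ultimately have "\<forall>\<^sub>F t in at_right 0. y - t *\<^sub>R \<nu> \<in> T"
        proof eventually_elim
          case (elim t)
          then have "y - t *\<^sub>R \<nu> \<in> ?M" by simp
          then show ?case using M interior_subset[of T] by blast
        qed
        then show ?thesis
          using Lim_in_closed_set[OF closed_elem[OF T] _ _ lim] by simp
      qed
    qed
    then have "z \<in> interior T" using r(1) by (meson centre_in_ball interior_maximal open_ball subsetD)
    moreover have "z \<in> frontier T" using e z(1) by (auto simp: faces_on_def)
    ultimately show False by (simp add: frontier_def)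
  qed
  then have "\<forall>y\<in>ball z r. (\<nu> \<bullet> (y - z) < 0 \<longrightarrow> y \<in> interior T) \<and> (\<nu> \<bullet> (y - z) > 0 \<longrightarrow> y \<notin> T)"
    using M by (auto simp: inner_diff_right)
  then show ?thesis
    using r(1) by (intro eventually_nhds[THEN iffD2] exI[of _ "ball z r"]) auto
qed

text \<open>The pyramid contains, near every point of the relative interior of its base, the inner side of
  the base; this excludes the other choice of the sign of the normal.\<close>

lemma inward_in_elem:
  assumes T: "T \<in> \<T>" and e: "e \<in> faces_on \<E> T" and x: "x \<in> rel_interior e"
    and A: "\<And>x. x \<in> e \<Longrightarrow> closed_segment x A \<subseteq> T" and \<nu>: "\<nu> = \<n> e \<or> \<nu> = - \<n> e" "\<nu> \<bullet> A < \<nu> \<bullet> x"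
  shows "\<forall>\<^sub>F t in at_right 0. x - t *\<^sub>R \<nu> \<in> T"
proof -
  have eE: "e \<in> \<E>" using e faces_onD by blast
  have xe: "x \<in> e" using x rel_interior_subset by blast
  obtain W where W: "open W" "rel_interior e = affine hull e \<inter> W"
    using openin_rel_interior[of e] by (auto simp: openin_open)
  define h where "h = \<nu> \<bullet> x - \<nu> \<bullet> A"
  have h: "h > 0" using \<nu>(2) by (simp add: h_def)
  have \<nu>1: "\<nu> \<bullet> \<nu> = 1" using \<nu>(1) normal_self[OF eE] by auto
  \<comment> \<open>the point where the line from \<open>A\<close> through \<open>x - t \<nu>\<close> meets the hyperplane\<close>
  define y where "y t = (1 / (1 - t / h)) *\<^sub>R (x - t *\<^sub>R \<nu> - (t / h) *\<^sub>R A)" for t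
  have "(y \<longlongrightarrow> (1 / (1 - 0 / h)) *\<^sub>R (x - 0 *\<^sub>R \<nu> - (0 / h) *\<^sub>R A)) (at_right 0)"
    unfolding y_def using h by (intro tendsto_intros) auto
  then have "(y \<longlongrightarrow> x) (at_right 0)" by simp
  then have "\<forall>\<^sub>F t in at_right 0. y t \<in> W"
    using topological_tendstoD[OF _ W(1)] x W(2) by blast
  moreover have "\<forall>\<^sub>F t in at_right 0. t \<in> {0<..<h}"
    using eventually_at_right_real[OF h] .
  ultimately show ?thesis
  proof eventually_elim
    case (elim t)
    have t: "0 \<le> t / h" "t / h \<le> 1" "1 - t / h \<noteq> 0" using elim h by (auto simp: divide_le_eq)
    have "\<nu> \<bullet> y t = (1 / (1 - t / h)) * (\<nu> \<bullet> x - t - (t / h) * (\<nu> \<bullet> x - h))"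
      by (simp add: y_def inner_diff_right \<nu>1 h_def)
    also have "\<nu> \<bullet> x - t - (t / h) * (\<nu> \<bullet> x - h) = (1 - t / h) * (\<nu> \<bullet> x)"
      using h by (simp add: field_simps)
    also have "1 / (1 - t / h) * ((1 - t / h) * (\<nu> \<bullet> x)) = \<nu> \<bullet> x"
      using t(3) by (metis (no_types) mult.assoc divide_self_if mult_1 times_divide_eq_left)
    finally have "\<nu> \<bullet> y t = \<nu> \<bullet> x" .
    then have "\<n> e \<bullet> y t = \<n> e \<bullet> x" using \<nu>(1) by auto
    then have "y t \<in> affine hull e" using hull_face[OF eE] face_level[OF eE xe] by simp
    then have "y t \<in> e" using elim W(2) rel_interior_subset by blast
    moreover have "x - t *\<^sub>R \<nu> = (1 - t / h) *\<^sub>R y t + (t / h) *\<^sub>R A"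
    proof -
      have "(1 - t / h) *\<^sub>R y t = ((1 - t / h) * (1 / (1 - t / h))) *\<^sub>R (x - t *\<^sub>R \<nu> - (t / h) *\<^sub>R A)"
        by (simp only: y_def scaleR_scaleR)
      also have "(1 - t / h) * (1 / (1 - t / h)) = 1" using t(3)
          by (metis divide_self mult.right_neutral times_divide_eq_right)
      finally show ?thesis by simp
    qed
    then have "x - t *\<^sub>R \<nu> \<in> closed_segment (y t) A"
      using t by (auto simp: closed_segment_def)
    ultimately show "x - t *\<^sub>R \<nu> \<in> T" using A by blast
  qed
qed

text \<open>\<open>outer_normal\<close> is a definite description. Generic points of the face show that the normal pointing
  away from the apex satisfies it, the preceding lemma that the opposite one does not.\<close>

lemma outer_normal_char:
  assumes T: "T \<in> \<T>" and e: "e \<in> faces_on \<E> T"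
  shows "outer_normal T e = \<n> e \<or> outer_normal T e = - \<n> e"
    and "\<And>z. z \<in> e \<Longrightarrow> z \<notin> crossings \<Longrightarrow>
      half_space_at T (outer_normal T e) z"
proof -
  have eE: "e \<in> \<E>" using e faces_onD by blast
  obtain A where A: "\<And>x. x \<in> e \<Longrightarrow> closed_segment x A \<subseteq> T" "A \<notin> affine hull e"
    using apex[OF T e] by blast
  define \<nu> where "\<nu> = (if \<n> e \<bullet> A < level e then \<n> e else - \<n> e)"
  have \<nu>: "\<nu> = \<n> e \<or> \<nu> = - \<n> e" by (simp add: \<nu>_def)
  have \<nu>A: "\<nu> \<bullet> A < \<nu> \<bullet> x" if "x \<in> e" for x
    using A(2) face_level[OF eE that] hull_face[OF eE] by (auto simp: \<nu>_def)
  have half: "half_space_at T \<nu> z"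
    if "z \<in> e" "z \<notin> crossings" for z
    using half_ball[OF T e that A(1)[OF that(1)] \<nu> \<nu>A[OF that(1)]] .
  have unit: "unit_normal e \<nu>" using normals eE \<nu> by (auto simp: unit_normal_def)
  have \<nu>1: "\<nu> \<bullet> \<nu> = 1" using \<nu> normal_self[OF eE] by auto
  obtain z where z: "z \<in> e" "z \<notin> crossings"
    using generic_points_dense[OF eE open_UNIV] face_nonempty[OF eE] by auto
  have "outer_normal T e = \<nu>"
    unfolding outer_normal_def
  proof (rule the_equality, intro conjI bexI[of _ z])
    show "unit_normal e \<nu>" by (rule unit)
    show "z \<in> rel_interior e" using generic_rel_interior[OF z(2) eE z(1)] .
    have lim: "((\<lambda>t. z + (c * t) *\<^sub>R \<nu>) \<longlongrightarrow> z + (c * 0) *\<^sub>R \<nu>) (at_right 0)" for c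
      by (intro tendsto_intros)
    have near: "\<forall>\<^sub>F t in at_right 0. (\<nu> \<bullet> ((z + (c * t) *\<^sub>R \<nu>) - z) < 0 \<longrightarrow> z + (c * t) *\<^sub>R \<nu> \<in> interior T) \<and>
        (\<nu> \<bullet> ((z + (c * t) *\<^sub>R \<nu>) - z) > 0 \<longrightarrow> z + (c * t) *\<^sub>R \<nu> \<notin> T)" for c
    proof -
      have "filterlim (\<lambda>t. z + (c * t) *\<^sub>R \<nu>) (nhds z) (at_right 0)" using lim[of c] by simp
      then show ?thesis by (rule eventually_compose_filterlim[OF half[OF z]])
    qed
    show "\<forall>\<^sub>F t in at_right 0. z - t *\<^sub>R \<nu> \<in> interior T \<and> z + t *\<^sub>R \<nu> \<notin> T"
      using near[of 1] near[of "-1"] eventually_at_right_less[of "0::real"]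
      by eventually_elim (auto simp: \<nu>1)
  next
    fix \<mu> assume \<mu>: "unit_normal e \<mu> \<and> (\<exists>x\<in>rel_interior e. \<forall>\<^sub>F t in at_right 0.
        x - t *\<^sub>R \<mu> \<in> interior T \<and> x + t *\<^sub>R \<mu> \<notin> T)"
    then obtain x where x: "x \<in> rel_interior e"
      "\<forall>\<^sub>F t in at_right 0. x - t *\<^sub>R \<mu> \<in> interior T \<and> x + t *\<^sub>R \<mu> \<notin> T" by blast
    have xe: "x \<in> e" using x rel_interior_subset by blast
    show "\<mu> = \<nu>"
    proof (rule ccontr)
      assume "\<mu> \<noteq> \<nu>"
      then have "\<mu> = - \<nu>"
        using unit_normal_unique[OF aff_dim_face[OF eE] face_nonempty[OF eE] unit] \<mu> by blast
      then have "\<forall>\<^sub>F t in at_right 0. x - t *\<^sub>R \<nu> \<notin> T" using x(2) by (auto elim: eventually_mono)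
      moreover have "\<forall>\<^sub>F t in at_right 0. x - t *\<^sub>R \<nu> \<in> T"
        by (rule inward_in_elem[OF T e x(1) _ \<nu> \<nu>A[OF xe]]) (rule A(1))
      ultimately have "\<forall>\<^sub>F t in at_right (0::real). False"
        by eventually_elim simp
      then show False by simp
    qed
  qed
  then show "outer_normal T e = \<n> e \<or> outer_normal T e = - \<n> e"
    and "\<And>z. z \<in> e \<Longrightarrow> z \<notin> crossings \<Longrightarrow>
      half_space_at T (outer_normal T e) z"
    using \<nu> half by simp_all
qed

definition orientation :: "(real^'n) set \<Rightarrow> (real^'n) set \<Rightarrow> real" where
  "orientation T e = \<n> e \<bullet> outer_normal T e"

lemma orientation:
  assumes "T \<in> \<T>" "e \<in> faces_on \<E> T"
  shows "outer_normal T e = orientation T e *\<^sub>R \<n> e" "orientation T e = 1 \<or> orientation T e = -1"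
  using outer_normal_char(1)[OF assms] normal_self[OF faces_onD[OF assms(2)]]
  by (auto simp: orientation_def)

text \<open>An inner face separates exactly two elements, whose outward normals are opposite: around a generic
  point of the face each side is covered by an element, which has the face on its boundary, and two
  elements on the same side would overlap.\<close>

lemma sum_orientation:
  assumes e: "e \<in> \<E>" and inner: "e \<notin> faces_on \<E> \<Omega>"
  shows "(\<Sum>T | T \<in> \<T> \<and> e \<in> faces_on \<E> T. orientation T e) = 0"
proof -
  obtain T0 where T0: "T0 \<in> \<T>" "e \<in> faces_on \<E> T0" using face_on_elem[OF e] by blast
  have "e \<subseteq> closure \<Omega>" using face_subset_elem[OF T0] cover T0(1) by blast
  then have "interior \<Omega> \<inter> e \<noteq> {}"
    using e inner unfolding faces_on_def frontier_def by blast
  then obtain z where z: "z \<in> interior \<Omega>" "z \<in> e" "z \<notin> crossings"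
    using generic_points_dense[OF e open_interior] by blast
  \<comment> \<open>near \<open>z\<close> and off the face there are only elements that have \<open>e\<close> as a face, on their inner side\<close>
  have local: "\<forall>\<^sub>F y in nhds z. y \<in> T \<longrightarrow> \<n> e \<bullet> (y - z) \<noteq> 0 \<longrightarrow>
      e \<in> faces_on \<E> T \<and> orientation T e * (\<n> e \<bullet> (y - z)) < 0" if T: "T \<in> \<T>" for T
  proof (cases "e \<in> faces_on \<E> T")
    case True
    show ?thesis
      using outer_normal_char(2)[OF T True z(2,3)] orientation(2)[OF T True]
      by (auto simp: orientation(1)[OF T True] True elim!: eventually_mono)
  next
    case False
    have "z \<notin> T"
    proof
      assume "z \<in> T"
      have "z \<notin> frontier T"
      proof
        assume "z \<in> frontier T"
        then obtain e' where "e' \<in> faces_on \<E> T" "z \<in> e'" using frontier_elem[OF T] by blast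
        then show False using generic_unique_face[OF z(3) e z(2)] False faces_onD by blast
      qed
      then have "z \<in> interior T" using \<open>z \<in> T\<close> closed_elem[OF T] by (auto simp: frontier_def)
      moreover have "z \<in> closure (interior T0)"
        using polyhedral_cell_closure_rel_interior[OF elem_cell[OF T0(1)]] face_subset_elem[OF T0] z(2)
          elem_cell[OF T0(1)] by (auto simp: interior_rel_interior_gen polyhedral_cell_def)
      ultimately have "interior T \<inter> interior T0 \<noteq> {}"
        using open_interior by (auto simp: closure_iff_nhds_not_empty)
      then have "T = T0" using elems_disjoint[OF T T0(1)] by blast
      then show False using False T0(2) by simp
    qed
    then have "\<forall>\<^sub>F y in nhds z. y \<notin> T"
      using closed_elem[OF T] by (intro eventually_nhds[THEN iffD2] exI[of _ "- T"]) (auto simp: open_Compl)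
    then show ?thesis by (auto elim: eventually_mono)
  qed
  have all: "\<forall>\<^sub>F y in nhds z. y \<in> interior \<Omega> \<and> (\<forall>T\<in>\<T>. y \<in> T \<longrightarrow> \<n> e \<bullet> (y - z) \<noteq> 0 \<longrightarrow>
      e \<in> faces_on \<E> T \<and> orientation T e * (\<n> e \<bullet> (y - z)) < 0)"
    using z(1) local finite_mesh(1)
    by (intro eventually_conj eventually_ball_finite) (auto intro: eventually_nhds_in_open)
  have exist: "\<exists>T\<in>\<T>. e \<in> faces_on \<E> T \<and> orientation T e = \<epsilon>" if \<epsilon>: "\<epsilon> = 1 \<or> \<epsilon> = -1" for \<epsilon>
  proof -
    have "((\<lambda>t. z + (- \<epsilon> * t) *\<^sub>R \<n> e) \<longlongrightarrow> z + (- \<epsilon> * 0) *\<^sub>R \<n> e) (at_right 0)" by (intro tendsto_intros)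
    then have lim: "filterlim (\<lambda>t. z + (- \<epsilon> * t) *\<^sub>R \<n> e) (nhds z) (at_right 0)" by simp
    have "\<forall>\<^sub>F t in at_right 0. z + (- \<epsilon> * t) *\<^sub>R \<n> e \<in> interior \<Omega> \<and>
        (\<forall>T\<in>\<T>. z + (- \<epsilon> * t) *\<^sub>R \<n> e \<in> T \<longrightarrow> \<n> e \<bullet> (z + (- \<epsilon> * t) *\<^sub>R \<n> e - z) \<noteq> 0 \<longrightarrow>
        e \<in> faces_on \<E> T \<and> orientation T e * (\<n> e \<bullet> (z + (- \<epsilon> * t) *\<^sub>R \<n> e - z)) < 0) \<and> 0 < t"
      using eventually_compose_filterlim[OF all lim] eventually_at_right_less[of "0::real"]
      by eventually_elim auto
    then have "\<exists>t. z + (- \<epsilon> * t) *\<^sub>R \<n> e \<in> interior \<Omega> \<and>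
        (\<forall>T\<in>\<T>. z + (- \<epsilon> * t) *\<^sub>R \<n> e \<in> T \<longrightarrow> \<n> e \<bullet> (z + (- \<epsilon> * t) *\<^sub>R \<n> e - z) \<noteq> 0 \<longrightarrow>
        e \<in> faces_on \<E> T \<and> orientation T e * (\<n> e \<bullet> (z + (- \<epsilon> * t) *\<^sub>R \<n> e - z)) < 0) \<and> 0 < t"
      by (intro eventually_happens') simp_all
    then obtain t where t: "0 < t" "z + (- \<epsilon> * t) *\<^sub>R \<n> e \<in> interior \<Omega>"
      and el: "\<And>T. T \<in> \<T> \<Longrightarrow> z + (- \<epsilon> * t) *\<^sub>R \<n> e \<in> T \<Longrightarrow> e \<in> faces_on \<E> T \<and> orientation T e * (- \<epsilon> * t) < 0"
      using \<epsilon> by (auto simp: normal_self[OF e])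
    have "z + (- \<epsilon> * t) *\<^sub>R \<n> e \<in> \<Union>\<T>"
      using t(2) cover interior_subset closure_subset by blast
    then obtain T where T: "T \<in> \<T>" "e \<in> faces_on \<E> T" "orientation T e * (- \<epsilon> * t) < 0"
      using el by blast
    then have "orientation T e = \<epsilon>"
      using orientation(2)[OF T(1,2)] t(1) \<epsilon> by (auto simp: mult_less_0_iff)
    then show ?thesis using T by blast
  qed
  have unique: "T = T'"
    if T: "T \<in> \<T>" "e \<in> faces_on \<E> T" and T': "T' \<in> \<T>" "e \<in> faces_on \<E> T'"
      and eq: "orientation T e = orientation T' e" for T T'
  proof -
    have nn: "outer_normal T' e = outer_normal T e" using orientation T T' eq by metis
    have unit: "outer_normal T e \<bullet> outer_normal T e = 1"
      using outer_normal_char(1)[OF T] normal_self[OF e] by auto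
    have "((\<lambda>t. z - t *\<^sub>R outer_normal T e) \<longlongrightarrow> z - 0 *\<^sub>R outer_normal T e) (at_right 0)"
      by (intro tendsto_intros)
    then have lim: "filterlim (\<lambda>t. z - t *\<^sub>R outer_normal T e) (nhds z) (at_right 0)" by simp
    have "\<forall>\<^sub>F t in at_right 0. z - t *\<^sub>R outer_normal T e \<in> interior T \<inter> interior T'"
      using eventually_compose_filterlim[OF outer_normal_char(2)[OF T z(2,3)] lim]
        eventually_compose_filterlim[OF outer_normal_char(2)[OF T' z(2,3)] lim]
        eventually_at_right_less[of "0::real"]
      by eventually_elim (auto simp: nn unit)
    then have "\<exists>t. z - t *\<^sub>R outer_normal T e \<in> interior T \<inter> interior T'"
      by (intro eventually_happens') simp_all
    then show ?thesis using elems_disjoint[OF T(1) T'(1)] by blast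
  qed
  obtain T1 T2 where T1: "T1 \<in> \<T>" "e \<in> faces_on \<E> T1" "orientation T1 e = 1"
    and T2: "T2 \<in> \<T>" "e \<in> faces_on \<E> T2" "orientation T2 e = -1"
    using exist[of 1] exist[of "-1"] by auto
  have "{T. T \<in> \<T> \<and> e \<in> faces_on \<E> T} = {T1, T2}"
  proof (intro equalityI subsetI)
    fix T assume "T \<in> {T. T \<in> \<T> \<and> e \<in> faces_on \<E> T}"
    then have T: "T \<in> \<T>" "e \<in> faces_on \<E> T" by simp_all
    then show "T \<in> {T1, T2}"
      using orientation(2)[OF T] unique[OF T T1(1,2)] unique[OF T T2(1,2)] T1(3) T2(3) by fastforce
  qed (use T1 T2 in auto)
  moreover have "T1 \<noteq> T2" using T1(3) T2(3) by auto
  ultimately show ?thesis using T1(3) T2(3) by simp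
qed

end

section \<open>The divergence theorem on an element\<close>

text \<open>Around each point the values on both sides agree, and these common values form a locally constant
  function on a connected interval. The value at the point itself may differ, as it does where a line
  crosses a face.\<close>

lemma punctured_local_const:
  fixes f :: "real \<Rightarrow> 'b"
  assumes s: "s > 0"
    and loc: "\<And>\<tau>. \<tau> \<in> {0..s} \<Longrightarrow> \<exists>c. \<forall>\<^sub>F \<sigma> in at \<tau> within {0..s}. f \<sigma> = c"
    and zero: "\<forall>\<^sub>F \<sigma> in at 0 within {0..s}. f \<sigma> = f 0"
    and one: "\<forall>\<^sub>F \<sigma> in at s within {0..s}. f \<sigma> = f s"
  shows "f 0 = f s"
proof -
  have nt: "at \<tau> within {0..s} \<noteq> bot" if "\<tau> \<in> {0..s}" for \<tau>
    using that s by (simp add: at_within_Icc_at trivial_limit_within islimpt_Icc)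
  obtain c where c: "\<And>\<tau>. \<tau> \<in> {0..s} \<Longrightarrow> \<forall>\<^sub>F \<sigma> in at \<tau> within {0..s}. f \<sigma> = c \<tau>"
    using bchoice[of "{0..s}" "\<lambda>\<tau> c. \<forall>\<^sub>F \<sigma> in at \<tau> within {0..s}. f \<sigma> = c"] loc by blast
  have c_unique: "c \<tau> = d" if \<tau>: "\<tau> \<in> {0..s}" and d: "\<forall>\<^sub>F \<sigma> in at \<tau> within {0..s}. f \<sigma> = d" for \<tau> d
  proof -
    have "\<forall>\<^sub>F \<sigma> in at \<tau> within {0..s}. c \<tau> = d"
      using c[OF \<tau>] d by eventually_elim simp
    then show ?thesis using nt[OF \<tau>] by simp
  qed
  have "c 0 = c s"
  proof (rule connected_local_const[of "{0..s}"])
    show "\<forall>\<tau>\<in>{0..s}. \<forall>\<^sub>F \<sigma> in at \<tau> within {0..s}. c \<tau> = c \<sigma>"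
    proof
      fix \<tau> assume \<tau>: "\<tau> \<in> {0..s}"
      obtain U where U: "open U" "\<tau> \<in> U" "\<And>\<sigma>. \<sigma> \<in> U \<Longrightarrow> \<sigma> \<noteq> \<tau> \<Longrightarrow> \<sigma> \<in> {0..s} \<Longrightarrow> f \<sigma> = c \<tau>"
        using c[OF \<tau>] unfolding eventually_at_topological by blast
      have "c \<tau> = c \<sigma>" if \<sigma>: "\<sigma> \<in> U" "\<sigma> \<noteq> \<tau>" "\<sigma> \<in> {0..s}" for \<sigma>
      proof -
        have "\<forall>\<^sub>F \<rho> in at \<sigma> within {0..s}. f \<rho> = c \<tau>"
          unfolding eventually_at_topological
          using U \<sigma> by (intro exI[of _ "U - {\<tau>}"]) (auto simp: open_delete)
        then show ?thesis using c_unique[OF \<sigma>(3)] by simp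
      qed
      then show "\<forall>\<^sub>F \<sigma> in at \<tau> within {0..s}. c \<tau> = c \<sigma>"
        unfolding eventually_at_topological using U by blast
    qed
  qed (use s in auto)
  then show ?thesis using c_unique[of 0, OF _ zero] c_unique[of s, OF _ one] s by simp
qed

lemma filterlim_line:
  fixes a y :: "'a::real_normed_vector"
  shows "filterlim (\<lambda>\<sigma>. y - \<sigma> *\<^sub>R a) (nhds (y - \<tau> *\<^sub>R a)) (nhds \<tau>)"
proof -
  have "isCont (\<lambda>\<sigma>. y - \<sigma> *\<^sub>R a) \<tau>" by (intro continuous_intros)
  then show ?thesis
    using tendsto_at_iff_tendsto_nhds[of "\<lambda>\<sigma>. y - \<sigma> *\<^sub>R a" \<tau>] by (simp add: isCont_def)
qed

lemma eventually_indicator_prism: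
  assumes "closed e" and out: "y - \<tau> *\<^sub>R a \<notin> e"
  shows "\<forall>\<^sub>F \<sigma> in nhds \<tau>. indicator (prism e a \<sigma>) y = (indicator (prism e a \<tau>) y :: real)"
proof -
  have "\<forall>\<^sub>F \<sigma> in nhds \<tau>. y - \<sigma> *\<^sub>R a \<in> - e"
    by (rule topological_tendstoD[OF filterlim_line]) (use assms in \<open>simp_all add: open_Compl\<close>)
  then obtain d where d0: "d > 0" "\<forall>\<sigma>. dist \<sigma> \<tau> < d \<longrightarrow> y - \<sigma> *\<^sub>R a \<in> - e"
    unfolding eventually_nhds_metric by blast
  have d: "y - \<sigma> *\<^sub>R a \<notin> e" if "dist \<sigma> \<tau> < d" for \<sigma>
    using d0(2) that by simp
  have "indicator (prism e a \<sigma>) y = (indicator (prism e a \<tau>) y :: real)" if \<sigma>: "dist \<sigma> \<tau> < d" for \<sigma>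
  proof -
    have "\<rho> \<in> {0..\<sigma>} \<longleftrightarrow> \<rho> \<in> {0..\<tau>}" if "y - \<rho> *\<^sub>R a \<in> e" for \<rho>
    proof -
      have "\<not> \<bar>\<rho> - \<tau>\<bar> < d" using d[of \<rho>] that by (auto simp only: dist_real_def)
      then show ?thesis using \<sigma> unfolding dist_real_def atLeastAtMost_iff by linarith
    qed
    then have "y \<in> prism e a \<sigma> \<longleftrightarrow> y \<in> prism e a \<tau>"
      unfolding prism_def mem_Collect_eq Bex_def by (intro ex_cong1) metis
    then show ?thesis by (simp only: indicator_def)
  qed
  then show ?thesis
    unfolding eventually_nhds_metric using d0(1) by blast
qed

context wg_mesh
begin

text \<open>The line through such a point misses the faces parallel to \<open>a\<close> and crosses the others one at a time,
  at points of their relative interior; neither end of its segment from \<open>y\<close> to \<open>y - s a\<close> is on a face.\<close>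

definition generic :: "real^'n \<Rightarrow> real \<Rightarrow> real^'n \<Rightarrow> bool" where
  "generic a s y \<longleftrightarrow> (\<forall>\<tau>. y - \<tau> *\<^sub>R a \<notin> crossings) \<and>
     (\<forall>e\<in>\<E>. y \<notin> affine hull e \<and> y - s *\<^sub>R a \<notin> affine hull e)"

lemma AE_generic: "AE y in lborel. generic a s y"
proof -
  have "negligible {y. \<not> generic a s y}"
  proof (rule negligible_subset)
    show "{y. \<not> generic a s y} \<subseteq> {y. \<exists>\<tau>. y - \<tau> *\<^sub>R a \<in> crossings} \<union>
        (\<Union>e\<in>\<E>. {y. \<n> e \<bullet> y = level e} \<union> {y. \<n> e \<bullet> y = level e + s * (\<n> e \<bullet> a)})"
      by (auto simp: generic_def hull_face inner_diff_right)
    show "negligible \<dots>"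
      using finite_mesh(2)
      by (intro negligible_Un negligible_lines_through_thin thin_crossings negligible_Union)
         (auto intro!: negligible_Un negligible_hyperplane simp: normal_nonzero)
  qed
  then have "AE y in lebesgue. generic a s y"
    unfolding negligible_iff_null_sets by (auto dest: AE_not_in)
  then show ?thesis by (simp add: AE_completion_iff)
qed

lemma generic_not_frontier:
  assumes "generic a s y" "T \<in> \<T>"
  shows "y \<notin> frontier T" "y - s *\<^sub>R a \<notin> frontier T"
  using assms frontier_elem faces_onD hull_inc unfolding generic_def by fastforce+

lemma eventually_indicator_elem:
  assumes "z \<notin> frontier T" "closed T"
  shows "\<forall>\<^sub>F y in nhds z. indicator T y = (indicator T z :: real)"
proof (cases "z \<in> T")
  case True
  then have "z \<in> interior T" using assms by (simp add: frontier_def)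
  then have "\<forall>\<^sub>F y in nhds z. y \<in> interior T" by (intro eventually_nhds_in_open) auto
  then have "\<forall>\<^sub>F y in nhds z. y \<in> T" by (rule eventually_mono) (use interior_subset in blast)
  then show ?thesis using True by (auto elim!: eventually_mono)
next
  case False
  then have "\<forall>\<^sub>F y in nhds z. y \<in> - T" using assms by (intro eventually_nhds_in_open) auto
  then show ?thesis using False by (auto elim!: eventually_mono)
qed

text \<open>Away from the faces both sides are locally constant in \<open>s\<close>. When the line crosses a face, the
  element is half a ball around the crossing point, and both sides change by the sign of \<open>\<nu> \<bullet> a\<close>.\<close>

lemma indicator_jump:
  assumes T: "T \<in> \<T>" and s: "s > 0" and y: "generic a s y"
  shows "indicator T (y - s *\<^sub>R a) - indicator T y
    = (\<Sum>e\<in>faces_on \<E> T. sgn (outer_normal T e \<bullet> a) * indicator (prism e a s) y)"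
proof -
  let ?I = "\<lambda>\<tau>. indicator T (y - \<tau> *\<^sub>R a) :: real"
  let ?S = "\<lambda>F \<tau>. \<Sum>e\<in>F. sgn (outer_normal T e \<bullet> a) * indicator (prism e a \<tau>) y"
  define J where "J \<tau> = ?I \<tau> - ?S (faces_on \<E> T) \<tau>" for \<tau>
  note line = filterlim_line[of y a]
  have miss_I: "\<forall>\<^sub>F \<sigma> in nhds \<tau>. ?I \<sigma> = ?I \<tau>" if "y - \<tau> *\<^sub>R a \<notin> frontier T" for \<tau>
    using eventually_compose_filterlim[OF eventually_indicator_elem[OF that closed_elem[OF T]] line] .
  have miss_S: "\<forall>\<^sub>F \<sigma> in nhds \<tau>. ?S F \<sigma> = ?S F \<tau>"
    if "F \<subseteq> faces_on \<E> T" "\<And>e. e \<in> F \<Longrightarrow> y - \<tau> *\<^sub>R a \<notin> e" for F \<tau>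
  proof -
    have "\<forall>\<^sub>F \<sigma> in nhds \<tau>. \<forall>e\<in>F. indicator (prism e a \<sigma>) y = (indicator (prism e a \<tau>) y :: real)"
    proof (rule eventually_ball_finite)
      show "finite F" using that(1) finite_faces_on finite_subset by blast
      show "\<forall>e\<in>F. \<forall>\<^sub>F \<sigma> in nhds \<tau>. indicator (prism e a \<sigma>) y = (indicator (prism e a \<tau>) y :: real)"
      proof
        fix e assume "e \<in> F"
        then show "\<forall>\<^sub>F \<sigma> in nhds \<tau>. indicator (prism e a \<sigma>) y = (indicator (prism e a \<tau>) y :: real)"
          using that faces_onD compact_face compact_imp_closed
          by (intro eventually_indicator_prism) blast+
      qed
    qed
    then show ?thesis by eventually_elim simp
  qed
  have miss: "\<forall>\<^sub>F \<sigma> in at \<tau> within {0..s}. J \<sigma> = J \<tau>" if "y - \<tau> *\<^sub>R a \<notin> frontier T" for \<tau>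
  proof -
    have "\<forall>\<^sub>F \<sigma> in nhds \<tau>. ?S (faces_on \<E> T) \<sigma> = ?S (faces_on \<E> T) \<tau>"
      using that by (intro miss_S) (auto simp: faces_on_def)
    with miss_I[OF that] have "\<forall>\<^sub>F \<sigma> in nhds \<tau>. J \<sigma> = J \<tau>"
      by eventually_elim (simp only: J_def)
    then show ?thesis unfolding eventually_at_filter by (rule eventually_mono) simp
  qed
  have "J 0 = J s"
  proof (rule punctured_local_const[OF s])
    show "\<forall>\<^sub>F \<sigma> in at 0 within {0..s}. J \<sigma> = J 0" "\<forall>\<^sub>F \<sigma> in at s within {0..s}. J \<sigma> = J s"
      using generic_not_frontier[OF y T] by (auto intro!: miss)
    fix \<tau> assume \<tau>: "\<tau> \<in> {0..s}"
    show "\<exists>c. \<forall>\<^sub>F \<sigma> in at \<tau> within {0..s}. J \<sigma> = c"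
    proof (cases "y - \<tau> *\<^sub>R a \<in> frontier T")
      case False
      then show ?thesis using miss by blast
    next
      case True
      let ?z = "y - \<tau> *\<^sub>R a"
      have z: "?z \<notin> crossings" using y by (simp add: generic_def)
      obtain e where e: "e \<in> faces_on \<E> T" "?z \<in> e" using True frontier_elem[OF T] by blast
      have eE: "e \<in> \<E>" using e faces_onD by blast
      let ?F = "faces_on \<E> T - {e}"
      define \<nu> where "\<nu> = outer_normal T e"
      have na: "\<n> e \<bullet> a \<noteq> 0"
      proof
        assume "\<n> e \<bullet> a = 0"
        then have "\<n> e \<bullet> y = level e" using face_level[OF eE e(2)] by (simp add: inner_diff_right)
        then have "y \<in> affine hull e" using hull_face[OF eE] by simp
        then show False using y eE unfolding generic_def by blast
      qed
      then have \<nu>a: "\<nu> \<bullet> a \<noteq> 0" using outer_normal_char(1)[OF T e(1)] by (auto simp: \<nu>_def)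
      have hit: "y - \<rho> *\<^sub>R a \<in> e \<longleftrightarrow> \<rho> = \<tau>" for \<rho>
      proof
        assume "y - \<rho> *\<^sub>R a \<in> e"
        then have "\<n> e \<bullet> (y - \<rho> *\<^sub>R a) = \<n> e \<bullet> ?z" using face_level[OF eE] e(2) by simp
        then show "\<rho> = \<tau>" using na by (simp add: inner_diff_right)
      qed (use e in simp)
      have ind: "indicator (prism e a \<sigma>) y = (if \<tau> \<le> \<sigma> then 1 else 0 :: real)" for \<sigma>
        using \<tau> by (auto simp: prism_def hit indicator_def)
      have "?S (faces_on \<E> T) \<sigma> = sgn (\<nu> \<bullet> a) * (if \<tau> \<le> \<sigma> then 1 else 0) + ?S ?F \<sigma>" for \<sigma>
        unfolding sum.remove[OF finite_faces_on e(1)] by (simp only: ind \<nu>_def)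
      then have J: "J \<sigma> = ?I \<sigma> - ?S ?F \<sigma> - sgn (\<nu> \<bullet> a) * (if \<tau> \<le> \<sigma> then 1 else 0)" for \<sigma>
        unfolding J_def by (simp add: algebra_simps)
      have "\<forall>\<^sub>F \<sigma> in nhds \<tau>. ?S ?F \<sigma> = ?S ?F \<tau>"
        using generic_unique_face[OF z eE e(2)] faces_onD by (intro miss_S) blast+
      moreover have "\<forall>\<^sub>F \<sigma> in nhds \<tau>. (\<nu> \<bullet> (y - \<sigma> *\<^sub>R a - ?z) < 0 \<longrightarrow> y - \<sigma> *\<^sub>R a \<in> interior T) \<and>
          (\<nu> \<bullet> (y - \<sigma> *\<^sub>R a - ?z) > 0 \<longrightarrow> y - \<sigma> *\<^sub>R a \<notin> T)"
        using eventually_compose_filterlim[OF outer_normal_char(2)[OF T e(1,2) z] line]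
        unfolding \<nu>_def .
      ultimately have "\<forall>\<^sub>F \<sigma> in nhds \<tau>. \<sigma> \<noteq> \<tau> \<longrightarrow> J \<sigma> = (if \<nu> \<bullet> a > 0 then 0 else 1) - ?S ?F \<tau>"
      proof eventually_elim
        case (elim \<sigma>)
        show ?case
        proof
          assume "\<sigma> \<noteq> \<tau>"
          have "\<nu> \<bullet> (y - \<sigma> *\<^sub>R a - ?z) = (\<tau> - \<sigma>) * (\<nu> \<bullet> a)"
            by (simp add: inner_diff_right algebra_simps)
          then have side: "((\<tau> - \<sigma>) * (\<nu> \<bullet> a) < 0 \<longrightarrow> ?I \<sigma> = 1) \<and> ((\<tau> - \<sigma>) * (\<nu> \<bullet> a) > 0 \<longrightarrow> ?I \<sigma> = 0)"
            using elim(2) interior_subset[of T] by (auto simp: indicator_def)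
          have "?I \<sigma> = sgn (\<nu> \<bullet> a) * (if \<tau> \<le> \<sigma> then 1 else 0) + (if \<nu> \<bullet> a > 0 then 0 else 1)"
            using side \<open>\<sigma> \<noteq> \<tau>\<close> \<nu>a
            by (cases "\<nu> \<bullet> a > 0"; cases "\<tau> < \<sigma>") (auto simp: mult_less_0_iff zero_less_mult_iff)
          then show "J \<sigma> = (if \<nu> \<bullet> a > 0 then 0 else 1) - ?S ?F \<tau>"
            unfolding J elim(1) by simp
        qed
      qed
      then have "\<forall>\<^sub>F \<sigma> in at \<tau> within {0..s}. J \<sigma> = (if \<nu> \<bullet> a > 0 then 0 else 1) - ?S ?F \<tau>"
        unfolding eventually_at_filter by (rule eventually_mono) simp
      then show ?thesis by blast
    qed
  qed
  moreover have "?S (faces_on \<E> T) 0 = 0"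
  proof (rule sum.neutral, rule ballI)
    fix e assume "e \<in> faces_on \<E> T"
    then have "y \<notin> e" using generic_not_frontier(1)[OF y T] by (auto simp: faces_on_def)
    then have "y \<notin> prism e a 0" by (auto simp: prism_def)
    then show "sgn (outer_normal T e \<bullet> a) * indicator (prism e a 0) y = 0" by simp
  qed
  ultimately show ?thesis by (simp add: J_def)
qed

lemma integrable_compact_continuous:
  fixes F :: "real^'n \<Rightarrow> real"
  assumes "continuous_on UNIV F" "compact S"
  shows "integrable lborel (\<lambda>x. indicator S x * F x)"
  using borel_integrable_compact[OF assms(2) continuous_on_subset[OF assms(1)]] by simp

text \<open>Translating the element by \<open>s a\<close> adds or removes the prisms over its faces. Dividing by \<open>s\<close> and
  letting \<open>s \<rightarrow> 0\<close>, the difference quotient of \<open>F\<close> tends to the directional derivative, and the integral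
  over a prism to the surface integral times \<open>\<bar>\<nu> \<bullet> a\<bar>\<close>.\<close>

theorem divergence_theorem_elem:
  fixes F :: "real^'n \<Rightarrow> real"
  assumes T: "T \<in> \<T>"
    and deriv: "\<And>x. (F has_derivative (\<lambda>h. G x \<bullet> h)) (at x)" and G: "continuous_on UNIV G"
  shows "integral\<^sup>L (lebesgue_on T) (\<lambda>x. G x \<bullet> a)
    = (\<Sum>e\<in>faces_on \<E> T. (outer_normal T e \<bullet> a) * integral\<^sup>L (surface_measure e) F)"
proof -
  have F: "continuous_on UNIV F"
    using deriv by (meson continuous_at_imp_continuous_on has_derivative_continuous)
  have [measurable]: "F \<in> borel_measurable borel" "(\<lambda>x. G x \<bullet> a) \<in> borel_measurable borel"
    using F G by (auto intro!: borel_measurable_continuous_onI continuous_intros)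
  have [measurable]: "T \<in> sets borel" using closed_elem[OF T] by simp
  define h where "h m = 1 / real (Suc m)" for m
  have h: "h m > 0" "h m \<le> 1" "real (Suc m) = 1 / h m" for m by (simp_all add: h_def)
  let ?P = "\<lambda>e m. \<integral>y. indicator (prism e a (h m)) y * F y \<partial>lborel"
  let ?D = "\<lambda>m. \<integral>x. indicator T x * (real (Suc m) * (F (x + h m *\<^sub>R a) - F x)) \<partial>lborel"
  have path: "((\<lambda>t. F (x + t *\<^sub>R a)) has_real_derivative G (x + t *\<^sub>R a) \<bullet> a) (at t)" for x t
  proof -
    have "((\<lambda>t. F (x + t *\<^sub>R a)) has_derivative (\<lambda>t'. G (x + t *\<^sub>R a) \<bullet> (t' *\<^sub>R a))) (at t)"
    proof (rule has_derivative_compose[where g = F])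
      show "((\<lambda>t. x + t *\<^sub>R a) has_derivative (\<lambda>t'. t' *\<^sub>R a)) (at t)"
        by (auto intro!: derivative_eq_intros)
    qed (rule deriv)
    moreover have "(\<lambda>t'. G (x + t *\<^sub>R a) \<bullet> (t' *\<^sub>R a)) = (*) (G (x + t *\<^sub>R a) \<bullet> a)"
      by (simp add: fun_eq_iff)
    ultimately show ?thesis by (simp only: has_field_derivative_def)
  qed
  have lim1: "?D \<longlonglongrightarrow> (\<integral>x. indicator T x * (G x \<bullet> a) \<partial>lborel)"
  proof -
    have "continuous_on (T \<times> {0..1::real}) (\<lambda>(x, t). G (x + t *\<^sub>R a) \<bullet> a)"
      by (auto simp: case_prod_unfold intro!: continuous_intros continuous_on_compose2[OF G])
    then have "bounded ((\<lambda>(x, t). G (x + t *\<^sub>R a) \<bullet> a) ` (T \<times> {0..1}))"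
      by (intro compact_imp_bounded compact_continuous_image compact_Times compact_elem[OF T]) auto
    then obtain C where "\<forall>x\<in>T. \<forall>t\<in>{0..1}. \<bar>G (x + t *\<^sub>R a) \<bullet> a\<bar> \<le> C"
      by (auto simp: bounded_iff)
    then have C: "\<bar>G (x + t *\<^sub>R a) \<bullet> a\<bar> \<le> C" if "x \<in> T" "0 \<le> t" "t \<le> 1" for x t using that by auto
    show ?thesis
    proof (rule integral_dominated_convergence[where w = "\<lambda>x. indicator T x * C"])
      show "integrable lborel (\<lambda>x. indicator T x * C)"
        by (rule integrable_compact_continuous) (use compact_elem[OF T] in auto)
      show "AE x in lborel. (\<lambda>m. indicator T x * (real (Suc m) * (F (x + h m *\<^sub>R a) - F x)))
          \<longlonglongrightarrow> indicator T x * (G x \<bullet> a)"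
      proof (rule AE_I2)
        fix x
        have "((\<lambda>t. (F (x + t *\<^sub>R a) - F x) / t) \<longlongrightarrow> G x \<bullet> a) (at 0)"
          using path[of x 0] by (simp add: has_field_derivative_iff)
        moreover have "filterlim h (at 0) sequentially"
        proof (rule filterlim_atI)
          show "h \<longlonglongrightarrow> 0"
            using LIMSEQ_inverse_real_of_nat unfolding h_def by (simp add: inverse_eq_divide)
          show "\<forall>\<^sub>F m in sequentially. h m \<noteq> 0" by (simp add: h_def)
        qed
        ultimately have "(\<lambda>m. (F (x + h m *\<^sub>R a) - F x) / h m) \<longlonglongrightarrow> G x \<bullet> a"
          by (rule filterlim_compose)
        then have "(\<lambda>m. real (Suc m) * (F (x + h m *\<^sub>R a) - F x)) \<longlonglongrightarrow> G x \<bullet> a"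
          unfolding h(3) by simp
        then show "(\<lambda>m. indicator T x * (real (Suc m) * (F (x + h m *\<^sub>R a) - F x)))
          \<longlonglongrightarrow> indicator T x * (G x \<bullet> a)" by (intro tendsto_intros)
      qed
      show "AE x in lborel. norm (indicator T x * (real (Suc m) * (F (x + h m *\<^sub>R a) - F x)))
          \<le> indicator T x * C" for m
      proof (rule AE_I2)
        fix x
        show "norm (indicator T x * (real (Suc m) * (F (x + h m *\<^sub>R a) - F x))) \<le> indicator T x * C"
        proof (cases "x \<in> T")
          case True
          obtain t where t: "0 < t" "t < h m"
            "F (x + h m *\<^sub>R a) - F (x + 0 *\<^sub>R a) = (h m - 0) * (G (x + t *\<^sub>R a) \<bullet> a)"
            using MVT2[OF h(1)[of m], of "\<lambda>t. F (x + t *\<^sub>R a)" "\<lambda>t. G (x + t *\<^sub>R a) \<bullet> a"] path by blast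
          then have "real (Suc m) * (F (x + h m *\<^sub>R a) - F x) = G (x + t *\<^sub>R a) \<bullet> a"
            unfolding h(3) using h(1)[of m] by simp
          then have "norm (indicator T x * (real (Suc m) * (F (x + h m *\<^sub>R a) - F x)))
              = \<bar>G (x + t *\<^sub>R a) \<bullet> a\<bar>"
            using True by (simp only: indicator_simps mult_1 real_norm_def)
          then show ?thesis using C[OF True, of t] t(1,2) h(2)[of m] True by simp
        qed simp
      qed
    qed measurable
  qed
  have eq: "?D = (\<lambda>m. \<Sum>e\<in>faces_on \<E> T. sgn (outer_normal T e \<bullet> a) *
      (real (Suc m) * ?P e m))"
  proof
    fix m
    have int: "integrable lborel (\<lambda>y. indicator T y * F y)"
      by (rule integrable_compact_continuous[OF F compact_elem[OF T]])
    have FA: "continuous_on UNIV (\<lambda>x. F (x + h m *\<^sub>R a))"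
      by (intro continuous_on_compose2[OF F] continuous_intros) auto
    have int': "integrable lborel (\<lambda>x. indicator T x * F (x + h m *\<^sub>R a))"
      by (rule integrable_compact_continuous[OF FA compact_elem[OF T]])
    have shift: "(\<integral>x. f (x - h m *\<^sub>R a) \<partial>lborel) = (\<integral>x. f x \<partial>lborel)"
        "integrable lborel f \<Longrightarrow> integrable lborel (\<lambda>x. f (x - h m *\<^sub>R a))"
      if [measurable]: "f \<in> borel_measurable borel" for f :: "real^'n \<Rightarrow> real"
    proof -
      have "(\<lambda>x. x - h m *\<^sub>R a) = (+) (- (h m *\<^sub>R a))" by (simp add: fun_eq_iff)
      then have "distr lborel borel (\<lambda>x. x - h m *\<^sub>R a) = lborel"
        by (simp only: lborel_distr_plus)
      then show "(\<integral>x. f (x - h m *\<^sub>R a) \<partial>lborel) = (\<integral>x. f x \<partial>lborel)"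
        "integrable lborel f \<Longrightarrow> integrable lborel (\<lambda>x. f (x - h m *\<^sub>R a))"
        using integral_distr[of "\<lambda>x. x - h m *\<^sub>R a" lborel borel f]
          integrable_distr_eq[of "\<lambda>x. x - h m *\<^sub>R a" lborel borel f] by simp_all
    qed
    have intp: "integrable lborel (\<lambda>y. indicator (prism e a (h m)) y * F y)" if "e \<in> faces_on \<E> T" for e
    proof (rule integrable_compact_continuous[OF F])
      interpret flat_face e "\<n> e" "level e" by (rule flat_face[OF faces_onD[OF that]])
      show "compact (prism e a (h m))" by (rule compact_prism)
    qed
    have "?D m = real (Suc m) * (\<integral>x. indicator T x * F (x + h m *\<^sub>R a) - indicator T x * F x \<partial>lborel)"
      unfolding integral_mult_right_zero[symmetric]
      by (intro Bochner_Integration.integral_cong refl) (simp add: right_diff_distrib mult.left_commute)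
    also have "(\<integral>x. indicator T x * F (x + h m *\<^sub>R a) - indicator T x * F x \<partial>lborel)
        = (\<integral>x. indicator T x * F (x + h m *\<^sub>R a) \<partial>lborel) - (\<integral>x. indicator T x * F x \<partial>lborel)"
      by (rule Bochner_Integration.integral_diff[OF int' int])
    also have "(\<integral>x. indicator T x * F (x + h m *\<^sub>R a) \<partial>lborel)
        = (\<integral>y. indicator T (y - h m *\<^sub>R a) * F y \<partial>lborel)"
      using shift(1)[of "\<lambda>x. indicator T x * F (x + h m *\<^sub>R a)"] by simp
    also have "(\<integral>y. indicator T (y - h m *\<^sub>R a) * F y \<partial>lborel) - (\<integral>x. indicator T x * F x \<partial>lborel)
        = (\<integral>y. indicator T (y - h m *\<^sub>R a) * F y - indicator T y * F y \<partial>lborel)"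
      using shift(2)[OF _ int'] int by (intro Bochner_Integration.integral_diff[symmetric]) simp_all
    also have "\<dots> = (\<integral>y. (\<Sum>e\<in>faces_on \<E> T.
        sgn (outer_normal T e \<bullet> a) * (indicator (prism e a (h m)) y * F y)) \<partial>lborel)"
    proof (rule integral_cong_AE)
      show "AE y in lborel. indicator T (y - h m *\<^sub>R a) * F y - indicator T y * F y
          = (\<Sum>e\<in>faces_on \<E> T. sgn (outer_normal T e \<bullet> a) * (indicator (prism e a (h m)) y * F y))"
        using AE_generic[of a "h m"]
      proof eventually_elim
        case (elim y)
        have "indicator T (y - h m *\<^sub>R a) * F y - indicator T y * F y
            = (indicator T (y - h m *\<^sub>R a) - indicator T y) * F y" by (simp add: algebra_simps)
        then show ?case
          unfolding indicator_jump[OF T h(1) elim] by (simp add: sum_distrib_right mult.assoc)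
      qed
      show "(\<lambda>y. indicator T (y - h m *\<^sub>R a) * F y - indicator T y * F y) \<in> borel_measurable lborel"
        by measurable
      show "(\<lambda>y. \<Sum>e\<in>faces_on \<E> T. sgn (outer_normal T e \<bullet> a) * (indicator (prism e a (h m)) y * F y))
          \<in> borel_measurable lborel"
        by (intro borel_measurable_sum borel_measurable_times[OF borel_measurable_const]
            borel_measurable_integrable[OF intp])
    qed
    also have "\<dots> = (\<Sum>e\<in>faces_on \<E> T.
        sgn (outer_normal T e \<bullet> a) * ?P e m)"
      by (subst Bochner_Integration.integral_sum) (simp_all add: intp)
    finally show "?D m = (\<Sum>e\<in>faces_on \<E> T. sgn (outer_normal T e \<bullet> a) *
      (real (Suc m) * ?P e m))"
      by (simp add: sum_distrib_left mult.left_commute)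
  qed
  have lim2: "(\<lambda>m. \<Sum>e\<in>faces_on \<E> T. sgn (outer_normal T e \<bullet> a) *
      (real (Suc m) * ?P e m))
      \<longlonglongrightarrow> (\<Sum>e\<in>faces_on \<E> T. (outer_normal T e \<bullet> a) * integral\<^sup>L (surface_measure e) F)"
  proof (rule tendsto_sum)
    fix e assume e: "e \<in> faces_on \<E> T"
    show "(\<lambda>m. sgn (outer_normal T e \<bullet> a) *
        (real (Suc m) * ?P e m))
        \<longlonglongrightarrow> (outer_normal T e \<bullet> a) * integral\<^sup>L (surface_measure e) F"
    proof (cases "outer_normal T e \<bullet> a = 0")
      case False
      interpret flat_face e "\<n> e" "level e" by (rule flat_face[OF faces_onD[OF e]])
      have "\<n> e \<bullet> a \<noteq> 0" "\<bar>\<n> e \<bullet> a\<bar> = \<bar>outer_normal T e \<bullet> a\<bar>"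
        using outer_normal_char(1)[OF T e] False by auto
      then have "(\<lambda>m. sgn (outer_normal T e \<bullet> a) *
        (real (Suc m) * ?P e m))
        \<longlonglongrightarrow> sgn (outer_normal T e \<bullet> a) * (\<bar>outer_normal T e \<bullet> a\<bar> * integral\<^sup>L (surface_measure e) F)"
        unfolding h_def using tendsto_integral_prism[OF F, of a] by (intro tendsto_mult_left) simp
      then show ?thesis by (simp add: mult.assoc[symmetric] sgn_mult_abs)
    qed simp
  qed
  have "(\<integral>x. indicator T x * (G x \<bullet> a) \<partial>lborel)
      = (\<Sum>e\<in>faces_on \<E> T. (outer_normal T e \<bullet> a) * integral\<^sup>L (surface_measure e) F)"
    by (rule LIMSEQ_unique[OF lim1[unfolded eq] lim2])
  moreover have "integral\<^sup>L (lebesgue_on T) (\<lambda>x. G x \<bullet> a) = (\<integral>x. indicator T x * (G x \<bullet> a) \<partial>lborel)"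
    by (subst integral_restrict_space) (auto simp: integral_completion)
  ultimately show ?thesis by simp
qed

text \<open>The hypothesis says that the piecewise constant function, extended by zero, has no jump across any
  face. A generic line from an interior point of an element leaves the bounded domain, and along it the
  value does not change.\<close>

lemma piecewise_constant_zero:
  assumes c: "\<And>e. e \<in> \<E> \<Longrightarrow> (\<Sum>T | T \<in> \<T> \<and> e \<in> faces_on \<E> T. c T * orientation T e) = 0"
    and T0: "T0 \<in> \<T>"
  shows "c T0 = 0"
proof -
  define a :: "real^'n" where "a = axis undefined 1"
  have a: "norm a = 1" by (simp add: a_def)
  have "bounded (\<Union>\<T>)" using compact_elem finite_mesh(1) by (auto intro: compact_imp_bounded)
  then obtain R where R: "\<And>x. x \<in> \<Union>\<T> \<Longrightarrow> norm x \<le> R" by (auto simp: bounded_iff)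
  \<comment> \<open>longer than any chord of the domain\<close>
  define s where "s = 2 * \<bar>R\<bar> + 1"
  have s: "s > 0" by (simp add: s_def)
  obtain y where y: "y \<in> interior T0" "generic a s y"
  proof (rule ccontr)
    assume "\<not> thesis"
    then have "interior T0 \<subseteq> {y. \<not> generic a s y}" using that by blast
    moreover have "AE y in lebesgue. generic a s y"
      using AE_generic by (simp add: AE_completion_iff)
    ultimately have "AE y in lebesgue. y \<notin> interior T0" by (auto elim!: eventually_mono)
    moreover have "interior T0 \<in> sets lebesgue" by (intro sets_completionI_sets) simp
    ultimately have "negligible (interior T0)"
      by (simp add: negligible_iff_null_sets AE_iff_null_sets)
    then show False using open_not_negligible[OF open_interior interior_elem_nonempty[OF T0]] by blast
  qed
  have far: "y - s *\<^sub>R a \<notin> T" if "T \<in> \<T>" for T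
  proof
    assume "y - s *\<^sub>R a \<in> T"
    then have "norm (y - s *\<^sub>R a) \<le> R" "norm y \<le> R"
      using R that T0 y(1) interior_subset[of T0] by blast+
    moreover have "norm (s *\<^sub>R a) \<le> norm y + norm (y - s *\<^sub>R a)"
      using norm_triangle_ineq4[of y "y - s *\<^sub>R a"] by simp
    ultimately show False using a by (simp add: s_def)
  qed
  have only: "indicator T y = (if T = T0 then 1 else 0 :: real)" if T: "T \<in> \<T>" for T
  proof (cases "y \<in> T")
    case True
    then have "y \<in> interior T"
      using generic_not_frontier(1)[OF y(2) T] closed_elem[OF T] by (simp add: frontier_def)
    then show ?thesis using True elems_disjoint[OF T T0 _ y(1)] by simp
  next
    case False
    then show ?thesis using y(1) interior_subset by auto
  qed
  have "(\<Sum>T\<in>\<T>. c T * (indicator T (y - s *\<^sub>R a) - indicator T y)) = (\<Sum>T\<in>\<T>. if T = T0 then - c T0 else 0)"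
    using far only by (intro sum.cong) auto
  also have "\<dots> = - c T0" using T0 finite_mesh(1) by simp
  finally have "- c T0 = (\<Sum>T\<in>\<T>. \<Sum>e\<in>faces_on \<E> T. c T * (sgn (outer_normal T e \<bullet> a) * indicator (prism e a s) y))"
    using indicator_jump[OF _ s y(2)] by (simp add: sum_distrib_left)
  also have "\<dots> = (\<Sum>T\<in>\<T>. \<Sum>e | e \<in> \<E> \<and> e \<in> faces_on \<E> T. c T * orientation T e * (sgn (\<n> e \<bullet> a) * indicator (prism e a s) y))"
  proof (intro sum.cong)
    fix T e assume "T \<in> \<T>" "e \<in> {e. e \<in> \<E> \<and> e \<in> faces_on \<E> T}"
    then have "outer_normal T e = orientation T e *\<^sub>R \<n> e" "orientation T e = 1 \<or> orientation T e = -1"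
      using orientation by auto
    then have "sgn (outer_normal T e \<bullet> a) = orientation T e * sgn (\<n> e \<bullet> a)"
      by (auto simp: sgn_mult)
    then show "c T * (sgn (outer_normal T e \<bullet> a) * indicator (prism e a s) y)
        = c T * orientation T e * (sgn (\<n> e \<bullet> a) * indicator (prism e a s) y)" by simp
  qed (auto dest: faces_onD)
  also have "\<dots> = (\<Sum>e\<in>\<E>. \<Sum>T | T \<in> \<T> \<and> e \<in> faces_on \<E> T. c T * orientation T e * (sgn (\<n> e \<bullet> a) * indicator (prism e a s) y))"
    by (rule sum.swap_restrict) (use finite_mesh in auto)
  also have "\<dots> = 0"
    using c by (simp add: sum_distrib_right[symmetric])
  finally show ?thesis by simp
qed

end

section \<open>Inner products of polynomials on elements and faces\<close>

lemma partial_deriv_add_scaled: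
  assumes "p \<in> polys r" "q \<in> polys r"
  shows "partial_deriv i (\<lambda>x. p x + c * q x) = (\<lambda>x. partial_deriv i p x + c * partial_deriv i q x)"
proof
  fix x
  have "((\<lambda>x. p x + c * q x) has_derivative (\<lambda>h. grad p x \<bullet> h + c * (grad q x \<bullet> h))) (at x)"
    by (intro has_derivative_add has_derivative_mult_right has_derivative_polys[OF assms(1)]
        has_derivative_polys[OF assms(2)])
  then have "(\<lambda>h. grad (\<lambda>x. p x + c * q x) x \<bullet> h) = (\<lambda>h. grad p x \<bullet> h + c * (grad q x \<bullet> h))"
    using has_derivative_unique has_derivative_polys[OF polys_add_scaled[OF assms]] by blast
  from fun_cong[OF this, of "axis i 1"]
  show "partial_deriv i (\<lambda>x. p x + c * q x) x = partial_deriv i p x + c * partial_deriv i q x"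
    by (simp add: grad_def inner_axis)
qed

lemma grad_add_scaled:
  assumes "p \<in> polys r" "q \<in> polys r"
  shows "grad (\<lambda>x. p x + c * q x) x = grad p x + c *\<^sub>R grad q x"
  unfolding grad_def partial_deriv_add_scaled[OF assms] by (simp add: vec_eq_iff)

lemma laplacian_add_scaled:
  assumes "p \<in> polys r" "q \<in> polys r"
  shows "laplacian (\<lambda>x. p x + c * q x) = (\<lambda>x. laplacian p x + c * laplacian q x)"
  unfolding laplacian_def[abs_def] partial_deriv_add_scaled[OF assms]
    partial_deriv_add_scaled[OF partial_deriv_in_polys[OF assms(1)] partial_deriv_in_polys[OF assms(2)]]
  by (simp add: sum.distrib sum_distrib_left)

lemma polys_grad_zero_imp_const:
  assumes p: "p \<in> polys r" and "\<And>i. partial_deriv i p = (\<lambda>x. 0)"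
  shows "\<exists>c. p = (\<lambda>x. c)"
proof -
  have "grad p x = 0" for x using assms(2) by (simp add: grad_def vec_eq_iff)
  then have "(p has_derivative (\<lambda>h. 0)) (at x within UNIV)" for x
    using has_derivative_polys[OF p, of x] by simp
  then obtain c where "\<And>x. x \<in> UNIV \<Longrightarrow> p x = c"
    using has_derivative_zero_constant[of UNIV p] by auto
  then show ?thesis by auto
qed

lemma bounded_measurable_lebesgue_on:
  fixes F :: "real^'n \<Rightarrow> real"
  assumes "compact T" "continuous_on UNIV F"
  shows "F \<in> bounded_measurable (lebesgue_on T)"
proof -
  have "bounded (F ` T)"
    using assms by (meson compact_continuous_image compact_imp_bounded continuous_on_subset subset_UNIV)
  then obtain C where "\<forall>x\<in>T. \<bar>F x\<bar> \<le> C" by (auto simp: bounded_iff)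
  moreover have "F \<in> borel_measurable (lebesgue_on T)"
    by (intro measurable_restrict_space1 measurable_completion)
       (simp add: borel_measurable_continuous_onI[OF assms(2)])
  ultimately show ?thesis by (auto simp: bounded_measurable_def)
qed

lemma finite_measure_lebesgue_on_compact:
  "compact T \<Longrightarrow> finite_measure (lebesgue_on (T :: (real^'n) set))"
  by (intro finite_measure_lebesgue_on lmeasurable_compact)

text \<open>The polynomial vanishes almost everywhere on \<open>T\<close>; the open set of its other points in the interior
  of \<open>T\<close> is null, hence empty.\<close>

lemma inner_elem_null_imp_zero:
  fixes p :: "real^'n \<Rightarrow> real"
  assumes T: "compact T" "interior T \<noteq> {}" and p: "p \<in> polys r" and zero: "inner_elem T p p = 0"
  shows "p = (\<lambda>x. 0)"
proof -
  have "p \<in> bounded_measurable (lebesgue_on T)"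
    by (rule bounded_measurable_lebesgue_on[OF T(1) continuous_on_polys[OF p]])
  then have "integrable (lebesgue_on T) (\<lambda>x. p x * p x)"
    by (intro integrable_mult_bounded_measurable finite_measure_lebesgue_on_compact T)
  then have "AE x in lebesgue_on T. p x * p x = 0"
    using zero integral_nonneg_eq_0_iff_AE[of "lebesgue_on T" "\<lambda>x. p x * p x"]
    by (simp add: inner_L2_def)
  moreover have "T \<inter> space lebesgue \<in> sets lebesgue"
    using lmeasurable_compact[OF T(1)] by (simp add: fmeasurableD)
  ultimately have ae: "AE x in lebesgue. x \<in> T \<longrightarrow> p x * p x = 0"
    by (simp add: AE_restrict_space_iff)
  let ?U = "interior T \<inter> {x. p x \<noteq> 0}"
  have "open ?U"
    by (intro open_Int open_interior open_Collect_neq continuous_on_polys[OF p] continuous_on_const)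
  moreover have "AE x in lebesgue. x \<notin> ?U"
    using ae by (rule eventually_mono) (use interior_subset[of T] in auto)
  moreover from \<open>open ?U\<close> have "?U \<in> sets lebesgue" by (intro sets_completionI_sets) simp
  ultimately have "negligible ?U" "open ?U"
    by (simp_all only: negligible_iff_null_sets AE_iff_null_sets)
  then have "?U = {}" using open_not_negligible by blast
  then have "\<And>x. x \<in> interior T \<Longrightarrow> p x = 0" by blast
  then show ?thesis
    using polys_zero_if_zero_on_open[OF p open_interior] T(2) by blast
qed

context wg_mesh
begin

abbreviation inner_face :: "(real^'n) set \<Rightarrow> (real^'n \<Rightarrow> real) \<Rightarrow> (real^'n \<Rightarrow> real) \<Rightarrow> real" where
  "inner_face e \<equiv> inner_L2 (surface_measure e)"

abbreviation face_fun :: "(real^'n) set \<Rightarrow> (real^'n \<Rightarrow> real) set" where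
  "face_fun e \<equiv> bounded_measurable (surface_measure e)"

lemma space_face: "e \<in> \<E> \<Longrightarrow> space (surface_measure e) = e"
  using flat_face.space_surface[OF flat_face] .

lemma finite_measure_face: "e \<in> \<E> \<Longrightarrow> finite_measure (surface_measure e)"
  using flat_face.finite_measure_surface[OF flat_face] .

lemma face_fun_continuous: "e \<in> \<E> \<Longrightarrow> continuous_on UNIV F \<Longrightarrow> F \<in> face_fun e"
  using flat_face.bounded_measurable_surface[OF flat_face] by blast

lemma face_fun_polys: "e \<in> \<E> \<Longrightarrow> p \<in> polys r \<Longrightarrow> p \<in> face_fun e"
  using face_fun_continuous continuous_on_polys by blast

lemma face_fun_polys_on:
  assumes "e \<in> \<E>" "p \<in> polys_on r e"
  shows "p \<in> face_fun e"
proof -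
  obtain P where P: "P \<in> polys r" "p = restrict P e" using assms(2) by (auto simp: polys_on_def)
  show ?thesis
    by (rule flat_face.bounded_measurable_surface[OF flat_face[OF assms(1)] continuous_on_polys[OF P(1)]])
       (simp add: P(2))
qed

lemma inner_face_cong:
  assumes "e \<in> \<E>" "\<And>x. x \<in> e \<Longrightarrow> f x = f' x" "\<And>x. x \<in> e \<Longrightarrow> g x = g' x"
  shows "inner_face e f g = inner_face e f' g'"
  using assms by (intro inner_L2_cong) (auto simp: space_face)

lemma inner_face_add_scaled:
  assumes "e \<in> \<E>" "f \<in> face_fun e" "g \<in> face_fun e" "h \<in> face_fun e"
  shows "inner_face e (\<lambda>x. f x + c * g x) h = inner_face e f h + c * inner_face e g h"
  using inner_L2_add_scaled[OF finite_measure_face[OF assms(1)] assms(2-4)] .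

lemma inner_face_add_scaled_right:
  assumes "e \<in> \<E>" "f \<in> face_fun e" "g \<in> face_fun e" "h \<in> face_fun e"
  shows "inner_face e h (\<lambda>x. f x + c * g x) = inner_face e h f + c * inner_face e h g"
  using inner_face_add_scaled[OF assms] by (simp only: inner_L2_commute[of _ h])

lemma inner_elem_add_scaled:
  assumes "T \<in> \<T>" "p \<in> polys r" "q \<in> polys s" "h \<in> polys t"
  shows "inner_elem T (\<lambda>x. p x + c * q x) h = inner_elem T p h + c * inner_elem T q h"
  using assms by (intro inner_L2_add_scaled finite_measure_lebesgue_on_compact
      bounded_measurable_lebesgue_on compact_elem) (auto intro: continuous_on_polys)

lemma inner_elem_add_scaled_right:
  assumes "T \<in> \<T>" "p \<in> polys r" "q \<in> polys s" "h \<in> polys t"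
  shows "inner_elem T h (\<lambda>x. p x + c * q x) = inner_elem T h p + c * inner_elem T h q"
  using inner_elem_add_scaled[OF assms] by (simp only: inner_L2_commute[of _ h])

lemma inner_elem_null:
  "T \<in> \<T> \<Longrightarrow> p \<in> polys r \<Longrightarrow> inner_elem T p p = 0 \<Longrightarrow> p = (\<lambda>x. 0)"
  using inner_elem_null_imp_zero[OF compact_elem interior_elem_nonempty] by blast

lemma inner_face_null:
  "e \<in> \<E> \<Longrightarrow> continuous_on UNIV F \<Longrightarrow> inner_face e F F = 0 \<Longrightarrow> x \<in> e \<Longrightarrow> F x = 0"
  using flat_face.surface_null_imp_zero[OF flat_face] by blast

lemma polys_on_eqI:
  assumes e: "e \<in> \<E>" and p: "p \<in> polys_on r e" and q: "q \<in> polys_on r e"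
    and eq: "\<And>h. h \<in> polys_on r e \<Longrightarrow> inner_face e p h = inner_face e q h"
  shows "p = q"
proof -
  obtain P Q where P: "P \<in> polys r" "p = restrict P e" and Q: "Q \<in> polys r" "q = restrict Q e"
    using p q by (auto simp: polys_on_def)
  let ?D = "\<lambda>x. P x + (-1) * Q x"
  have D: "?D \<in> polys r" using polys_add_scaled[OF P(1) Q(1)] .
  have "restrict ?D e \<in> polys_on r e" using D by (auto simp: polys_on_def)
  from eq[OF this] have "inner_face e P ?D = inner_face e Q ?D"
    using inner_face_cong[OF e, of p P "restrict ?D e" ?D] inner_face_cong[OF e, of q Q "restrict ?D e" ?D]
    by (simp add: P(2) Q(2))
  then have "inner_face e ?D ?D = 0"
    using inner_face_add_scaled[OF e face_fun_polys[OF e P(1)] face_fun_polys[OF e Q(1)]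
        face_fun_polys[OF e D], of "-1"] by simp
  then have "?D x = 0" if "x \<in> e" for x
    using inner_face_null[OF e continuous_on_polys[OF D]] that by blast
  then show ?thesis unfolding P(2) Q(2) by (intro restrict_ext) simp
qed

lemma Qb_exists:
  assumes e: "e \<in> \<E>" and F: "F \<in> face_fun e"
  shows "\<exists>p\<in>polys_on r e. \<forall>q\<in>polys_on r e. inner_face e p q = inner_face e F q"
proof -
  have null: "\<forall>x\<in>e. f x = 0" if "f \<in> polys r" "inner_face e f f = 0" for f
    using inner_face_null[OF e continuous_on_polys[OF that(1)] that(2)] by blast
  have "\<exists>p\<in>polys r. \<forall>q\<in>polys r. inner_face e p q = inner_face e F q"
  proof (rule Riesz_representation_polys)
    show "inner_face e (\<lambda>x. f x + c * g x) h = inner_face e f h + c * inner_face e g h"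
      if "f \<in> polys r" "g \<in> polys r" "h \<in> polys r" for f g h c
      using that face_fun_polys[OF e] by (intro inner_face_add_scaled e) blast+
    show "inner_face e F (\<lambda>x. f x + c * g x) = inner_face e F f + c * inner_face e F g"
      if "f \<in> polys r" "g \<in> polys r" for f g c
      using that face_fun_polys[OF e] F by (intro inner_face_add_scaled_right e) blast+
    show "inner_face e f g = 0" if "f \<in> polys r" "g \<in> polys r" "inner_face e f f = 0" for f g
    proof -
      have "inner_face e f g = inner_face e (\<lambda>x. 0) g"
        using null[OF that(1,3)] by (intro inner_face_cong[OF e]) auto
      then show ?thesis by (simp add: inner_L2_def)
    qed
    show "inner_face e F f = 0" if "f \<in> polys r" "inner_face e f f = 0" for f
    proof -
      have "inner_face e F f = inner_face e F (\<lambda>x. 0)"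
        using null[OF that] by (intro inner_face_cong[OF e]) auto
      then show ?thesis by (simp add: inner_L2_def)
    qed
  qed (rule inner_L2_commute)
  then obtain P where P: "P \<in> polys r" "\<forall>q\<in>polys r. inner_face e P q = inner_face e F q" by blast
  have "inner_face e (restrict P e) q = inner_face e F q" if "q \<in> polys_on r e" for q
  proof -
    obtain Q where Q: "Q \<in> polys r" "q = restrict Q e" using \<open>q \<in> polys_on r e\<close> by (auto simp: polys_on_def)
    have "inner_face e (restrict P e) q = inner_face e P Q" "inner_face e F q = inner_face e F Q"
      by (intro inner_face_cong[OF e]; simp add: Q)+
    then show ?thesis using P(2) Q(1) by simp
  qed
  then show ?thesis using P(1) by (intro bexI[of _ "restrict P e"]) (auto simp: polys_on_def)
qed

lemma Qb:
  assumes e: "e \<in> \<E>" and F: "F \<in> face_fun e"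
  shows "Q\<^sub>b k e F \<in> polys_on (k - 1) e"
    and "\<And>q. q \<in> polys_on (k - 1) e \<Longrightarrow> inner_face e (Q\<^sub>b k e F) q = inner_face e F q"
proof -
  have "\<exists>!p. p \<in> polys_on (k - 1) e \<and> (\<forall>q\<in>polys_on (k - 1) e. inner_face e p q = inner_face e F q)"
    using Qb_exists[OF assms, of "k - 1"] polys_on_eqI[OF e] by (auto intro!: ex_ex1I)
  from theI'[OF this]
  show "Q\<^sub>b k e F \<in> polys_on (k - 1) e"
    and "\<And>q. q \<in> polys_on (k - 1) e \<Longrightarrow> inner_face e (Q\<^sub>b k e F) q = inner_face e F q"
    unfolding Q\<^sub>b_def by blast+
qed

lemma polys_on_add_scaled:
  assumes "p \<in> polys_on r e" "q \<in> polys_on r e"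
  shows "(\<lambda>x\<in>e. p x + c * q x) \<in> polys_on r e"
proof -
  obtain P Q where "P \<in> polys r" "p = restrict P e" "Q \<in> polys r" "q = restrict Q e"
    using assms by (auto simp: polys_on_def)
  then have "(\<lambda>x. P x + c * Q x) \<in> polys r" "(\<lambda>x\<in>e. p x + c * q x) = restrict (\<lambda>x. P x + c * Q x) e"
    by (auto intro: polys_add_scaled)
  then show ?thesis unfolding polys_on_def by blast
qed

lemma Qb_add_scaled:
  assumes e: "e \<in> \<E>" and F: "F \<in> face_fun e" and G: "G \<in> face_fun e"
    and FG: "(\<lambda>x. F x + c * G x) \<in> face_fun e" and x: "x \<in> e"
  shows "Q\<^sub>b k e (\<lambda>x. F x + c * G x) x = Q\<^sub>b k e F x + c * Q\<^sub>b k e G x"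
proof -
  have "Q\<^sub>b k e (\<lambda>x. F x + c * G x) = (\<lambda>x\<in>e. Q\<^sub>b k e F x + c * Q\<^sub>b k e G x)"
  proof (rule polys_on_eqI[OF e Qb(1)[OF e FG]])
    show "(\<lambda>x\<in>e. Q\<^sub>b k e F x + c * Q\<^sub>b k e G x) \<in> polys_on (k - 1) e"
      by (intro polys_on_add_scaled Qb(1) e F G)
    fix h assume h: "h \<in> polys_on (k - 1) e"
    have "inner_face e (\<lambda>x\<in>e. Q\<^sub>b k e F x + c * Q\<^sub>b k e G x) h
        = inner_face e (\<lambda>x. Q\<^sub>b k e F x + c * Q\<^sub>b k e G x) h"
      by (rule inner_face_cong[OF e]) simp_all
    also have "\<dots> = inner_face e F h + c * inner_face e G h"
      by (subst inner_face_add_scaled[OF e])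
         (simp_all add: Qb(2)[OF e _ h] face_fun_polys_on[OF e Qb(1)[OF e]] F G face_fun_polys_on[OF e h])
    also have "\<dots> = inner_face e (\<lambda>x. F x + c * G x) h"
      by (simp add: inner_face_add_scaled[OF e F G face_fun_polys_on[OF e h]])
    finally show "inner_face e (Q\<^sub>b k e (\<lambda>x. F x + c * G x)) h
        = inner_face e (\<lambda>x\<in>e. Q\<^sub>b k e F x + c * Q\<^sub>b k e G x) h"
      by (simp add: Qb(2)[OF e FG h])
  qed
  then show ?thesis using x by simp
qed

lemma Qb_const:
  assumes e: "e \<in> \<E>" and x: "x \<in> e"
  shows "Q\<^sub>b k e (\<lambda>x. c) x = c"
proof -
  have c: "(\<lambda>x. c) \<in> face_fun e" by (intro face_fun_continuous e continuous_on_const)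
  have "Q\<^sub>b k e (\<lambda>x. c) = restrict (\<lambda>x. c) e"
  proof (rule polys_on_eqI[OF e Qb(1)[OF e c]])
    show "restrict (\<lambda>x. c) e \<in> polys_on (k - 1) e" unfolding polys_on_def using polys_const by blast
    fix h assume "h \<in> polys_on (k - 1) e"
    then have "inner_face e (Q\<^sub>b k e (\<lambda>x. c)) h = inner_face e (\<lambda>x. c) h" by (rule Qb(2)[OF e c])
    also have "\<dots> = inner_face e (restrict (\<lambda>x. c) e) h" by (rule inner_face_cong[OF e]) simp_all
    finally show "inner_face e (Q\<^sub>b k e (\<lambda>x. c)) h = inner_face e (restrict (\<lambda>x. c) e) h" .
  qed
  then show ?thesis using x by simp
qed

section \<open>Green's formulas\<close>

definition dirichlet :: "(real^'n) set \<Rightarrow> (real^'n \<Rightarrow> real) \<Rightarrow> (real^'n \<Rightarrow> real) \<Rightarrow> real" where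
  "dirichlet T p q = (\<Sum>i\<in>UNIV. inner_elem T (partial_deriv i p) (partial_deriv i q))"

lemma dirichlet_commute: "dirichlet T p q = dirichlet T q p"
  by (simp add: dirichlet_def inner_L2_commute)

text \<open>The divergence theorem for \<open>q \<partial>\<^sub>i p\<close> in the \<open>i\<close>-th direction, summed over \<open>i\<close>.\<close>

lemma green_first:
  assumes T: "T \<in> \<T>" and p: "p \<in> polys r" and q: "q \<in> polys s"
  shows "inner_elem T (laplacian p) q + dirichlet T p q
    = (\<Sum>e\<in>faces_on \<E> T. inner_face e (\<lambda>x. grad p x \<bullet> outer_normal T e) q)"
proof -
  have q': "continuous_on UNIV q" by (rule continuous_on_polys[OF q])
  have int: "integrable (lebesgue_on T) (\<lambda>x. f x * g x)"
    if "f \<in> polys m" "g \<in> polys m'" for f g :: "real^'n \<Rightarrow> real" and m m'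
    using that T by (intro integrable_mult_bounded_measurable finite_measure_lebesgue_on_compact
        bounded_measurable_lebesgue_on compact_elem) (auto intro: continuous_on_polys)
  have part: "inner_elem T (partial_deriv i (partial_deriv i p)) q
      + inner_elem T (partial_deriv i p) (partial_deriv i q)
      = (\<Sum>e\<in>faces_on \<E> T. (outer_normal T e $ i) * inner_face e (partial_deriv i p) q)" for i
  proof -
    have pi: "partial_deriv i p \<in> polys (r - 1)" by (rule partial_deriv_in_polys[OF p])
    let ?G = "\<lambda>x. q x *\<^sub>R grad (partial_deriv i p) x + partial_deriv i p x *\<^sub>R grad q x"
    have "((\<lambda>x. partial_deriv i p x * q x) has_derivative (\<lambda>h. ?G x \<bullet> h)) (at x)" for x
    proof -
      have "((\<lambda>x. partial_deriv i p x * q x) has_derivative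
          (\<lambda>h. partial_deriv i p x * (grad q x \<bullet> h) + (grad (partial_deriv i p) x \<bullet> h) * q x)) (at x)"
        by (intro has_derivative_mult has_derivative_polys[OF pi] has_derivative_polys[OF q])
      moreover have "(\<lambda>h. partial_deriv i p x * (grad q x \<bullet> h) + (grad (partial_deriv i p) x \<bullet> h) * q x)
          = (\<lambda>h. ?G x \<bullet> h)"
        by (simp add: fun_eq_iff inner_add_left)
      ultimately show ?thesis by simp
    qed
    moreover have "continuous_on UNIV ?G"
      by (intro continuous_intros q' continuous_on_grad[OF pi] continuous_on_grad[OF q] continuous_on_polys[OF pi])
    ultimately have "integral\<^sup>L (lebesgue_on T) (\<lambda>x. ?G x \<bullet> axis i 1)
        = (\<Sum>e\<in>faces_on \<E> T. (outer_normal T e \<bullet> axis i 1) *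
            integral\<^sup>L (surface_measure e) (\<lambda>x. partial_deriv i p x * q x))"
      by (rule divergence_theorem_elem[OF T])
    moreover have "?G x \<bullet> axis i 1 = partial_deriv i (partial_deriv i p) x * q x + partial_deriv i p x * partial_deriv i q x" for x
      by (simp add: inner_add_left inner_axis grad_def)
    ultimately have "(\<integral>x. partial_deriv i (partial_deriv i p) x * q x + partial_deriv i p x * partial_deriv i q x \<partial>lebesgue_on T)
        = (\<Sum>e\<in>faces_on \<E> T. (outer_normal T e $ i) * inner_face e (partial_deriv i p) q)"
      by (simp add: inner_L2_def inner_axis)
    then show ?thesis
      unfolding inner_L2_def
      by (subst (asm) Bochner_Integration.integral_add)
         (auto intro!: int partial_deriv_in_polys p q)
  qed
  have lap: "inner_elem T (laplacian p) q = (\<Sum>i\<in>UNIV. inner_elem T (partial_deriv i (partial_deriv i p)) q)"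
    unfolding inner_L2_def laplacian_def sum_distrib_right
    by (rule Bochner_Integration.integral_sum)
       (rule int[OF partial_deriv_in_polys[OF partial_deriv_in_polys[OF p]] q])
  have normal: "inner_face e (\<lambda>x. grad p x \<bullet> \<nu>) q = (\<Sum>i\<in>UNIV. (\<nu> $ i) * inner_face e (partial_deriv i p) q)"
    if e: "e \<in> \<E>" for e \<nu>
  proof -
    have "(grad p x \<bullet> \<nu>) * q x = (\<Sum>i\<in>UNIV. (\<nu> $ i) * (partial_deriv i p x * q x))" for x
      by (simp add: inner_vec_def grad_def sum_distrib_right sum_distrib_left mult_ac)
    then have "inner_face e (\<lambda>x. grad p x \<bullet> \<nu>) q
        = (\<integral>x. (\<Sum>i\<in>UNIV. (\<nu> $ i) * (partial_deriv i p x * q x)) \<partial>surface_measure e)"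
      by (simp add: inner_L2_def)
    also have "\<dots> = (\<Sum>i\<in>UNIV. (\<nu> $ i) * inner_face e (partial_deriv i p) q)"
      unfolding inner_L2_def
      by (subst Bochner_Integration.integral_sum)
         (auto intro!: integrable_mult_right integrable_mult_bounded_measurable finite_measure_face e
            face_fun_polys[OF e partial_deriv_in_polys[OF p]] face_fun_polys[OF e q])
    finally show ?thesis .
  qed
  have "inner_elem T (laplacian p) q + dirichlet T p q
      = (\<Sum>i\<in>UNIV. \<Sum>e\<in>faces_on \<E> T. (outer_normal T e $ i) * inner_face e (partial_deriv i p) q)"
    unfolding lap dirichlet_def sum.distrib[symmetric] part ..
  also have "\<dots> = (\<Sum>e\<in>faces_on \<E> T. inner_face e (\<lambda>x. grad p x \<bullet> outer_normal T e) q)"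
    by (subst sum.swap) (intro sum.cong refl normal[symmetric] faces_onD)
  finally show ?thesis .
qed

lemma green_second:
  assumes "T \<in> \<T>" "p \<in> polys r" "q \<in> polys s"
  shows "inner_elem T (laplacian p) q = inner_elem T p (laplacian q)
    - (\<Sum>e\<in>faces_on \<E> T. inner_face e p (\<lambda>x. grad q x \<bullet> outer_normal T e))
    + (\<Sum>e\<in>faces_on \<E> T. inner_face e (\<lambda>x. grad p x \<bullet> outer_normal T e) q)"
  using green_first[OF assms] green_first[OF assms(1,3,2)]
  by (simp add: dirichlet_commute[of T q p] inner_L2_commute[of _ p])

end

section \<open>The bilinear form on weak functions\<close>

context wg_mesh
begin

abbreviation \<V> :: "nat \<Rightarrow> 'n weak_fun set" where
  "\<V> k \<equiv> V\<^sub>h k \<T> \<E>"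

abbreviation \<V>\<^sub>0 :: "nat \<Rightarrow> 'n weak_fun set" where
  "\<V>\<^sub>0 k \<equiv> V\<^sub>h\<^sub>0 k \<Omega> \<T> \<E>"

abbreviation \<Delta>\<^sub>w :: "nat \<Rightarrow> 'n weak_fun \<Rightarrow> (real^'n) set \<Rightarrow> real^'n \<Rightarrow> real" where
  "\<Delta>\<^sub>w k \<equiv> weak_laplacian k \<E> \<n>"

abbreviation energy :: "nat \<Rightarrow> 'n weak_fun \<Rightarrow> 'n weak_fun \<Rightarrow> real" where
  "energy k \<equiv> wg_form k \<T> \<E> \<n>"

definition add_scaled :: "real \<Rightarrow> 'n weak_fun \<Rightarrow> 'n weak_fun \<Rightarrow> 'n weak_fun" where
  "add_scaled c v w = (case (v, w) of ((v0, vb, vn), (w0, wb, wn)) \<Rightarrow>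
     (\<lambda>T\<in>\<T>. \<lambda>x. v0 T x + c * w0 T x, \<lambda>e\<in>\<E>. \<lambda>x\<in>e. vb e x + c * wb e x, \<lambda>e\<in>\<E>. \<lambda>x\<in>e. vn e x + c * wn e x))"

lemma V\<^sub>hD:
  assumes "(v0, vb, vn) \<in> \<V> k"
  shows "T \<in> \<T> \<Longrightarrow> v0 T \<in> polys k" "e \<in> \<E> \<Longrightarrow> vb e \<in> polys_on (k - 1) e" "e \<in> \<E> \<Longrightarrow> vn e \<in> polys_on (k - 1) e"
  using assms by (auto simp: V\<^sub>h_def)

lemma V\<^sub>h_eqI:
  assumes v: "(v0, vb, vn) \<in> \<V> k" and w: "(w0, wb, wn) \<in> \<V> k"
    and "\<And>T. T \<in> \<T> \<Longrightarrow> v0 T = w0 T"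
    and "\<And>e x. e \<in> \<E> \<Longrightarrow> x \<in> e \<Longrightarrow> vb e x = wb e x \<and> vn e x = wn e x"
  shows "(v0, vb, vn) = (w0, wb, wn)"
proof -
  have face: "p = q" if p: "p \<in> (\<Pi>\<^sub>E e\<in>\<E>. polys_on (k - 1) e)" and q: "q \<in> (\<Pi>\<^sub>E e\<in>\<E>. polys_on (k - 1) e)"
    and eq: "\<And>e x. e \<in> \<E> \<Longrightarrow> x \<in> e \<Longrightarrow> p e x = q e x" for p q :: "'n elem_fun"
  proof (rule PiE_ext[OF p q])
    fix e assume e: "e \<in> \<E>"
    then have "p e \<in> extensional e" "q e \<in> extensional e"
      using PiE_mem[OF p e] PiE_mem[OF q e] by (auto simp: polys_on_def)
    then show "p e = q e" by (rule extensionalityI) (rule eq[OF e])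
  qed
  have "v0 = w0" by (rule PiE_ext[of v0 \<T> "\<lambda>_. polys k"]) (use assms in \<open>auto simp: V\<^sub>h_def\<close>)
  then show ?thesis using face[of vb wb] face[of vn wn] assms by (simp add: V\<^sub>h_def)
qed

lemma V\<^sub>h_add_scaled:
  assumes "v \<in> \<V> k" "w \<in> \<V> k"
  shows "add_scaled c v w \<in> \<V> k"
  using assms
  by (cases v; cases w)
     (auto simp: add_scaled_def V\<^sub>h_def intro!: polys_add_scaled polys_on_add_scaled)

text \<open>The right-hand side that defines \<open>\<Delta>\<^sub>w\<close>, with the constant \<open>n\<^sub>e \<bullet> n\<close> pulled out of the face
  integrals.\<close>

definition weak_laplacian_functional :: "'n weak_fun \<Rightarrow> (real^'n) set \<Rightarrow> (real^'n \<Rightarrow> real) \<Rightarrow> real" where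
  "weak_laplacian_functional v T \<phi> = (case v of (v0, vb, vn) \<Rightarrow>
     inner_elem T (v0 T) (laplacian \<phi>)
     - (\<Sum>e\<in>faces_on \<E> T. inner_face e (vb e) (\<lambda>x. grad \<phi> x \<bullet> outer_normal T e))
     + (\<Sum>e\<in>faces_on \<E> T. orientation T e * inner_face e (vn e) \<phi>))"

lemma weak_laplacian_functional:
  "inner_elem T (v0 T) (laplacian \<phi>)
    - inner_bd \<E> T vb (\<lambda>e x. grad \<phi> x \<bullet> outer_normal T e)
    + inner_bd \<E> T (\<lambda>e x. vn e x * (\<n> e \<bullet> outer_normal T e)) (\<lambda>e. \<phi>)
    = weak_laplacian_functional (v0, vb, vn) T \<phi>"
proof -
  have "inner_face e (\<lambda>x. vn e x * (\<n> e \<bullet> outer_normal T e)) \<phi> = orientation T e * inner_face e (vn e) \<phi>" for e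
    using inner_L2_scale[of "surface_measure e" "orientation T e" "vn e" \<phi>]
    by (simp add: orientation_def mult.commute)
  then show ?thesis by (simp add: weak_laplacian_functional_def inner_bd_def)
qed

lemma face_fun_grad:
  "e \<in> \<E> \<Longrightarrow> p \<in> polys r \<Longrightarrow> (\<lambda>x. grad p x \<bullet> a) \<in> face_fun e"
  using face_fun_polys inner_grad_in_polys by blast

lemma weak_laplacian_functional_add_scaled_right:
  assumes v: "v \<in> \<V> k" and T: "T \<in> \<T>" and p: "p \<in> polys r" "q \<in> polys r"
  shows "weak_laplacian_functional v T (\<lambda>x. p x + c * q x)
    = weak_laplacian_functional v T p + c * weak_laplacian_functional v T q"
proof -
  obtain v0 vb vn where v_eq: "v = (v0, vb, vn)" by (cases v)
  note V = V\<^sub>hD[OF v[unfolded v_eq]]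
  let ?\<nu> = "outer_normal T"
  have lap: "inner_elem T (v0 T) (laplacian (\<lambda>x. p x + c * q x))
      = inner_elem T (v0 T) (laplacian p) + c * inner_elem T (v0 T) (laplacian q)"
    unfolding laplacian_add_scaled[OF p]
    by (rule inner_elem_add_scaled_right[OF T laplacian_in_polys[OF p(1)] laplacian_in_polys[OF p(2)] V(1)[OF T]])
  have trace: "(\<Sum>e\<in>faces_on \<E> T. inner_face e (vb e) (\<lambda>x. grad (\<lambda>x. p x + c * q x) x \<bullet> ?\<nu> e))
      = (\<Sum>e\<in>faces_on \<E> T. inner_face e (vb e) (\<lambda>x. grad p x \<bullet> ?\<nu> e))
        + c * (\<Sum>e\<in>faces_on \<E> T. inner_face e (vb e) (\<lambda>x. grad q x \<bullet> ?\<nu> e))"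
    unfolding sum_distrib_left sum.distrib[symmetric] grad_add_scaled[OF p] inner_add_left inner_scaleR_left
  proof (rule sum.cong[OF refl])
    fix e assume "e \<in> faces_on \<E> T"
    then have e: "e \<in> \<E>" by (rule faces_onD)
    show "inner_face e (vb e) (\<lambda>x. grad p x \<bullet> ?\<nu> e + c * (grad q x \<bullet> ?\<nu> e))
        = inner_face e (vb e) (\<lambda>x. grad p x \<bullet> ?\<nu> e) + c * inner_face e (vb e) (\<lambda>x. grad q x \<bullet> ?\<nu> e)"
      by (rule inner_face_add_scaled_right[OF e face_fun_grad[OF e p(1)] face_fun_grad[OF e p(2)]
            face_fun_polys_on[OF e V(2)[OF e]]])
  qed
  have flux: "(\<Sum>e\<in>faces_on \<E> T. orientation T e * inner_face e (vn e) (\<lambda>x. p x + c * q x))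
      = (\<Sum>e\<in>faces_on \<E> T. orientation T e * inner_face e (vn e) p)
        + c * (\<Sum>e\<in>faces_on \<E> T. orientation T e * inner_face e (vn e) q)"
    unfolding sum_distrib_left sum.distrib[symmetric]
  proof (rule sum.cong[OF refl])
    fix e assume "e \<in> faces_on \<E> T"
    then have e: "e \<in> \<E>" by (rule faces_onD)
    show "orientation T e * inner_face e (vn e) (\<lambda>x. p x + c * q x)
        = orientation T e * inner_face e (vn e) p + c * (orientation T e * inner_face e (vn e) q)"
      unfolding inner_face_add_scaled_right[OF e face_fun_polys[OF e p(1)] face_fun_polys[OF e p(2)]
          face_fun_polys_on[OF e V(3)[OF e]]] by (simp add: distrib_left mult.left_commute)
  qed
  show ?thesis
    unfolding weak_laplacian_functional_def v_eq case_prod_conv lap trace flux distrib_left right_diff_distrib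
    by linarith
qed

lemma weak_laplacian:
  assumes v: "v \<in> \<V> k" and T: "T \<in> \<T>"
  shows "\<Delta>\<^sub>w k v T \<in> polys (k - 2)"
    and "\<And>\<phi>. \<phi> \<in> polys (k - 2) \<Longrightarrow> inner_elem T (\<Delta>\<^sub>w k v T) \<phi> = weak_laplacian_functional v T \<phi>"
proof -
  obtain v0 vb vn where v_eq: "v = (v0, vb, vn)" by (cases v)
  let ?P = "polys (k - 2) :: (real^'n \<Rightarrow> real) set"
  have zero: "weak_laplacian_functional v T (\<lambda>x. 0) = 0"
    using weak_laplacian_functional_add_scaled_right[OF v T polys_zero polys_zero, of 1] by simp
  have "\<exists>p\<in>?P. \<forall>\<phi>\<in>?P. inner_elem T p \<phi> = weak_laplacian_functional v T \<phi>"
  proof (rule Riesz_representation_polys)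
    show "inner_elem T (\<lambda>x. f x + c * g x) h = inner_elem T f h + c * inner_elem T g h"
      if "f \<in> ?P" "g \<in> ?P" "h \<in> ?P" for f g h c
      by (rule inner_elem_add_scaled[OF T that])
    show "weak_laplacian_functional v T (\<lambda>x. f x + c * g x)
        = weak_laplacian_functional v T f + c * weak_laplacian_functional v T g"
      if "f \<in> ?P" "g \<in> ?P" for f g c
      by (rule weak_laplacian_functional_add_scaled_right[OF v T that])
    show "inner_elem T f g = 0" if "f \<in> ?P" "g \<in> ?P" "inner_elem T f f = 0" for f g
      unfolding inner_elem_null[OF T that(1,3)] by (simp add: inner_L2_def)
    show "weak_laplacian_functional v T f = 0" if "f \<in> ?P" "inner_elem T f f = 0" for f
      unfolding inner_elem_null[OF T that] by (rule zero)
  qed (rule inner_L2_commute)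
  moreover have "p = q"
    if p: "p \<in> ?P" and q: "q \<in> ?P" and eq: "\<forall>\<phi>\<in>?P. inner_elem T p \<phi> = inner_elem T q \<phi>" for p q
  proof -
    let ?D = "\<lambda>x. p x + (-1) * q x"
    have D: "?D \<in> ?P" by (rule polys_add_scaled[OF p q])
    have "inner_elem T ?D ?D = 0"
      using inner_elem_add_scaled[OF T p q D, of "-1"] bspec[OF eq D] by simp
    from inner_elem_null[OF T D this] show ?thesis by (simp add: fun_eq_iff)
  qed
  ultimately have "\<exists>!p. p \<in> ?P \<and> (\<forall>\<phi>\<in>?P. inner_elem T p \<phi> = weak_laplacian_functional v T \<phi>)"
    by (intro ex_ex1I) (blast, simp)
  from theI'[OF this]
  show "\<Delta>\<^sub>w k v T \<in> polys (k - 2)"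
    and "\<And>\<phi>. \<phi> \<in> polys (k - 2) \<Longrightarrow> inner_elem T (\<Delta>\<^sub>w k v T) \<phi> = weak_laplacian_functional v T \<phi>"
    unfolding weak_laplacian_def v_eq case_prod_conv weak_laplacian_functional by blast+
qed

lemma weak_laplacian_add_scaled:
  assumes v: "v \<in> \<V> k" and w: "w \<in> \<V> k" and T: "T \<in> \<T>"
  shows "\<Delta>\<^sub>w k (add_scaled c v w) T
    = (\<lambda>x. \<Delta>\<^sub>w k v T x + c * \<Delta>\<^sub>w k w T x)"
proof -
  obtain v0 vb vn w0 wb wn where v_eq: "v = (v0, vb, vn)" and w_eq: "w = (w0, wb, wn)"
    by (cases v, cases w)
  note V = V\<^sub>hD[OF v[unfolded v_eq]] and W = V\<^sub>hD[OF w[unfolded w_eq]]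
  let ?z = "add_scaled c v w"
  have z: "?z \<in> \<V> k" by (rule V\<^sub>h_add_scaled[OF v w])
  note Lz = weak_laplacian[OF z T] and Lv = weak_laplacian[OF v T] and Lw = weak_laplacian[OF w T]
  let ?D = "\<lambda>x. \<Delta>\<^sub>w k v T x + c * \<Delta>\<^sub>w k w T x"
  have D: "?D \<in> polys (k - 2)" by (rule polys_add_scaled[OF Lv(1) Lw(1)])
  have fun_eq: "weak_laplacian_functional ?z T \<phi>
      = weak_laplacian_functional v T \<phi> + c * weak_laplacian_functional w T \<phi>" if \<phi>: "\<phi> \<in> polys (k - 2)" for \<phi>
  proof -
    have lap: "inner_elem T (\<lambda>x. v0 T x + c * w0 T x) (laplacian \<phi>)
        = inner_elem T (v0 T) (laplacian \<phi>) + c * inner_elem T (w0 T) (laplacian \<phi>)"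
      by (rule inner_elem_add_scaled[OF T V(1)[OF T] W(1)[OF T] laplacian_in_polys[OF \<phi>]])
    have face: "inner_face e ((\<lambda>e\<in>\<E>. \<lambda>x\<in>e. p e x + c * q e x) e) h = inner_face e (p e) h + c * inner_face e (q e) h"
      if e: "e \<in> faces_on \<E> T" and p: "p e \<in> polys_on (k - 1) e" and q: "q e \<in> polys_on (k - 1) e"
        and h: "h \<in> face_fun e" for e h and p q :: "'n elem_fun"
    proof -
      have eE: "e \<in> \<E>" using e by (rule faces_onD)
      have "inner_face e ((\<lambda>e\<in>\<E>. \<lambda>x\<in>e. p e x + c * q e x) e) h = inner_face e (\<lambda>x. p e x + c * q e x) h"
        by (rule inner_face_cong[OF eE]) (simp_all add: eE)
      then show ?thesis
        using inner_face_add_scaled[OF eE face_fun_polys_on[OF eE p] face_fun_polys_on[OF eE q] h] by simp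
    qed
    let ?vb = "\<lambda>e\<in>\<E>. \<lambda>x\<in>e. vb e x + c * wb e x" and ?vn = "\<lambda>e\<in>\<E>. \<lambda>x\<in>e. vn e x + c * wn e x"
    have trace: "(\<Sum>e\<in>faces_on \<E> T. inner_face e (?vb e) (\<lambda>x. grad \<phi> x \<bullet> outer_normal T e))
        = (\<Sum>e\<in>faces_on \<E> T. inner_face e (vb e) (\<lambda>x. grad \<phi> x \<bullet> outer_normal T e))
          + c * (\<Sum>e\<in>faces_on \<E> T. inner_face e (wb e) (\<lambda>x. grad \<phi> x \<bullet> outer_normal T e))"
      unfolding sum_distrib_left sum.distrib[symmetric]
    proof (rule sum.cong[OF refl])
      fix e assume e: "e \<in> faces_on \<E> T"
      note eE = faces_onD[OF e]
      show "inner_face e (?vb e) (\<lambda>x. grad \<phi> x \<bullet> outer_normal T e)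
          = inner_face e (vb e) (\<lambda>x. grad \<phi> x \<bullet> outer_normal T e)
            + c * inner_face e (wb e) (\<lambda>x. grad \<phi> x \<bullet> outer_normal T e)"
        by (rule face[of e vb wb, OF e V(2)[OF eE] W(2)[OF eE] face_fun_grad[OF eE \<phi>]])
    qed
    have flux: "(\<Sum>e\<in>faces_on \<E> T. orientation T e * inner_face e (?vn e) \<phi>)
        = (\<Sum>e\<in>faces_on \<E> T. orientation T e * inner_face e (vn e) \<phi>)
          + c * (\<Sum>e\<in>faces_on \<E> T. orientation T e * inner_face e (wn e) \<phi>)"
      unfolding sum_distrib_left sum.distrib[symmetric]
    proof (rule sum.cong[OF refl])
      fix e assume e: "e \<in> faces_on \<E> T"
      note eE = faces_onD[OF e]
      have "inner_face e (?vn e) \<phi> = inner_face e (vn e) \<phi> + c * inner_face e (wn e) \<phi>"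
        by (rule face[of e vn wn, OF e V(3)[OF eE] W(3)[OF eE] face_fun_polys[OF eE \<phi>]])
      then show "orientation T e * inner_face e (?vn e) \<phi>
          = orientation T e * inner_face e (vn e) \<phi> + c * (orientation T e * inner_face e (wn e) \<phi>)"
        by (simp only: distrib_left mult.left_commute)
    qed
    have "weak_laplacian_functional ?z T \<phi> = inner_elem T (\<lambda>x. v0 T x + c * w0 T x) (laplacian \<phi>)
        - (\<Sum>e\<in>faces_on \<E> T. inner_face e (?vb e) (\<lambda>x. grad \<phi> x \<bullet> outer_normal T e))
        + (\<Sum>e\<in>faces_on \<E> T. orientation T e * inner_face e (?vn e) \<phi>)"
      unfolding weak_laplacian_functional_def add_scaled_def v_eq w_eq case_prod_conv restrict_apply'[OF T] ..
    then show ?thesis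
      unfolding lap trace flux unfolding weak_laplacian_functional_def v_eq w_eq case_prod_conv
        distrib_left right_diff_distrib by linarith
  qed
  let ?Z = "\<lambda>x. \<Delta>\<^sub>w k ?z T x + (-1) * ?D x"
  have Z: "?Z \<in> polys (k - 2)" by (rule polys_add_scaled[OF Lz(1) D])
  have "inner_elem T ?Z ?Z = inner_elem T (\<Delta>\<^sub>w k ?z T) ?Z - inner_elem T ?D ?Z"
    using inner_elem_add_scaled[OF T Lz(1) D Z, of "-1"] by simp
  also have "\<dots> = 0"
    unfolding inner_elem_add_scaled[OF T Lv(1) Lw(1) Z] Lz(2)[OF Z] Lv(2)[OF Z] Lw(2)[OF Z] fun_eq[OF Z]
    by simp
  finally have "?Z = (\<lambda>x. 0)" by (rule inner_elem_null[OF T Z])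
  then have "\<Delta>\<^sub>w k ?z T x + (-1) * ?D x = 0" for x by (rule fun_cong)
  then have "\<Delta>\<^sub>w k ?z T x = ?D x" for x
    by (smt (verit))
  then show ?thesis by (rule ext)
qed

text \<open>The two jumps that the stabilizer penalizes.\<close>

definition normal_jump :: "'n weak_fun \<Rightarrow> (real^'n) set \<Rightarrow> (real^'n) set \<Rightarrow> real^'n \<Rightarrow> real" where
  "normal_jump v T e = (case v of (v0, vb, vn) \<Rightarrow> \<lambda>x. grad (v0 T) x \<bullet> \<n> e - vn e x)"

definition trace_jump :: "nat \<Rightarrow> 'n weak_fun \<Rightarrow> (real^'n) set \<Rightarrow> (real^'n) set \<Rightarrow> real^'n \<Rightarrow> real" where
  "trace_jump k v T e = (case v of (v0, vb, vn) \<Rightarrow> \<lambda>x. Q\<^sub>b k e (v0 T) x - vb e x)"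

lemma stabilizer_eq:
  "stabilizer k \<T> \<E> \<n> v w =
     (\<Sum>T\<in>\<T>. 1 / diameter T * (\<Sum>e\<in>faces_on \<E> T. inner_face e (normal_jump v T e) (normal_jump w T e)))
   + (\<Sum>T\<in>\<T>. 1 / diameter T ^ 3 * (\<Sum>e\<in>faces_on \<E> T. inner_face e (trace_jump k v T e) (trace_jump k w T e)))"
  by (cases v; cases w) (simp add: stabilizer_def inner_bd_def normal_jump_def trace_jump_def)

lemma polys_on_diff: "p \<in> polys_on r e \<Longrightarrow> q \<in> polys_on r e \<Longrightarrow> \<exists>P\<in>polys r. \<forall>x\<in>e. p x - q x = P x"
proof -
  assume "p \<in> polys_on r e" "q \<in> polys_on r e"
  then obtain P Q where "P \<in> polys r" "p = restrict P e" "Q \<in> polys r" "q = restrict Q e"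
    by (auto simp: polys_on_def)
  then show ?thesis
    by (intro bexI[of _ "\<lambda>x. P x + (-1) * Q x"]) (auto intro: polys_add_scaled[of P r Q "-1", simplified])
qed

lemma jump_polynomial:
  assumes v: "v \<in> \<V> k" and T: "T \<in> \<T>" and e: "e \<in> \<E>"
  shows "\<exists>P\<in>polys (k - 1). \<forall>x\<in>e. normal_jump v T e x = P x"
    and "\<exists>P\<in>polys (k - 1). \<forall>x\<in>e. trace_jump k v T e x = P x"
proof -
  obtain v0 vb vn where v_eq: "v = (v0, vb, vn)" by (cases v)
  note V = V\<^sub>hD[OF v[unfolded v_eq]]
  have "restrict (\<lambda>x. grad (v0 T) x \<bullet> \<n> e) e \<in> polys_on (k - 1) e"
    using inner_grad_in_polys[OF V(1)[OF T]] by (auto simp: polys_on_def)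
  from polys_on_diff[OF this V(3)[OF e]]
  show "\<exists>P\<in>polys (k - 1). \<forall>x\<in>e. normal_jump v T e x = P x"
    by (simp add: v_eq normal_jump_def)
  from polys_on_diff[OF Qb(1)[OF e face_fun_polys[OF e V(1)[OF T]]] V(2)[OF e]]
  show "\<exists>P\<in>polys (k - 1). \<forall>x\<in>e. trace_jump k v T e x = P x"
    by (simp add: v_eq trace_jump_def)
qed

lemma face_fun_jump:
  assumes v: "v \<in> \<V> k" and T: "T \<in> \<T>" and e: "e \<in> \<E>"
  shows "normal_jump v T e \<in> face_fun e" and "trace_jump k v T e \<in> face_fun e"
  using jump_polynomial[OF assms] flat_face.bounded_measurable_surface[OF flat_face[OF e] continuous_on_polys]
  by blast+

lemma jump_null:
  assumes v: "v \<in> \<V> k" and T: "T \<in> \<T>" and e: "e \<in> \<E>" and x: "x \<in> e"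
  shows "inner_face e (normal_jump v T e) (normal_jump v T e) = 0 \<Longrightarrow> normal_jump v T e x = 0"
    and "inner_face e (trace_jump k v T e) (trace_jump k v T e) = 0 \<Longrightarrow> trace_jump k v T e x = 0"
proof -
  have null: "f x = 0" if f: "\<exists>P\<in>polys (k - 1). \<forall>x\<in>e. f x = P x" and z: "inner_face e f f = 0" for f
  proof -
    obtain P where P: "P \<in> polys (k - 1)" "\<forall>x\<in>e. f x = P x" using f by blast
    have "inner_face e P P = inner_face e f f" by (rule inner_face_cong[OF e]) (simp_all add: P)
    then have "P x = 0" using inner_face_null[OF e continuous_on_polys[OF P(1)]] z x by simp
    then show ?thesis using P(2) x by simp
  qed
  show "inner_face e (normal_jump v T e) (normal_jump v T e) = 0 \<Longrightarrow> normal_jump v T e x = 0"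
    by (rule null[OF jump_polynomial(1)[OF v T e]])
  show "inner_face e (trace_jump k v T e) (trace_jump k v T e) = 0 \<Longrightarrow> trace_jump k v T e x = 0"
    by (rule null[OF jump_polynomial(2)[OF v T e]])
qed

lemma jump_add_scaled:
  assumes v: "v \<in> \<V> k" and w: "w \<in> \<V> k" and T: "T \<in> \<T>" and e: "e \<in> \<E>" and x: "x \<in> e"
  shows "normal_jump (add_scaled c v w) T e x = normal_jump v T e x + c * normal_jump w T e x"
    and "trace_jump k (add_scaled c v w) T e x = trace_jump k v T e x + c * trace_jump k w T e x"
proof -
  obtain v0 vb vn w0 wb wn where v_eq: "v = (v0, vb, vn)" and w_eq: "w = (w0, wb, wn)"
    by (cases v, cases w)
  note V = V\<^sub>hD(1)[OF v[unfolded v_eq] T] and W = V\<^sub>hD(1)[OF w[unfolded w_eq] T]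
  show "normal_jump (add_scaled c v w) T e x = normal_jump v T e x + c * normal_jump w T e x"
    using T e x
    by (simp add: v_eq w_eq normal_jump_def add_scaled_def grad_add_scaled[OF V W] inner_add_left algebra_simps)
  show "trace_jump k (add_scaled c v w) T e x = trace_jump k v T e x + c * trace_jump k w T e x"
    using T e x
    by (simp add: v_eq w_eq trace_jump_def add_scaled_def algebra_simps
        Qb_add_scaled[OF e face_fun_polys[OF e V] face_fun_polys[OF e W] face_fun_polys[OF e polys_add_scaled[OF V W]] x])
qed

lemma wg_form_commute: "energy k v w = energy k w v"
  by (simp add: wg_form_def stabilizer_eq inner_L2_commute)

lemma wg_form_add_scaled:
  assumes v: "v \<in> \<V> k" and w: "w \<in> \<V> k" and z: "z \<in> \<V> k"
  shows "energy k (add_scaled c v w) z = energy k v z + c * energy k w z"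
proof -
  have L: "inner_elem T (\<Delta>\<^sub>w k (add_scaled c v w) T) (\<Delta>\<^sub>w k z T)
      = inner_elem T (\<Delta>\<^sub>w k v T) (\<Delta>\<^sub>w k z T)
        + c * inner_elem T (\<Delta>\<^sub>w k w T) (\<Delta>\<^sub>w k z T)" if T: "T \<in> \<T>" for T
    unfolding weak_laplacian_add_scaled[OF v w T]
    by (rule inner_elem_add_scaled[OF T weak_laplacian(1)[OF v T] weak_laplacian(1)[OF w T] weak_laplacian(1)[OF z T]])
  have J: "inner_face e h g = inner_face e h1 g + c * inner_face e h2 g"
    if e: "e \<in> \<E>" and h: "\<And>x. x \<in> e \<Longrightarrow> h x = h1 x + c * h2 x"
      and "h1 \<in> face_fun e" "h2 \<in> face_fun e" "g \<in> face_fun e" for e h h1 h2 g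
  proof -
    have "inner_face e h g = inner_face e (\<lambda>x. h1 x + c * h2 x) g"
      by (rule inner_face_cong[OF e]) (simp_all add: h)
    then show ?thesis using inner_face_add_scaled[OF e that(3-5)] by simp
  qed
  have N: "inner_face e (normal_jump (add_scaled c v w) T e) (normal_jump z T e)
      = inner_face e (normal_jump v T e) (normal_jump z T e) + c * inner_face e (normal_jump w T e) (normal_jump z T e)"
    and B: "inner_face e (trace_jump k (add_scaled c v w) T e) (trace_jump k z T e)
      = inner_face e (trace_jump k v T e) (trace_jump k z T e) + c * inner_face e (trace_jump k w T e) (trace_jump k z T e)"
    if T: "T \<in> \<T>" and "e \<in> faces_on \<E> T" for T e
  proof -
    have e: "e \<in> \<E>" using that(2) by (rule faces_onD)
    show "inner_face e (normal_jump (add_scaled c v w) T e) (normal_jump z T e)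
      = inner_face e (normal_jump v T e) (normal_jump z T e) + c * inner_face e (normal_jump w T e) (normal_jump z T e)"
      by (rule J[OF e jump_add_scaled(1)[OF v w T e] face_fun_jump(1)[OF v T e] face_fun_jump(1)[OF w T e] face_fun_jump(1)[OF z T e]])
    show "inner_face e (trace_jump k (add_scaled c v w) T e) (trace_jump k z T e)
      = inner_face e (trace_jump k v T e) (trace_jump k z T e) + c * inner_face e (trace_jump k w T e) (trace_jump k z T e)"
      by (rule J[OF e jump_add_scaled(2)[OF v w T e] face_fun_jump(2)[OF v T e] face_fun_jump(2)[OF w T e] face_fun_jump(2)[OF z T e]])
  qed
  show ?thesis
    unfolding wg_form_def stabilizer_eq
    by (simp add: L N B sum.distrib distrib_left sum_distrib_left mult_ac)
qed

section \<open>Definiteness of the form\<close>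

text \<open>Without jumps, \<open>\<Delta>\<^sub>w v = \<Delta> v\<^sub>0\<close> by Green's second formula, so that a weak function of vanishing energy
  is piecewise harmonic. By Green's first formula its Dirichlet energy is a sum
  over the faces of \<open>\<langle>v\<^sub>n, v\<^sub>b\<rangle>\<close> times the sum of the orientations, and so vanishes: it is piecewise
  constant, without jumps, with zero boundary values.\<close>

lemma wg_form_definite:
  assumes k: "k \<ge> 2" and v: "(v0, vb, vn) \<in> \<V>\<^sub>0 k"
    and zero: "energy k (v0, vb, vn) (v0, vb, vn) = 0"
  shows "\<And>T. T \<in> \<T> \<Longrightarrow> v0 T = (\<lambda>x. 0)"
    and "\<And>e x. e \<in> \<E> \<Longrightarrow> x \<in> e \<Longrightarrow> vb e x = 0 \<and> vn e x = 0"
proof -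
  let ?v = "(v0, vb, vn)"
  have vV: "?v \<in> \<V> k" and bd: "\<And>e x. e \<in> faces_on \<E> \<Omega> \<Longrightarrow> x \<in> e \<Longrightarrow> vb e x = 0 \<and> vn e x = 0"
    using v by (auto simp: V\<^sub>h\<^sub>0_def)
  note V = V\<^sub>hD[OF vV]
  let ?L = "\<lambda>T. inner_elem T (\<Delta>\<^sub>w k ?v T) (\<Delta>\<^sub>w k ?v T)"
  let ?N = "\<lambda>T e. inner_face e (normal_jump ?v T e) (normal_jump ?v T e)"
  let ?B = "\<lambda>T e. inner_face e (trace_jump k ?v T e) (trace_jump k ?v T e)"
  have N0: "0 \<le> 1 / diameter T * (\<Sum>e\<in>faces_on \<E> T. ?N T e)"
    and B0: "0 \<le> 1 / diameter T ^ 3 * (\<Sum>e\<in>faces_on \<E> T. ?B T e)" if "T \<in> \<T>" for T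
    using diameter_elem_pos[OF that] by (simp_all add: sum_nonneg inner_L2_nonneg)
  have "(\<Sum>T\<in>\<T>. ?L T) + ((\<Sum>T\<in>\<T>. 1 / diameter T * (\<Sum>e\<in>faces_on \<E> T. ?N T e))
      + (\<Sum>T\<in>\<T>. 1 / diameter T ^ 3 * (\<Sum>e\<in>faces_on \<E> T. ?B T e))) = 0"
    using zero unfolding wg_form_def stabilizer_eq .
  moreover have "0 \<le> (\<Sum>T\<in>\<T>. ?L T)" by (intro sum_nonneg inner_L2_nonneg)
  moreover have "0 \<le> (\<Sum>T\<in>\<T>. 1 / diameter T * (\<Sum>e\<in>faces_on \<E> T. ?N T e))" by (intro sum_nonneg N0)
  moreover have "0 \<le> (\<Sum>T\<in>\<T>. 1 / diameter T ^ 3 * (\<Sum>e\<in>faces_on \<E> T. ?B T e))" by (intro sum_nonneg B0)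
  ultimately have sums: "(\<Sum>T\<in>\<T>. ?L T) = 0" "(\<Sum>T\<in>\<T>. 1 / diameter T * (\<Sum>e\<in>faces_on \<E> T. ?N T e)) = 0"
      "(\<Sum>T\<in>\<T>. 1 / diameter T ^ 3 * (\<Sum>e\<in>faces_on \<E> T. ?B T e)) = 0" by linarith+
  have wl: "\<Delta>\<^sub>w k ?v T = (\<lambda>x. 0)" if T: "T \<in> \<T>" for T
  proof -
    have "?L T = 0"
      using sum_nonneg_0[OF finite_mesh(1) _ sums(1) T] by (simp add: inner_L2_nonneg)
    then show ?thesis by (rule inner_elem_null[OF T weak_laplacian(1)[OF vV T]])
  qed
  have normal: "grad (v0 T) x \<bullet> \<n> e = vn e x" if T: "T \<in> \<T>" and e: "e \<in> faces_on \<E> T" and x: "x \<in> e" for T e x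
  proof -
    have "1 / diameter T * (\<Sum>e\<in>faces_on \<E> T. ?N T e) = 0"
      using sum_nonneg_0[OF finite_mesh(1) N0 sums(2) T] .
    then have "(\<Sum>e\<in>faces_on \<E> T. ?N T e) = 0" using diameter_elem_pos[OF T] by simp
    then have "?N T e = 0"
      using sum_nonneg_0[OF finite_faces_on _ _ e, of "?N T"] by (simp add: inner_L2_nonneg)
    then show ?thesis
      using jump_null(1)[OF vV T faces_onD[OF e] x] by (simp add: normal_jump_def)
  qed
  have trace: "Q\<^sub>b k e (v0 T) x = vb e x" if T: "T \<in> \<T>" and e: "e \<in> faces_on \<E> T" and x: "x \<in> e" for T e x
  proof -
    have "1 / diameter T ^ 3 * (\<Sum>e\<in>faces_on \<E> T. ?B T e) = 0"
      using sum_nonneg_0[OF finite_mesh(1) B0 sums(3) T] .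
    then have "(\<Sum>e\<in>faces_on \<E> T. ?B T e) = 0" using diameter_elem_pos[OF T] by simp
    then have "?B T e = 0"
      using sum_nonneg_0[OF finite_faces_on _ _ e, of "?B T"] by (simp add: inner_L2_nonneg)
    then show ?thesis
      using jump_null(2)[OF vV T faces_onD[OF e] x] by (simp add: trace_jump_def)
  qed
  \<comment> \<open>\<open>v\<^sub>b\<close> is the projection of \<open>v\<^sub>0\<close>, so they agree when tested with polynomials of degree \<open>k - 1\<close>\<close>
  have project: "inner_face e (vb e) q = inner_face e (v0 T) q"
    if T: "T \<in> \<T>" and e: "e \<in> faces_on \<E> T" and q: "q \<in> polys_on (k - 1) e" for T e q
  proof -
    have eE: "e \<in> \<E>" using e by (rule faces_onD)
    have "inner_face e (vb e) q = inner_face e (Q\<^sub>b k e (v0 T)) q"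
      by (rule inner_face_cong[OF eE]) (simp_all add: trace[OF T e])
    then show ?thesis using Qb(2)[OF eE face_fun_polys[OF eE V(1)[OF T]] q] by simp
  qed
  have flux: "inner_face e (\<lambda>x. grad (v0 T) x \<bullet> outer_normal T e) q = orientation T e * inner_face e (vn e) q"
    if T: "T \<in> \<T>" and e: "e \<in> faces_on \<E> T" for T e q
  proof -
    have "inner_face e (\<lambda>x. grad (v0 T) x \<bullet> outer_normal T e) q
        = inner_face e (\<lambda>x. orientation T e * vn e x) q"
      by (rule inner_face_cong[OF faces_onD[OF e]])
         (simp_all add: orientation(1)[OF T e] normal[OF T e])
    then show ?thesis by (simp add: inner_L2_scale)
  qed
  \<comment> \<open>\<open>\<Delta>\<^sub>w v = \<Delta> v\<^sub>0\<close>, tested with \<open>\<Delta> v\<^sub>0\<close> itself; its normal derivatives are polynomials of degree below \<open>k - 1\<close>\<close>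
  have harmonic: "laplacian (v0 T) = (\<lambda>x. 0)" if T: "T \<in> \<T>" for T
  proof -
    let ?\<phi> = "laplacian (v0 T)"
    have \<phi>: "?\<phi> \<in> polys (k - 2)" by (rule laplacian_in_polys[OF V(1)[OF T]])
    have flux_\<phi>: "inner_face e (vb e) (\<lambda>x. grad ?\<phi> x \<bullet> outer_normal T e)
        = inner_face e (v0 T) (\<lambda>x. grad ?\<phi> x \<bullet> outer_normal T e)" if e: "e \<in> faces_on \<E> T" for e
    proof -
      let ?g = "\<lambda>x. grad ?\<phi> x \<bullet> outer_normal T e"
      have "?g \<in> polys (k - 1)" by (rule polys_mono[OF inner_grad_in_polys[OF \<phi>]]) simp
      then have "restrict ?g e \<in> polys_on (k - 1) e" by (simp add: polys_on_def)
      moreover have "inner_face e f ?g = inner_face e f (restrict ?g e)" for f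
        by (rule inner_face_cong[OF faces_onD[OF e]]) simp_all
      ultimately show ?thesis using project[OF T e] by simp
    qed
    have "inner_elem T ?\<phi> ?\<phi> = weak_laplacian_functional ?v T ?\<phi>"
      unfolding green_second[OF T V(1)[OF T] \<phi>] weak_laplacian_functional_def
      using flux_\<phi> flux[OF T] by simp
    also have "\<dots> = inner_elem T (\<lambda>x. 0) ?\<phi>"
      using weak_laplacian(2)[OF vV T \<phi>] wl[OF T] by simp
    finally have "inner_elem T ?\<phi> ?\<phi> = 0" by (simp add: inner_L2_def)
    then show ?thesis by (rule inner_elem_null[OF T \<phi>])
  qed
  have energy: "dirichlet T (v0 T) (v0 T) = (\<Sum>e\<in>faces_on \<E> T. orientation T e * inner_face e (vn e) (vb e))"
    if T: "T \<in> \<T>" for T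
  proof -
    have "dirichlet T (v0 T) (v0 T)
        = (\<Sum>e\<in>faces_on \<E> T. inner_face e (\<lambda>x. grad (v0 T) x \<bullet> outer_normal T e) (v0 T))"
      using green_first[OF T V(1)[OF T] V(1)[OF T]] harmonic[OF T] by (simp add: inner_L2_def)
    also have "\<dots> = (\<Sum>e\<in>faces_on \<E> T. orientation T e * inner_face e (vn e) (vb e))"
    proof (rule sum.cong[OF refl])
      fix e assume e: "e \<in> faces_on \<E> T"
      have "inner_face e (vn e) (v0 T) = inner_face e (vn e) (vb e)"
        using project[OF T e V(3)[OF faces_onD[OF e]]] by (simp add: inner_L2_commute)
      then show "inner_face e (\<lambda>x. grad (v0 T) x \<bullet> outer_normal T e) (v0 T)
          = orientation T e * inner_face e (vn e) (vb e)"
        using flux[OF T e] by simp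
    qed
    finally show ?thesis .
  qed
  have "(\<Sum>T\<in>\<T>. dirichlet T (v0 T) (v0 T))
      = (\<Sum>T\<in>\<T>. \<Sum>e | e \<in> \<E> \<and> e \<in> faces_on \<E> T. orientation T e * inner_face e (vn e) (vb e))"
    using energy faces_onD by (intro sum.cong) (auto intro!: sum.cong)
  also have "\<dots> = (\<Sum>e\<in>\<E>. \<Sum>T | T \<in> \<T> \<and> e \<in> faces_on \<E> T. orientation T e * inner_face e (vn e) (vb e))"
    by (rule sum.swap_restrict) (use finite_mesh in auto)
  also have "\<dots> = 0"
  proof (rule sum.neutral, rule ballI)
    fix e assume e: "e \<in> \<E>"
    show "(\<Sum>T | T \<in> \<T> \<and> e \<in> faces_on \<E> T. orientation T e * inner_face e (vn e) (vb e)) = 0"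
    proof (cases "e \<in> faces_on \<E> \<Omega>")
      case True
      have "inner_face e (vn e) (vb e) = inner_face e (\<lambda>x. 0) (\<lambda>x. 0)"
        using bd[OF True] by (intro inner_face_cong[OF e]) auto
      then show ?thesis by (simp add: inner_L2_def)
    next
      case False
      then show ?thesis using sum_orientation[OF e False] by (simp add: sum_distrib_right[symmetric])
    qed
  qed
  finally have total: "(\<Sum>T\<in>\<T>. dirichlet T (v0 T) (v0 T)) = 0" .
  have "\<exists>c. v0 T = (\<lambda>x. c)" if T: "T \<in> \<T>" for T
  proof (rule polys_grad_zero_imp_const[OF V(1)[OF T]])
    fix i
    have "dirichlet T (v0 T) (v0 T) = 0"
      using sum_nonneg_0[OF finite_mesh(1) _ total T] by (simp add: dirichlet_def sum_nonneg inner_L2_nonneg)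
    then have "inner_elem T (partial_deriv i (v0 T)) (partial_deriv i (v0 T)) = 0"
      unfolding dirichlet_def
      using sum_nonneg_0[of UNIV "\<lambda>i. inner_elem T (partial_deriv i (v0 T)) (partial_deriv i (v0 T))" i]
      by (simp add: inner_L2_nonneg)
    then show "partial_deriv i (v0 T) = (\<lambda>x. 0)"
      by (rule inner_elem_null[OF T partial_deriv_in_polys[OF V(1)[OF T]]])
  qed
  then obtain c where c: "\<And>T. T \<in> \<T> \<Longrightarrow> v0 T = (\<lambda>x. c T)" by metis
  have vb: "vb e x = c T" if T: "T \<in> \<T>" and e: "e \<in> faces_on \<E> T" and x: "x \<in> e" for T e x
    using trace[OF T e x] Qb_const[OF faces_onD[OF e] x] c[OF T] by simp
  have jump: "(\<Sum>T | T \<in> \<T> \<and> e \<in> faces_on \<E> T. c T * orientation T e) = 0" if e: "e \<in> \<E>" for e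
  proof -
    obtain x where x: "x \<in> e" using face_nonempty[OF e] by blast
    have "(\<Sum>T | T \<in> \<T> \<and> e \<in> faces_on \<E> T. c T * orientation T e)
        = vb e x * (\<Sum>T | T \<in> \<T> \<and> e \<in> faces_on \<E> T. orientation T e)"
      using vb x by (auto simp: sum_distrib_left intro!: sum.cong)
    moreover have "vb e x = 0" if "e \<in> faces_on \<E> \<Omega>" using bd[OF that x] by simp
    ultimately show ?thesis using sum_orientation[OF e] by (cases "e \<in> faces_on \<E> \<Omega>") auto
  qed
  have c0: "c T = 0" if "T \<in> \<T>" for T by (rule piecewise_constant_zero[OF jump that])
  show v0: "v0 T = (\<lambda>x. 0)" if "T \<in> \<T>" for T using c c0 that by simp
  show "vb e x = 0 \<and> vn e x = 0" if e: "e \<in> \<E>" and x: "x \<in> e" for e x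
  proof -
    obtain T where T: "T \<in> \<T>" "e \<in> faces_on \<E> T" using face_on_elem[OF e] by blast
    have "grad (v0 T) x = 0" unfolding v0[OF T(1)] by (simp add: grad_def partial_deriv_def vec_eq_iff)
    then show ?thesis using normal[OF T x] vb[OF T x] c0[OF T(1)] by simp
  qed
qed

section \<open>Equivalence with the Schur complement formulation\<close>

lemma integrable_L2_piecewise:
  assumes f: "f \<in> L2 (lebesgue_on \<Omega>)" and v0: "\<And>T. T \<in> \<T> \<Longrightarrow> v0 T \<in> polys r"
  shows "integrable (lebesgue_on \<Omega>) (\<lambda>x. f x * piecewise \<T> v0 x)"
proof -
  have interior_eq: "\<Omega> = interior (closure \<Omega>)" using domain unfolding polyhedral_domain_def by (elim conjE)
  have "open \<Omega>" using open_interior[of "closure \<Omega>"] by (simp only: interior_eq[symmetric])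
  have "bounded (\<Union>\<T>)" using compact_elem finite_mesh(1) by (auto intro: compact_imp_bounded)
  then have comp: "compact (closure \<Omega>)" unfolding cover compact_eq_bounded_closed by simp
  then have "bounded \<Omega>" by (rule bounded_subset[OF compact_imp_bounded closure_subset])
  then have "\<Omega> \<in> lmeasurable" using \<open>open \<Omega>\<close> by (rule lmeasurable_open)
  then interpret finite_measure "lebesgue_on \<Omega>" by (rule finite_measure_lebesgue_on)
  have meas: "piecewise \<T> v0 \<in> borel_measurable (lebesgue_on \<Omega>)"
  proof (intro measurable_restrict_space1 measurable_completion)
    have "v0 T \<in> borel_measurable lborel" if "T \<in> \<T>" for T
      using borel_measurable_continuous_onI[OF continuous_on_polys[OF v0[OF that]]] by simp
    moreover have "(indicator (interior T) :: real^'n \<Rightarrow> real) \<in> borel_measurable lborel" for T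
      by simp
    ultimately show "piecewise \<T> v0 \<in> borel_measurable lborel"
      unfolding piecewise_def[abs_def] by (intro borel_measurable_sum borel_measurable_times)
  qed
  have "\<exists>C. \<forall>x\<in>closure \<Omega>. \<bar>v0 T x\<bar> \<le> C" if "T \<in> \<T>" for T
    using compact_imp_bounded[OF compact_continuous_image[OF continuous_on_polys[OF v0[OF that]] comp]]
    by (auto simp: bounded_iff)
  then have "\<forall>T\<in>\<T>. \<exists>C. \<forall>x\<in>closure \<Omega>. \<bar>v0 T x\<bar> \<le> C" by blast
  from bchoice[OF this] obtain C where C: "\<And>T x. T \<in> \<T> \<Longrightarrow> x \<in> closure \<Omega> \<Longrightarrow> \<bar>v0 T x\<bar> \<le> C T"
    by blast
  have bound: "\<bar>piecewise \<T> v0 x\<bar> \<le> (\<Sum>T\<in>\<T>. \<bar>C T\<bar>)" if "x \<in> \<Omega>" for x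
    unfolding piecewise_def
  proof (rule order_trans[OF sum_abs sum_mono])
    fix T assume "T \<in> \<T>"
    moreover have "x \<in> closure \<Omega>" using that closure_subset by blast
    ultimately show "\<bar>indicator (interior T) x * v0 T x\<bar> \<le> \<bar>C T\<bar>"
      using C[of T x] by (auto simp: indicator_def)
  qed
  let ?K = "\<Sum>T\<in>\<T>. \<bar>C T\<bar>"
  have "integrable (lebesgue_on \<Omega>) (\<lambda>x. ((f x)\<^sup>2 + 1) * ?K)"
    using f by (auto simp: L2_def)
  then show ?thesis
  proof (rule Bochner_Integration.integrable_bound)
    show "(\<lambda>x. f x * piecewise \<T> v0 x) \<in> borel_measurable (lebesgue_on \<Omega>)"
      using f meas by (auto simp: L2_def)
    show "AE x in lebesgue_on \<Omega>. norm (f x * piecewise \<T> v0 x) \<le> norm (((f x)\<^sup>2 + 1) * ?K)"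
    proof (rule AE_I2)
      fix x assume "x \<in> space (lebesgue_on \<Omega>)"
      then have x: "x \<in> \<Omega>" by simp
      \<comment> \<open>on a set of finite measure this makes square integrable functions integrable\<close>
      have "\<bar>f x\<bar> \<le> (f x)\<^sup>2 + 1"
        using zero_le_power2[of "\<bar>f x\<bar> - 1"] by (simp add: power2_diff)
      then have "\<bar>f x\<bar> * \<bar>piecewise \<T> v0 x\<bar> \<le> ((f x)\<^sup>2 + 1) * ?K"
        using bound[OF x] by (intro mult_mono) auto
      then show "norm (f x * piecewise \<T> v0 x) \<le> norm (((f x)\<^sup>2 + 1) * ?K)"
        by (simp add: abs_mult sum_nonneg)
    qed
  qed
qed

text \<open>A test function is the sum of its face part, tested by the global equation, and of its parts on the
  single elements, tested by the local systems.\<close>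

lemma schur_complement_imp_wg:
  assumes f: "f \<in> L2 (lebesgue_on \<Omega>)" and w: "w \<in> \<V> k"
    and global: "\<forall>vb vn. (zero_elem \<T>, vb, vn) \<in> \<V>\<^sub>0 k \<longrightarrow>
      energy k w (zero_elem \<T>, vb, vn) = 0"
    and local: "\<forall>T\<in>\<T>. \<forall>v0. (v0, zero_face \<E>, zero_face \<E>) \<in> V\<^sub>h_local k \<Omega> \<T> \<E> T \<longrightarrow>
      energy k w (v0, zero_face \<E>, zero_face \<E>)
        = inner_L2 (lebesgue_on \<Omega>) f (piecewise \<T> v0)"
    and z: "(z0, zb, zn) \<in> \<V>\<^sub>0 k"
  shows "energy k w (z0, zb, zn) = inner_L2 (lebesgue_on \<Omega>) f (piecewise \<T> z0)"
proof -
  have zV: "(z0, zb, zn) \<in> \<V> k" using z by (auto simp: V\<^sub>h\<^sub>0_def)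
  note V = V\<^sub>hD[OF zV]
  have ext: "z0 \<in> extensional \<T>" "zb \<in> extensional \<E>" "zn \<in> extensional \<E>"
    using zV by (auto simp: V\<^sub>h_def PiE_def)
  have ext': "zb e \<in> extensional e" "zn e \<in> extensional e" if "e \<in> \<E>" for e
    using V(2,3)[OF that] by (auto simp: polys_on_def)
  have zf: "restrict (\<lambda>x. 0) e \<in> polys_on (k - 1) e" for e :: "(real^'n) set"
    unfolding polys_on_def using polys_zero by blast
  define part where "part S = (\<lambda>T\<in>\<T>. if T \<in> S then z0 T else (\<lambda>x. 0))" for S
  let ?f = "inner_L2 (lebesgue_on \<Omega>) f"
  let ?p = "\<lambda>S. (part S, zero_face \<E>, zero_face \<E>)"
  have part_polys: "part S T \<in> polys k" if "T \<in> \<T>" for S T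
    using that V(1) polys_zero by (auto simp: part_def)
  have partV: "?p S \<in> \<V>\<^sub>0 k" for S
    using part_polys zf by (auto simp: V\<^sub>h\<^sub>0_def V\<^sub>h_def zero_face_def part_def dest: faces_onD)
  then have partV': "?p S \<in> \<V> k" for S by (auto simp: V\<^sub>h\<^sub>0_def)
  have faceV: "(zero_elem \<T>, zb, zn) \<in> \<V>\<^sub>0 k"
    using z polys_zero by (auto simp: V\<^sub>h\<^sub>0_def V\<^sub>h_def zero_elem_def)
  have form_add: "energy k w (add_scaled c p q) = energy k w p + c * energy k w q"
    if "p \<in> \<V> k" "q \<in> \<V> k" for c p q
    using wg_form_add_scaled[OF that w, of c] by (simp only: wg_form_commute[of k w])
  have elems: "energy k w (?p S)
      = ?f (piecewise \<T> (part S))" if "finite S" "S \<subseteq> \<T>" for S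
    using that
  proof (induction S rule: finite_induct)
    case empty
    have "part {} = zero_elem \<T>" by (auto simp: part_def zero_elem_def)
    moreover have "piecewise \<T> (zero_elem \<T>) = (\<lambda>x. 0)"
      by (simp add: piecewise_def zero_elem_def fun_eq_iff)
    moreover have "(zero_elem \<T>, zero_face \<E>, zero_face \<E>) \<in> \<V>\<^sub>0 k"
      using partV[of "{}"] calculation(1) by simp
    ultimately show ?case using global by (simp add: inner_L2_def)
  next
    case (insert T S)
    have "?p {T} \<in> V\<^sub>h_local k \<Omega> \<T> \<E> T"
      using partV[of "{T}"] by (auto simp: V\<^sub>h_local_def part_def zero_face_def)
    then have single: "energy k w (?p {T})
        = ?f (piecewise \<T> (part {T}))"
      using local insert.prems by blast
    have "add_scaled 1 (?p S) (?p {T})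
        = ?p (insert T S)"
      using insert.hyps by (auto simp: add_scaled_def part_def zero_face_def fun_eq_iff)
    then have "energy k w (?p (insert T S))
        = energy k w (?p S)
          + energy k w (?p {T})"
      using form_add[OF partV'[of S] partV'[of "{T}"], of 1] by simp
    also have "\<dots> = ?f (piecewise \<T> (part S))
        + ?f (piecewise \<T> (part {T}))"
      using insert.IH insert.prems single by simp
    also have "\<dots> = (\<integral>x. f x * piecewise \<T> (part S) x + f x * piecewise \<T> (part {T}) x \<partial>lebesgue_on \<Omega>)"
      unfolding inner_L2_def
      by (rule Bochner_Integration.integral_add[symmetric]) (rule integrable_L2_piecewise[OF f], erule part_polys)+
    also have "\<dots> = ?f (piecewise \<T> (part (insert T S)))"
      unfolding inner_L2_def
    proof (rule Bochner_Integration.integral_cong[OF refl])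
      fix x
      have "part S T' x + part {T} T' x = part (insert T S) T' x" if "T' \<in> \<T>" for T'
        using insert.hyps that by (auto simp: part_def)
      then have "piecewise \<T> (part S) x + piecewise \<T> (part {T}) x = piecewise \<T> (part (insert T S)) x"
        unfolding piecewise_def sum.distrib[symmetric] distrib_left[symmetric] by (intro sum.cong) auto
      then show "f x * piecewise \<T> (part S) x + f x * piecewise \<T> (part {T}) x
          = f x * piecewise \<T> (part (insert T S)) x"
        by (simp only: distrib_left[symmetric])
    qed
    finally show ?case .
  qed
  have part_all: "part \<T> = z0"
    using ext(1) by (auto simp: part_def fun_eq_iff extensional_def)
  have "add_scaled 1 (z0, zero_face \<E>, zero_face \<E>) (zero_elem \<T>, zb, zn) = (z0, zb, zn)"
  proof -
    have "(\<lambda>T\<in>\<T>. \<lambda>x. z0 T x + 1 * zero_elem \<T> T x) = z0"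
      using ext(1) by (auto simp: zero_elem_def fun_eq_iff extensional_def)
    moreover have "(\<lambda>e\<in>\<E>. \<lambda>x\<in>e. zero_face \<E> e x + 1 * q e x) = q"
      if "q \<in> extensional \<E>" "\<And>e. e \<in> \<E> \<Longrightarrow> q e \<in> extensional e" for q :: "'n elem_fun"
    proof (rule extensionalityI[of _ \<E>])
      fix e assume e: "e \<in> \<E>"
      show "(\<lambda>e\<in>\<E>. \<lambda>x\<in>e. zero_face \<E> e x + 1 * q e x) e = q e"
        by (rule extensionalityI[of _ e]) (use that e in \<open>auto simp: zero_face_def\<close>)
    qed (use that in auto)
    ultimately show ?thesis using ext ext' by (simp add: add_scaled_def)
  qed
  then have "energy k w (z0, zb, zn) = energy k w (z0, zero_face \<E>, zero_face \<E>)
      + energy k w (zero_elem \<T>, zb, zn)"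
    using form_add[of "(z0, zero_face \<E>, zero_face \<E>)" "(zero_elem \<T>, zb, zn)" 1] partV'[of \<T>] faceV
    by (auto simp: part_all V\<^sub>h\<^sub>0_def)
  then show ?thesis
    using elems[OF finite_mesh(1) subset_refl] global faceV by (simp add: part_all)
qed

end

theorem theorem4p2:
  fixes k :: nat
    and \<Omega> :: "(real^'n) set"
    and \<T> \<E> :: "(real^'n) set set"
    and \<n> :: "(real^'n) set \<Rightarrow> real^'n"
    and f g gn :: "real^'n \<Rightarrow> real"
    and u w :: "'n weak_fun"
  assumes dim: "CARD('n) = 2 \<or> CARD('n) = 3"
    and k: "k \<ge> 2"
    and domain: "polyhedral_domain \<Omega>"
    and mesh: "polyhedral_mesh \<Omega> \<T> \<E>"
    and regular: "shape_regular \<T> \<E>"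
    and normals: "\<forall>e\<in>\<E>. unit_normal e (\<n> e)"
    and f: "f \<in> L2 (lebesgue_on \<Omega>)"
    and g: "\<forall>e\<in>faces_on \<E> \<Omega>. g \<in> L2 (surface_measure e)"
    and gn: "\<forall>e\<in>faces_on \<E> \<Omega>. gn \<in> L2 (surface_measure e)"
    and u_space: "u \<in> V\<^sub>h k \<T> \<E>"
    and u_boundary: "boundary_values k \<Omega> \<E> \<n> g gn u"
    and u_equation: "\<forall>v0 vb vn. (v0, vb, vn) \<in> V\<^sub>h\<^sub>0 k \<Omega> \<T> \<E> \<longrightarrow>
      wg_form k \<T> \<E> \<n> u (v0, vb, vn) = inner_L2 (lebesgue_on \<Omega>) f (piecewise \<T> v0)"
    and w_space: "w \<in> V\<^sub>h k \<T> \<E>"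
    and w_boundary: "boundary_values k \<Omega> \<E> \<n> g gn w"
    and w_global: "\<forall>vb vn. (zero_elem \<T>, vb, vn) \<in> V\<^sub>h\<^sub>0 k \<Omega> \<T> \<E> \<longrightarrow>
      wg_form k \<T> \<E> \<n> w (zero_elem \<T>, vb, vn) = 0"
    and w_local: "\<forall>T\<in>\<T>. \<forall>v0. (v0, zero_face \<E>, zero_face \<E>) \<in> V\<^sub>h_local k \<Omega> \<T> \<E> T \<longrightarrow>
      wg_form k \<T> \<E> \<n> w (v0, zero_face \<E>, zero_face \<E>)
        = inner_L2 (lebesgue_on \<Omega>) f (piecewise \<T> v0)"
  shows "w = u"
proof -
  interpret wg_mesh \<Omega> \<T> \<E> \<n>
    by standard (use dim domain mesh regular normals in auto)
  obtain w0 wb wn u0 ub un where w_eq: "w = (w0, wb, wn)" and u_eq: "u = (u0, ub, un)"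
    by (cases w, cases u)
  obtain d0 db dn where d_eq: "add_scaled (-1) w u = (d0, db, dn)"
    by (cases "add_scaled (-1) w u")
  have dV: "(d0, db, dn) \<in> V\<^sub>h k \<T> \<E>"
    using V\<^sub>h_add_scaled[OF w_space u_space, of "-1"] by (simp only: d_eq)
  have d0: "d0 T x = w0 T x - u0 T x" if "T \<in> \<T>" for T x
    using d_eq that by (auto simp: add_scaled_def w_eq u_eq)
  have db: "db e x = wb e x - ub e x" "dn e x = wn e x - un e x" if "e \<in> \<E>" "x \<in> e" for e x
    using d_eq that by (auto simp: add_scaled_def w_eq u_eq)
  have dV0: "(d0, db, dn) \<in> V\<^sub>h\<^sub>0 k \<Omega> \<T> \<E>"
    using dV u_boundary w_boundary faces_onD
    by (auto simp: V\<^sub>h\<^sub>0_def boundary_values_def w_eq u_eq db)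
  have "wg_form k \<T> \<E> \<n> (d0, db, dn) (d0, db, dn)
      = wg_form k \<T> \<E> \<n> w (d0, db, dn) - wg_form k \<T> \<E> \<n> u (d0, db, dn)"
    using wg_form_add_scaled[OF w_space u_space dV, of "-1"] by (simp add: d_eq)
  also have "\<dots> = 0"
    using schur_complement_imp_wg[OF f w_space w_global w_local dV0] u_equation dV0 by simp
  finally have zero: "wg_form k \<T> \<E> \<n> (d0, db, dn) (d0, db, dn) = 0" .
  have "(w0, wb, wn) = (u0, ub, un)"
  proof (rule V\<^sub>h_eqI[OF w_space[unfolded w_eq] u_space[unfolded u_eq]])
    show "w0 T = u0 T" if "T \<in> \<T>" for T
      using wg_form_definite(1)[OF k dV0 zero that] d0[OF that] by (auto simp: fun_eq_iff)
    show "wb e x = ub e x \<and> wn e x = un e x" if "e \<in> \<E>" "x \<in> e" for e x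
      using wg_form_definite(2)[OF k dV0 zero that] db[OF that] by simp
  qed
  then show ?thesis by (simp only: w_eq u_eq)
qed

end
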